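(* Let $G$ be a finite group, let $p$ be the smallest prime divisor of $|G|$ and let $P$ be a Sylow $p$-subgroup of $G$. Suppose that either $P$ is cyclic, or $P$ has a subgroup $D$ with $1<|D|<|P|$ such that: (i) every subgroup $H$ of $P$ of order $|D|$ is an $\mathscr{H}C$-subgroup of $G$; and (ii) when $p=2$ and $|P:D|>2$, every subgroup $H$ of $P$ for which there exists $D_1\unlhd H$ such that $2|D_1|=|D|$ and $H/D_1$ is a cyclic group of order $4$ is also an $\mathscr{H}C$-subgroup of $G$. Then $G$ is $p$-nilpotent.
   Context: All groups are finite. A subgroup $H$ of a group $G$ is an $\mathscr{H}C$-subgroup of $G$ if there exists a normal subgroup $T$ of $G$ such that $G=HT$ and $H^g\cap N_T(H)\leq H$ for all $g\in G$, where $N_T(H)=T\cap N_G(H)$ and $H^g=g^{-1}Hg$. A group is $p$-nilpotent if it has a normal $p$-complement, i.e. a normal subgroup of order prime to $p$ whose index is a power of $p$. *)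

theory Defs
  imports "HOL-Algebra.Algebra"
begin

definition conj_subgroup :: "('a, 'b) monoid_scheme \<Rightarrow> 'a set \<Rightarrow> 'a \<Rightarrow> 'a set"
  where "conj_subgroup G H g = inv\<^bsub>G\<^esub> g <#\<^bsub>G\<^esub> H #>\<^bsub>G\<^esub> g"

definition subgroup_index :: "('a, 'b) monoid_scheme \<Rightarrow> 'a set \<Rightarrow> nat"
  where "subgroup_index G H = card (rcosets\<^bsub>G\<^esub> H)"

definition HC_subgroup :: "'a set \<Rightarrow> ('a, 'b) monoid_scheme \<Rightarrow> bool"
  where "HC_subgroup H G \<longleftrightarrow>
    subgroup H G \<and>
    (\<exists>T. T \<lhd> G \<and> carrier G = H <#>\<^bsub>G\<^esub> T \<and>
      (\<forall>g \<in> carrier G. conj_subgroup G H g \<inter> (T \<inter> normalizer G H) \<subseteq> H))"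

definition sylow_subgroup :: "nat \<Rightarrow> 'a set \<Rightarrow> ('a, 'b) monoid_scheme \<Rightarrow> bool"
  where "sylow_subgroup p P G \<longleftrightarrow>
    subgroup P G \<and> card P = p ^ multiplicity p (order G)"

definition p_nilpotent :: "nat \<Rightarrow> ('a, 'b) monoid_scheme \<Rightarrow> bool"
  where "p_nilpotent p G \<longleftrightarrow>
    (\<exists>N. N \<lhd> G \<and> coprime (card N) p \<and> (\<exists>k. subgroup_index G N = p ^ k))"

end

(* Let K be the subgroup generated by the p'-elements of G and Q = P Int K, which is a Sylow
   p-subgroup of K; G is p-nilpotent iff Q = 1. K has no nontrivial homomorphism to Z/p, so by
   transfer and Alperin's fusion argument there is no nonzero character Q -> Z/p that is respected
   by every p'-element of K normalizing a subgroup of Q. As |G| is coprime to p - 1, this already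
   excludes a subgroup of index p in Q that is strongly closed in Q with respect to K, which settles
   cyclic P.

   The supplement T of an HC-subgroup H contains K. Hence H Int K is strongly closed if H is normal
   in P, and H is strongly closed if H <= Q. Write |D| = p^d.

   If |Q| <= p^(d+1), take R <= Q of index p and normal in P. A Gaschuetz averaging argument yields
   S <= P with S Int K = R and |P : S| = p, and any H normal in P with R <= H <= S and |H| = p^d
   shows that R is strongly closed.

   If |Q| > p^(d+1), choose e >= d maximal such that all subgroups of Q of order p^e are strongly
   closed; then p^e < |Q|/p. Noncyclic subgroups of order p^(e+1) are unions of subgroups of order
   p^e, so there is a cyclic one (and e >= 2 if p = 2, by hypothesis (ii)). It follows that every
   p'-element of K normalizing a subgroup of Q centralizes it, so all characters of Q are respected. *)

theory Submission
  imports Defs "HOL-Number_Theory.Residues"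
begin

section \<open>Conjugation, cosets and fixed points\<close>

text \<open>The HC condition restrains only those conjugates of elements of H that lie in T and
  normalize H. As T contains K it says something about K-fusion, but it becomes strong closure only
  once the elements of Q are known to normalize H. A subgroup H of order |D| outside K enters only
  through H Int K, whose order is not under control; this is why small Q calls for a complement S
  modulo R, which forces H Int K = R.

  The number p - 1 is the order of Aut(Z/p). Since p is the smallest prime divisor of |G|, it is
  prime to |G|, so conjugation that preserves the kernel of a character to Z/p preserves the
  character itself. In this way strong closure of subgroups turns into stability of characters.

  Order 4 enters because a p'-automorphism of a p-group that fixes all elements of order p is
  trivial for odd p only: the quaternion group of order 8 has an automorphism of order 3 fixing its
  involution. Hypothesis (ii) covers the cyclic subgroups of order 2|D|, with D_1 the subgroup of
  index 4.\<close>

definition conj_by :: "('a, 'b) monoid_scheme \<Rightarrow> 'a \<Rightarrow> 'a \<Rightarrow> 'a"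
  where "conj_by G g x = inv\<^bsub>G\<^esub> g \<otimes>\<^bsub>G\<^esub> x \<otimes>\<^bsub>G\<^esub> g"

definition invariant :: "('a, 'b) monoid_scheme \<Rightarrow> 'a set \<Rightarrow> 'a set \<Rightarrow> bool"
  where "invariant G K C \<longleftrightarrow> (\<forall>g\<in>K. \<forall>x\<in>C. conj_by G g x \<in> C)"

text \<open>Only an inclusion is asked for; for subsets of a finite group it is an equality
  (\<open>normalizer_in_image\<close>).\<close>

definition normalizer_in :: "('a, 'b) monoid_scheme \<Rightarrow> 'a set \<Rightarrow> 'a set \<Rightarrow> 'a set"
  where "normalizer_in G K C = {g \<in> K. \<forall>x\<in>C. conj_by G g x \<in> C}"

text \<open>Subgroups stay subsets of the one group G instead of becoming groups with a changed
  carrier, so that nested subgroups share all operations.\<close>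

definition cosets_in :: "('a, 'b) monoid_scheme \<Rightarrow> 'a set \<Rightarrow> 'a set \<Rightarrow> 'a set set"
  where "cosets_in G K H = (\<lambda>x. H #>\<^bsub>G\<^esub> x) ` K"

definition sylow_in :: "('a, 'b) monoid_scheme \<Rightarrow> nat \<Rightarrow> 'a set \<Rightarrow> 'a set \<Rightarrow> bool"
  where "sylow_in G p Q K \<longleftrightarrow> subgroup Q G \<and> subgroup K G \<and> Q \<subseteq> K \<and>
    (\<exists>n m. card Q = p ^ n \<and> card K = m * p ^ n \<and> \<not> p dvd m)"

locale finite_group_prime = group G for G (structure) +
  fixes p :: nat
  assumes fin: "finite (carrier G)" and prime_p: "Factorial_Ring.prime p"
begin

abbreviation cj where "cj \<equiv> conj_by G"

lemma p_gt_1: "p > 1"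
  using prime_p prime_gt_1_nat by blast

lemma cj_closed [simp, intro]: "g \<in> carrier G \<Longrightarrow> x \<in> carrier G \<Longrightarrow> cj g x \<in> carrier G"
  by (simp add: conj_by_def)

lemma cj_one [simp]: "x \<in> carrier G \<Longrightarrow> cj \<one> x = x"
  by (simp add: conj_by_def)

lemma cj_one_right [simp]: "g \<in> carrier G \<Longrightarrow> cj g \<one> = \<one>"
  by (simp add: conj_by_def)

lemma cj_mult: "\<lbrakk>g \<in> carrier G; x \<in> carrier G; y \<in> carrier G\<rbrakk> \<Longrightarrow> cj g (x \<otimes> y) = cj g x \<otimes> cj g y"
  unfolding conj_by_def by (smt (verit, ccfv_threshold) inv_closed m_assoc m_closed r_inv r_one)

lemma cj_cj: "\<lbrakk>g \<in> carrier G; h \<in> carrier G; x \<in> carrier G\<rbrakk> \<Longrightarrow> cj h (cj g x) = cj (g \<otimes> h) x"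
  by (simp add: conj_by_def m_assoc inv_mult_group)

lemma cj_cj_inv [simp]: "\<lbrakk>g \<in> carrier G; x \<in> carrier G\<rbrakk> \<Longrightarrow> cj (inv g) (cj g x) = x"
  by (simp add: cj_cj)

lemma cj_eq_iff: "\<lbrakk>g \<in> carrier G; x \<in> carrier G; y \<in> carrier G\<rbrakk> \<Longrightarrow> cj g x = cj g y \<longleftrightarrow> x = y"
  by (metis cj_cj_inv)

lemma cj_inj_on: "g \<in> carrier G \<Longrightarrow> A \<subseteq> carrier G \<Longrightarrow> inj_on (cj g) A"
  by (auto simp: inj_on_def subset_iff cj_eq_iff)

lemma cj_inv: "\<lbrakk>g \<in> carrier G; x \<in> carrier G\<rbrakk> \<Longrightarrow> cj g (inv x) = inv (cj g x)"
  by (simp add: conj_by_def inv_mult_group m_assoc)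

lemma cj_pow: "\<lbrakk>g \<in> carrier G; x \<in> carrier G\<rbrakk> \<Longrightarrow> cj g (x [^] (n::nat)) = cj g x [^] n"
  by (induction n) (simp_all add: cj_mult)

lemma mult_cj: "\<lbrakk>g \<in> carrier G; x \<in> carrier G\<rbrakk> \<Longrightarrow> g \<otimes> cj g x = x \<otimes> g"
  by (simp add: conj_by_def m_assoc[symmetric])

lemma cj_cj_dist:
  "\<lbrakk>g \<in> carrier G; h \<in> carrier G; x \<in> carrier G\<rbrakk> \<Longrightarrow> cj g (cj h x) = cj (cj g h) (cj g x)"
  by (simp add: cj_cj mult_cj)

section \<open>Subgroups of a finite group\<close>

lemma finite_sub: "A \<subseteq> carrier G \<Longrightarrow> finite A"
  using fin finite_subset by blast

lemma subgroup_sub: "subgroup H G \<Longrightarrow> H \<subseteq> carrier G"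
  by (rule subgroup.subset)

lemma finite_subgroup: "subgroup H G \<Longrightarrow> finite H"
  using finite_sub subgroup_sub by blast

lemma card_subgroup_pos: "subgroup H G \<Longrightarrow> card H > 0"
  using subgroup.finite_imp_card_positive fin by blast

lemma subgroup_pow: "subgroup H G \<Longrightarrow> x \<in> H \<Longrightarrow> x [^] (n::nat) \<in> H"
  by (induction n) (auto simp: subgroup.one_closed subgroup.m_closed)

lemma subgroup_cj: "subgroup H G \<Longrightarrow> g \<in> H \<Longrightarrow> x \<in> H \<Longrightarrow> cj g x \<in> H"
  by (simp add: conj_by_def subgroup.m_closed subgroup.m_inv_closed)

lemma pow_card_eq_one:
  assumes "subgroup H G" "x \<in> H"
  shows "x [^] card H = \<one>"
proof -
  have "group (G\<lparr>carrier := H\<rparr>)" using assms(1) by (rule subgroup_imp_group)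
  from group.pow_order_eq_1[OF this, of x] assms(2)
  show ?thesis by (simp add: order_def nat_pow_consistent[symmetric])
qed

lemma inv_as_pow:
  assumes "x \<in> carrier G"
  shows "\<exists>n::nat. inv x = x [^] n"
proof -
  have pos: "order G > 0" using order_gt_0_iff_finite fin by blast
  have "x [^] (order G - 1) \<otimes> x = x [^] Suc (order G - 1)" by simp
  also have "\<dots> = \<one>" using pos assms pow_order_eq_1 by simp
  finally have "inv x = x [^] (order G - 1)"
    using assms by (intro inv_equality) auto
  then show ?thesis by blast
qed

text \<open>Inverses are powers by finiteness, so closure under products is enough.\<close>

lemma finite_submonoid_subgroup:
  assumes "H \<subseteq> carrier G" "\<one> \<in> H" "\<And>x y. x \<in> H \<Longrightarrow> y \<in> H \<Longrightarrow> x \<otimes> y \<in> H"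
  shows "subgroup H G"
proof -
  have pw: "x [^] (n::nat) \<in> H" if "x \<in> H" for x n
    using that assms by (induction n) auto
  show ?thesis
  proof (rule subgroupI)
    show "inv a \<in> H" if "a \<in> H" for a
      using inv_as_pow[of a] pw[OF that] assms(1) that by (metis subsetD)
  qed (use assms in auto)
qed

lemma normalizer_in_subgroup:
  assumes "subgroup K G" "C \<subseteq> carrier G"
  shows "subgroup (normalizer_in G K C) G"
proof (rule finite_submonoid_subgroup)
  fix x y assume "x \<in> normalizer_in G K C" "y \<in> normalizer_in G K C"
  then show "x \<otimes> y \<in> normalizer_in G K C"
    using assms subgroup_sub[OF assms(1)]
    by (auto simp: normalizer_in_def subgroup.m_closed subset_iff cj_cj[symmetric])
qed (use assms subgroup_sub[OF assms(1)] in \<open>auto simp: normalizer_in_def subgroup.one_closed subset_iff\<close>)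

lemma normalizer_in_image:
  assumes "g \<in> normalizer_in G K C" "K \<subseteq> carrier G" "C \<subseteq> carrier G"
  shows "cj g ` C = C"
proof (rule card_subset_eq)
  show "finite C" using assms finite_sub by blast
  show "cj g ` C \<subseteq> C" using assms by (auto simp: normalizer_in_def)
  show "card (cj g ` C) = card C"
    using assms by (intro card_image cj_inj_on) (auto simp: normalizer_in_def)
qed

lemma lagrange_in:
  assumes "subgroup H G" "subgroup K G" "H \<subseteq> K"
  shows "card (cosets_in G K H) * card H = card K"
proof -
  have "group (G\<lparr>carrier := K\<rparr>)" "subgroup H (G\<lparr>carrier := K\<rparr>)"
    using assms subgroup_imp_group subgroup_incl by blast+
  from group.lagrange[OF this] show ?thesis
    by (simp add: order_def cosets_in_def RCOSETS_def UNION_singleton_eq_range)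
qed

lemma card_dvd:
  assumes "subgroup H G" "subgroup K G" "H \<subseteq> K"
  shows "card H dvd card K"
  using lagrange_in[OF assms] by (metis dvd_triv_right)

lemma subgroup_psubset_card:
  assumes "subgroup H G" "subgroup K G" "H \<subseteq> K" "card K \<le> card H"
  shows "H = K"
  using assms finite_subgroup card_seteq by blast

lemma card_p_power_sub:
  assumes "subgroup H G" "subgroup K G" "H \<subseteq> K" "card K = p ^ n"
  shows "\<exists>k\<le>n. card H = p ^ k"
  using card_dvd[OF assms(1-3)] assms(4) divides_primepow_nat[OF prime_p] by auto

lemma rcos_eq_iff:
  assumes "subgroup H G" "x \<in> carrier G" "y \<in> carrier G"
  shows "H #> x = H #> y \<longleftrightarrow> x \<otimes> inv y \<in> H"
  using assms by (metis coset_join1 coset_join2 coset_mult_inv1 coset_mult_inv2 inv_closed m_closed subgroup_sub)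

text \<open>Right actions, so that conjugation and right translation of cosets fit without inverses.\<close>

lemma p_group_fixed_points:
  assumes H: "subgroup H G" "card H = p ^ k" and E: "finite E"
    and cl: "\<And>h x. h \<in> H \<Longrightarrow> x \<in> E \<Longrightarrow> act h x \<in> E"
    and one: "\<And>x. x \<in> E \<Longrightarrow> act \<one> x = x"
    and comp: "\<And>h h' x. h \<in> H \<Longrightarrow> h' \<in> H \<Longrightarrow> x \<in> E \<Longrightarrow> act (h \<otimes> h') x = act h' (act h x)"
  shows "[card E = card {x \<in> E. \<forall>h\<in>H. act h x = x}] (mod p)"
proof -
  let ?H = "G\<lparr>carrier := H\<rparr>"
  \<comment> \<open>The library acts from the left, hence \<open>inv h\<close>; the restriction to E
    makes the map extensional, as membership in \<open>Bij\<close> demands.\<close>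
  define \<phi> where "\<phi> = (\<lambda>h. \<lambda>x\<in>E. act (inv h) x)"
  have grpH: "group ?H" using H subgroup_imp_group by blast
  have Hc: "h \<in> H \<Longrightarrow> h \<in> carrier G" for h
    using subgroup_sub[OF H(1)] by blast
  have Hi: "h \<in> H \<Longrightarrow> inv h \<in> H" for h
    using subgroup.m_inv_closed[OF H(1)] by blast
  have inverse: "act (inv h) (act h x) = x" if "h \<in> H" "x \<in> E" for h x
    using comp[OF that(1) Hi[OF that(1)] that(2)] one[OF that(2)] r_inv[OF Hc[OF that(1)]] by metis
  have inverse': "act h (act (inv h) x) = x" if "h \<in> H" "x \<in> E" for h x
    using comp[OF Hi[OF that(1)] that] one[OF that(2)] l_inv[OF Hc[OF that(1)]] by metis
  have bij: "\<phi> h \<in> Bij E" if h: "h \<in> H" for h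
  proof -
    have "bij_betw (\<phi> h) E E"
      by (rule bij_betwI[where g = "act h"])
        (use h in \<open>auto simp: \<phi>_def cl Hi inverse inverse'\<close>)
    then show ?thesis by (simp add: Bij_def \<phi>_def)
  qed
  have "\<phi> \<in> hom ?H (BijGroup E)"
  proof (rule homI)
    fix h h' assume h: "h \<in> carrier ?H" "h' \<in> carrier ?H"
    have "\<phi> (h \<otimes> h') = compose E (\<phi> h) (\<phi> h')"
      using h comp[of "inv h'" "inv h"] cl Hi Hc
      by (auto simp: \<phi>_def compose_def inv_mult_group fun_eq_iff)
    with h bij show "\<phi> (h \<otimes>\<^bsub>?H\<^esub> h') = \<phi> h \<otimes>\<^bsub>BijGroup E\<^esub> \<phi> h'"
      by (simp add: BijGroup_def)
  qed (use bij in \<open>auto simp: BijGroup_def\<close>)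
  then interpret A: group_action ?H E \<phi>
    using grpH group_BijGroup
    by (simp add: group_action_def group_hom_def group_hom_axioms_def)
  have orb: "orbit ?H \<phi> x = (\<lambda>h. act h x) ` H" if "x \<in> E" for x
  proof -
    have "orbit ?H \<phi> x = (\<lambda>h. act (inv h) x) ` H"
      using that by (auto simp: orbit_def \<phi>_def)
    also have "\<dots> = (\<lambda>h. act h x) ` H"
      using Hi Hc by (auto simp: image_iff) (metis Hc Hi inv_inv)
    finally show ?thesis .
  qed
  define F where "F = {x \<in> E. \<forall>h\<in>H. act h x = x}"
  define Os where "Os = orbits ?H E \<phi>"
  have fixO: "O' = {x}" if O: "O' \<in> Os" and xO: "x \<in> O'" and xF: "x \<in> F" for O' x
  proof -
    obtain y where y: "y \<in> E" "O' = orbit ?H \<phi> y" using O by (auto simp: Os_def orbits_def)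
    obtain h where h: "h \<in> H" "x = act h y" using y orb xO by auto
    have "y = x" using inverse[OF h(1) y(1)] xF h Hi unfolding F_def by auto
    then show ?thesis using xF y orb H subgroup.one_closed[OF H(1)] unfolding F_def by auto
  qed
  have "card E = (\<Sum>O'\<in>Os. \<Sum>x\<in>O'. 1)"
    using A.disjoint_sum[OF E, where f = "\<lambda>_. 1::nat"] by (simp add: Os_def)
  \<comment> \<open>Compared orbit by orbit: an orbit that meets F is a single point, any other has
    size a power of p greater than 1.\<close>
  also have "[\<dots> = (\<Sum>O'\<in>Os. \<Sum>x\<in>O'. if x \<in> F then 1 else 0)] (mod p)"
  proof (rule cong_sum)
    fix O' assume O: "O' \<in> Os"
    then obtain y where y: "y \<in> E" "O' = orbit ?H \<phi> y" by (auto simp: Os_def orbits_def)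
    have yO: "y \<in> O'" using y orb[OF y(1)] one[OF y(1)] subgroup.one_closed[OF H(1)] by force
    show "[(\<Sum>x\<in>O'. 1) = (\<Sum>x\<in>O'. if x \<in> F then 1 else 0)] (mod p)"
    proof (cases "O' \<inter> F = {}")
      case False
      then obtain x where x: "x \<in> O'" "x \<in> F" by auto
      have "O' = {x}" using fixO[OF O x] .
      with x show ?thesis by simp
    next
      case True
      have "card O' dvd p ^ k"
        using A.orbit_stabilizer_theorem[OF y(1)] H y(2) by (auto simp: order_def) (metis dvd_triv_left)
      then obtain j where j: "card O' = p ^ j" using divides_primepow_nat[OF prime_p] by blast
      have "j \<noteq> 0"
      proof
        assume "j = 0"
        with j obtain z where z: "O' = {z}" by (auto simp: card_1_singleton_iff)
        then have "\<forall>h\<in>H. act h y = y" using yO y orb by auto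
        then show False using True yO y by (auto simp: F_def)
      qed
      moreover have "(\<Sum>x\<in>O'. if x \<in> F then 1 else 0::nat) = 0"
        using True by (intro sum.neutral) auto
      ultimately show ?thesis using j by (simp add: cong_0_iff)
    qed
  qed
  also have "(\<Sum>O'\<in>Os. \<Sum>x\<in>O'. if x \<in> F then 1 else 0) = (\<Sum>x\<in>E. if x \<in> F then 1 else 0::nat)"
    using A.disjoint_sum[OF E] by (simp add: Os_def)
  also have "\<dots> = card F"
    using E by (simp add: sum.If_cases F_def Int_def)
  finally show ?thesis by (simp add: F_def)
qed

section \<open>Sylow subgroups and chains in \<open>p\<close>-groups\<close>

lemma inv_cancel_left [simp]:
  "a \<in> carrier G \<Longrightarrow> b \<in> carrier G \<Longrightarrow> inv a \<otimes> (a \<otimes> b) = b"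
  "a \<in> carrier G \<Longrightarrow> b \<in> carrier G \<Longrightarrow> a \<otimes> (inv a \<otimes> b) = b"
  by (simp_all add: m_assoc[symmetric])

lemma subgroup_mem: "subgroup H G \<Longrightarrow> x \<in> H \<Longrightarrow> x \<in> carrier G"
  by (rule subgroup.mem_carrier)

lemma invariantD: "invariant G K C \<Longrightarrow> g \<in> K \<Longrightarrow> x \<in> C \<Longrightarrow> cj g x \<in> C"
  by (simp add: invariant_def)

lemma invariant_subset: "invariant G K C \<Longrightarrow> L \<subseteq> K \<Longrightarrow> invariant G L C"
  by (auto simp: invariant_def)

lemma invariant_self: "subgroup K G \<Longrightarrow> invariant G K K"
  by (simp add: invariant_def subgroup_cj)

text \<open>H acts on the cosets by right translation, and \<open>Q #> x\<close> is fixed exactly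
  when x H x^-1 lies in Q; \<open>cj (inv x) h\<close> is x h x^-1.\<close>

lemma coset_fixed_points:
  assumes H: "subgroup H G" "card H = p ^ k" and Q: "subgroup Q G" and N: "subgroup N G"
    and sub: "Q \<subseteq> N" "H \<subseteq> N"
  shows "[card (cosets_in G N Q) =
    card {C \<in> cosets_in G N Q. \<exists>x\<in>N. C = Q #> x \<and> (\<forall>h\<in>H. cj (inv x) h \<in> Q)}] (mod p)"
proof -
  have Qc: "Q \<subseteq> carrier G" using Q subgroup_sub by blast
  have Nc: "x \<in> N \<Longrightarrow> x \<in> carrier G" for x using subgroup_mem[OF N] .
  have Hc: "x \<in> H \<Longrightarrow> x \<in> carrier G" for x using subgroup_mem[OF H(1)] .
  have cl: "C #> h \<in> cosets_in G N Q" if "h \<in> H" "C \<in> cosets_in G N Q" for h C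
  proof -
    obtain x where x: "x \<in> N" "C = Q #> x" using \<open>C \<in> cosets_in G N Q\<close> by (auto simp: cosets_in_def)
    have "C #> h = Q #> (x \<otimes> h)" using x coset_mult_assoc[OF Qc] that Nc Hc by simp
    moreover have "x \<otimes> h \<in> N" using x that sub subgroup.m_closed[OF N] by blast
    ultimately show ?thesis by (auto simp: cosets_in_def)
  qed
  have cc: "C \<subseteq> carrier G" if "C \<in> cosets_in G N Q" for C
    using that Nc Qc by (auto simp: cosets_in_def r_coset_subset_G subset_iff) (metis Nc Qc r_coset_subset_G subset_iff)
  have fixed: "(\<forall>h\<in>H. C #> h = C) \<longleftrightarrow> (\<exists>x\<in>N. C = Q #> x \<and> (\<forall>h\<in>H. cj (inv x) h \<in> Q))"
    if "C \<in> cosets_in G N Q" for C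
  proof -
    have *: "(Q #> x) #> h = Q #> x \<longleftrightarrow> cj (inv x) h \<in> Q" if "x \<in> N" "h \<in> H" for x h
      using that Nc Hc Qc rcos_eq_iff[OF Q, of "x \<otimes> h" x] coset_mult_assoc[OF Qc, of x h]
      by (simp add: conj_by_def)
    obtain y where y: "y \<in> N" "C = Q #> y" using \<open>C \<in> cosets_in G N Q\<close> by (auto simp: cosets_in_def)
    show ?thesis using * y by blast
  qed
  have "[card (cosets_in G N Q) =
      card {C \<in> cosets_in G N Q. \<forall>h\<in>H. C #> h = C}] (mod p)"
  proof (rule p_group_fixed_points[OF H])
    show "finite (cosets_in G N Q)" using finite_subgroup[OF N] by (simp add: cosets_in_def)
    show "C #> (h \<otimes> h') = C #> h #> h'" if "h \<in> H" "h' \<in> H" "C \<in> cosets_in G N Q" for h h' C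
      using that cc Hc by (simp add: coset_mult_assoc)
  qed (use cl cc in auto)
  also have "{C \<in> cosets_in G N Q. \<forall>h\<in>H. C #> h = C} =
      {C \<in> cosets_in G N Q. \<exists>x\<in>N. C = Q #> x \<and> (\<forall>h\<in>H. cj (inv x) h \<in> Q)}"
    by (rule Collect_cong) (use fixed in blast)
  finally show ?thesis .
qed

text \<open>The number of cosets of Q in N is prime to p, so H fixes one of them.\<close>

lemma sylow_conj:
  assumes S: "sylow_in G p Q N" and H: "subgroup H G" "card H = p ^ k" "H \<subseteq> N"
  shows "\<exists>x\<in>N. \<forall>h\<in>H. cj x h \<in> Q"
proof -
  obtain n m where nm: "card Q = p ^ n" "card N = m * p ^ n" "\<not> p dvd m"
    and Q: "subgroup Q G" and N: "subgroup N G" and QN: "Q \<subseteq> N"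
    using S by (auto simp: sylow_in_def)
  have "card (cosets_in G N Q) * p ^ n = m * p ^ n" using lagrange_in[OF Q N QN] nm by simp
  then have "card (cosets_in G N Q) = m" using p_gt_1 by simp
  with coset_fixed_points[OF H(1,2) Q N QN H(3)] nm(3)
  have "\<not> p dvd card {C \<in> cosets_in G N Q. \<exists>x\<in>N. C = Q #> x \<and> (\<forall>h\<in>H. cj (inv x) h \<in> Q)}"
    using cong_dvd_iff by blast
  then have "{C \<in> cosets_in G N Q. \<exists>x\<in>N. C = Q #> x \<and> (\<forall>h\<in>H. cj (inv x) h \<in> Q)} \<noteq> {}"
    by (metis card.empty dvd_0_right)
  then obtain x where "x \<in> N" "\<forall>h\<in>H. cj (inv x) h \<in> Q" by auto
  then show ?thesis using subgroup.m_inv_closed[OF N] by blast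
qed

lemma p_group_index_dvd:
  assumes "subgroup A G" "subgroup P G" "A \<subset> P" "card P = p ^ n"
  shows "p dvd card (cosets_in G P A)"
proof -
  have l: "card (cosets_in G P A) * card A = p ^ n" using lagrange_in[of A P] assms by auto
  then have "card (cosets_in G P A) dvd p ^ n" by (metis dvd_triv_left)
  then obtain k where k: "card (cosets_in G P A) = p ^ k"
    using divides_primepow_nat[OF prime_p] by blast
  have "k \<noteq> 0"
  proof
    assume "k = 0"
    with k l assms have "card A = card P" by simp
    then show False using assms subgroup_psubset_card[of A P] by auto
  qed
  with k show ?thesis by simp
qed

text \<open>Meant for sets of fixed points of p-groups, where one fixed point is obvious and a
  second one is wanted.\<close>

lemma exists_other_element:
  assumes "p dvd card F" "a \<in> F"
  shows "\<exists>b\<in>F. b \<noteq> a"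
proof (rule ccontr)
  assume "\<not> ?thesis"
  then have "F = {a}" using assms(2) by blast
  then show False using assms(1) p_gt_1 by simp
qed

text \<open>A acts on its own right cosets in P and fixes the trivial one, and the number of fixed
  cosets is divisible by p. A second fixed coset A x gives the element x^-1 of the normalizer
  outside A.\<close>

lemma normalizer_grows:
  assumes A: "subgroup A G" and P: "subgroup P G" and sub: "A \<subset> P" and cP: "card P = p ^ n"
  shows "A \<subset> normalizer_in G P A"
proof -
  let ?F = "{C \<in> cosets_in G P A. \<exists>x\<in>P. C = A #> x \<and> (\<forall>h\<in>A. cj (inv x) h \<in> A)}"
  obtain k where k: "card A = p ^ k" using card_p_power_sub[OF A P _ cP] sub by auto
  have AP: "A \<subseteq> P" using sub by auto
  have "p dvd card ?F"
    using coset_fixed_points[OF A k A P AP AP] p_group_index_dvd[OF A P sub cP] cong_dvd_iff by blast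
  moreover have "A #> \<one> \<in> ?F"
    using subgroup.one_closed[OF P] subgroup_mem[OF A] by (auto simp: cosets_in_def intro!: bexI[of _ \<one>])
  ultimately have "\<exists>C\<in>?F. C \<noteq> A #> \<one>" by (intro exists_other_element)
  then obtain x where x: "x \<in> P" "A #> x \<noteq> A #> \<one>" "\<forall>h\<in>A. cj (inv x) h \<in> A" by auto
  have xc: "x \<in> carrier G" using subgroup_mem[OF P x(1)] .
  have "inv x \<in> normalizer_in G P A" using x subgroup.m_inv_closed[OF P x(1)] by (auto simp: normalizer_in_def)
  moreover have "inv x \<notin> A"
    using x(2) rcos_eq_iff[OF A xc one_closed] xc subgroup.m_inv_closed[OF A, of "inv x"] by auto
  moreover have "A \<subseteq> normalizer_in G P A" using AP subgroup_cj[OF A] by (auto simp: normalizer_in_def)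
  ultimately show ?thesis by blast
qed

text \<open>The union is R<s> for an element s normalizing R; natural exponents suffice in a finite
  group.\<close>

lemma rcos_pow_cl:
  assumes R: "subgroup R G" and s: "s \<in> carrier G" and inv: "\<forall>r\<in>R. cj s r \<in> R" "\<forall>r\<in>R. cj (inv s) r \<in> R"
  shows "subgroup (\<Union>i::nat. R #> (s [^] i)) G"
proof (rule finite_submonoid_subgroup)
  have Rc: "r \<in> R \<Longrightarrow> r \<in> carrier G" for r using subgroup_mem[OF R] .
  show "(\<Union>i::nat. R #> (s [^] i)) \<subseteq> carrier G"
    using subgroup_sub[OF R] s by (auto simp: r_coset_def)
  show "\<one> \<in> (\<Union>i::nat. R #> (s [^] i))"
    using subgroup.one_closed[OF R] by (auto simp: r_coset_def intro!: exI[of _ 0] bexI[of _ \<one>])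
  have step: "cj (inv (s [^] (i::nat))) r \<in> R" if "r \<in> R" for r i
    using that
  proof (induction i arbitrary: r)
    case (Suc i)
    have "cj (inv (s [^] Suc i)) r = cj (inv (s [^] i)) (cj (inv s) r)"
      using s Rc Suc.prems by (simp add: cj_cj inv_mult_group)
    then show ?case using Suc inv by simp
  qed (use Rc in simp)
  fix x y assume "x \<in> (\<Union>i::nat. R #> (s [^] i))" "y \<in> (\<Union>i::nat. R #> (s [^] i))"
  then obtain i j :: nat and r r' where x: "x = r \<otimes> s [^] i" "r \<in> R" and y: "y = r' \<otimes> s [^] j" "r' \<in> R"
    by (auto simp: r_coset_def)
  have "x \<otimes> y = (r \<otimes> cj (inv (s [^] i)) r') \<otimes> s [^] (i + j)"
    using x y s Rc by (simp add: conj_by_def m_assoc nat_pow_mult[symmetric])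
  moreover have "r \<otimes> cj (inv (s [^] i)) r' \<in> R" using x y step subgroup.m_closed[OF R] by blast
  ultimately show "x \<otimes> y \<in> (\<Union>i::nat. R #> (s [^] i))" by (auto simp: r_coset_def)
qed

text \<open>S/R is a nontrivial normal subgroup of the p-group P/R and hence meets its centre; T/R
  is generated by a central element of order p.\<close>

lemma invariant_step:
  assumes P: "subgroup P G" "card P = p ^ n" and R: "subgroup R G" "invariant G P R"
    and S: "subgroup S G" "invariant G P S" and RS: "R \<subset> S" and SP: "S \<subseteq> P"
  shows "\<exists>T. subgroup T G \<and> invariant G P T \<and> R \<subseteq> T \<and> T \<subseteq> S \<and> card T = p * card R"
proof -
  have Pc: "x \<in> P \<Longrightarrow> x \<in> carrier G" for x using subgroup_mem[OF P(1)] .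
  have Sc: "x \<in> S \<Longrightarrow> x \<in> carrier G" for x using subgroup_mem[OF S(1)] .
  have Rc: "x \<in> R \<Longrightarrow> x \<in> carrier G" for x using subgroup_mem[OF R(1)] .
  have img: "cj u ` (R #> s) = R #> cj u s" if u: "u \<in> P" and s: "s \<in> S" for u s
  proof -
    have "cj u ` R = R"
      using normalizer_in_image[of u P R] u R(2) subgroup_sub[OF P(1)] subgroup_sub[OF R(1)]
      by (auto simp: normalizer_in_def invariant_def)
    moreover have "cj u ` (R #> s) = (cj u ` R) #> cj u s"
      using u s Pc Sc Rc by (auto simp: r_coset_def image_iff cj_mult)
    ultimately show ?thesis by simp
  qed
  let ?F = "{C \<in> cosets_in G S R. \<forall>u\<in>P. cj u ` C = C}"
  have "[card (cosets_in G S R) = card ?F] (mod p)"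
  proof (rule p_group_fixed_points[OF P])
    show "finite (cosets_in G S R)" using finite_subgroup[OF S(1)] by (simp add: cosets_in_def)
    fix h C assume h: "h \<in> P" and C: "C \<in> cosets_in G S R"
    then obtain s where s: "s \<in> S" "C = R #> s" by (auto simp: cosets_in_def)
    show "cj h ` C \<in> cosets_in G S R" using img[OF h s(1)] s(2) invariantD[OF S(2) h s(1)]
      by (auto simp: cosets_in_def)
    have Cc: "C \<subseteq> carrier G" using s Sc subgroup_sub[OF R(1)] r_coset_subset_G by metis
    show "cj (h \<otimes> h') ` C = cj h' ` cj h ` C" if "h' \<in> P" for h'
      using that h Pc Cc by (auto simp: image_iff cj_cj subset_iff)
  next
    fix C assume "C \<in> cosets_in G S R"
    then obtain s where s: "s \<in> S" "C = R #> s" by (auto simp: cosets_in_def)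
    have Cc: "C \<subseteq> carrier G" using s Sc subgroup_sub[OF R(1)] r_coset_subset_G by metis
    show "cj \<one> ` C = C" using Cc by (force simp: image_iff subset_iff)
  qed
  moreover obtain j where j: "card S = p ^ j" using card_p_power_sub[OF S(1) P(1) SP P(2)] by auto
  ultimately have "p dvd card ?F"
    using p_group_index_dvd[OF R(1) S(1) RS j] cong_dvd_iff by blast
  moreover have "R #> \<one> \<in> ?F" using subgroup.one_closed[OF S(1)] img[of _ \<one>] Pc
    by (auto simp: cosets_in_def)
  ultimately have "\<exists>C\<in>?F. C \<noteq> R #> \<one>" by (intro exists_other_element)
  then obtain s0 where s0: "s0 \<in> S" "R #> s0 \<noteq> R #> \<one>" "\<forall>u\<in>P. cj u ` (R #> s0) = R #> s0"
    by (auto simp: cosets_in_def)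
  have s0R: "s0 \<notin> R" using s0 rcos_eq_iff[OF R(1) Sc[OF s0(1)] one_closed] Sc by auto
  have s0pow: "s0 [^] (p ^ j) = \<one>" using pow_card_eq_one[OF S(1) s0(1)] j by simp
  \<comment> \<open>s0 is central modulo R, but its order modulo R may exceed p; the power with
    exponent p^(k-1) has order p modulo R.\<close>
  define k where "k = (LEAST k. s0 [^] (p ^ k) \<in> R)"
  have kR: "s0 [^] (p ^ k) \<in> R"
    unfolding k_def using s0pow subgroup.one_closed[OF R(1)] by (metis (mono_tags, lifting) LeastI)
  have k0: "k \<noteq> 0" using kR s0R Sc[OF s0(1)] by (metis nat_pow_eone power_0)
  define s where "s = s0 [^] (p ^ (k - 1))"
  have sS: "s \<in> S" unfolding s_def using subgroup_pow[OF S(1) s0(1)] .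
  have sR: "s \<notin> R"
    unfolding s_def using k0 not_less_Least[of "k - 1" "\<lambda>k. s0 [^] (p ^ k) \<in> R"] k_def by simp
  have spR: "s [^] p \<in> R"
  proof -
    have "s [^] p = s0 [^] (p ^ (k - 1) * p)" unfolding s_def using Sc[OF s0(1)] by (simp add: nat_pow_pow)
    also have "p ^ (k - 1) * p = p ^ k" using k0 by (metis mult.commute power_eq_if)
    finally show ?thesis using kR by simp
  qed
  have sc: "s \<in> carrier G" using Sc sS by blast
  define T where "T = (\<Union>i::nat. R #> (s [^] i))"
  have sP: "s \<in> P" using sS SP by blast
  have Tsub: "subgroup T G" unfolding T_def
    using R sP subgroup.m_inv_closed[OF P(1) sP] by (intro rcos_pow_cl) (auto simp: sc invariant_def)
  have RT: "R \<subseteq> T" unfolding T_def using Rc by (auto simp: r_coset_def intro!: exI[of _ 0])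
  have TS: "T \<subseteq> S"
    unfolding T_def r_coset_def using RS subgroup_pow[OF S(1) sS] subgroup.m_closed[OF S(1)] by blast
  have cs: "cj u s0 \<in> R #> s0" if "u \<in> P" for u
    using s0(3) that rcos_self[OF Sc[OF s0(1)] R(1)] by blast
  have powcl: "cj u (s0 [^] (i::nat)) \<in> R #> (s0 [^] i)" if u: "u \<in> P" for u i
  proof (induction i)
    case 0 show ?case using Pc[OF u] rcos_self[OF one_closed R(1)] by simp
  next
    case (Suc i)
    obtain r where r: "r \<in> R" "cj u (s0 [^] i) = r \<otimes> s0 [^] i" using Suc by (auto simp: r_coset_def)
    obtain r' where r': "r' \<in> R" "cj u s0 = r' \<otimes> s0" using cs[OF u] by (auto simp: r_coset_def)
    have c: "s0 \<in> carrier G" "u \<in> carrier G" "r \<in> carrier G" "r' \<in> carrier G" using Sc s0 Pc u Rc r r' by auto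
    have "cj u (s0 [^] Suc i) = (r \<otimes> s0 [^] i) \<otimes> (r' \<otimes> s0)"
      using r r' c by (simp add: cj_mult)
    also have "\<dots> = (r \<otimes> cj (inv (s0 [^] i)) r') \<otimes> s0 [^] Suc i"
      using c by (simp add: conj_by_def m_assoc)
    finally have e: "cj u (s0 [^] Suc i) = (r \<otimes> cj (inv (s0 [^] i)) r') \<otimes> s0 [^] Suc i" .
    have "inv (s0 [^] i) \<in> P" using subgroup_pow[OF P(1)] subgroup.m_inv_closed[OF P(1)] s0 SP by blast
    then have "r \<otimes> cj (inv (s0 [^] i)) r' \<in> R"
      using r r' invariantD[OF R(2)] subgroup.m_closed[OF R(1)] by blast
    with e show ?case by (auto simp: r_coset_def)
  qed
  have Tinv: "invariant G P T"
    unfolding invariant_def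
  proof (intro ballI)
    fix u x assume u: "u \<in> P" and x: "x \<in> T"
    then obtain i r where r: "r \<in> R" "x = r \<otimes> s [^] (i::nat)" by (auto simp: T_def r_coset_def)
    have si: "s [^] i = s0 [^] (p ^ (k - 1) * i)" unfolding s_def using Sc[OF s0(1)] by (simp add: nat_pow_pow)
    obtain r' where r': "r' \<in> R" "cj u (s [^] i) = r' \<otimes> s [^] i"
      using powcl[OF u, of "p ^ (k - 1) * i"] unfolding si by (auto simp: r_coset_def)
    have "cj u x = (cj u r \<otimes> r') \<otimes> s [^] i"
      using r r' Rc Pc[OF u] sc by (simp add: cj_mult m_assoc)
    moreover have "cj u r \<otimes> r' \<in> R" using r r' invariantD[OF R(2) u] subgroup.m_closed[OF R(1)] by blast
    ultimately show "cj u x \<in> T" by (auto simp: T_def r_coset_def)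
  qed
  \<comment> \<open>Since s^p lies in R there are at most p cosets, and p divides their number
    because T is a p-group larger than R.\<close>
  have cosT: "cosets_in G T R \<subseteq> (\<lambda>i. R #> (s [^] i)) ` {..<p}"
  proof
    fix C assume "C \<in> cosets_in G T R"
    then obtain i r where r: "r \<in> R" "C = R #> (r \<otimes> s [^] (i::nat))"
      by (auto simp: cosets_in_def T_def r_coset_def)
    have "r \<otimes> s [^] i \<otimes> inv (s [^] (i mod p)) = r \<otimes> (s [^] p) [^] (i div p)"
    proof -
      have "s [^] i = s [^] (p * (i div p)) \<otimes> s [^] (i mod p)"
        using sc by (simp add: nat_pow_mult)
      then show ?thesis using sc Rc r by (simp add: m_assoc nat_pow_pow)
    qed
    also have "\<dots> \<in> R" using r subgroup_pow[OF R(1) spR] subgroup.m_closed[OF R(1)] by blast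
    finally have "C = R #> (s [^] (i mod p))"
      using r rcos_eq_iff[OF R(1), of "r \<otimes> s [^] i" "s [^] (i mod p)"] Rc sc by auto
    then show "C \<in> (\<lambda>i. R #> (s [^] i)) ` {..<p}" using p_gt_1 by auto
  qed
  have "card (cosets_in G T R) \<le> p"
    using surj_card_le[OF _ cosT] by simp
  moreover have "p dvd card (cosets_in G T R)"
  proof -
    obtain jj where "card T = p ^ jj" using card_p_power_sub[OF Tsub P(1) _ P(2)] TS SP by auto
    moreover have "s \<in> T" unfolding T_def using rcos_self[OF sc R(1)] by (auto intro!: exI[of _ "1::nat"] simp: sc)
    ultimately show ?thesis using p_group_index_dvd[OF R(1) Tsub] RT sR by blast
  qed
  moreover have "card (cosets_in G T R) > 0"
    using lagrange_in[OF R(1) Tsub RT] card_subgroup_pos[OF Tsub] by (metis gr0I mult_0 less_irrefl)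
  ultimately have "card (cosets_in G T R) = p" using dvd_imp_le by fastforce
  then have "card T = p * card R" using lagrange_in[OF R(1) Tsub RT] by simp
  then show ?thesis using Tsub Tinv RT TS by blast
qed

lemma invariant_intermediate:
  assumes P: "subgroup P G" "card P = p ^ n" and R: "subgroup R G" "invariant G P R" "card R = p ^ i"
    and S: "subgroup S G" "invariant G P S" "card S = p ^ k" and RS: "R \<subseteq> S" and SP: "S \<subseteq> P"
    and ij: "i \<le> j" "j \<le> k"
  shows "\<exists>T. subgroup T G \<and> invariant G P T \<and> R \<subseteq> T \<and> T \<subseteq> S \<and> card T = p ^ j"
  using ij
proof (induction j rule: dec_induct)
  case base then show ?case using R RS by blast
next
  case (step j)
  then obtain T where T: "subgroup T G" "invariant G P T" "R \<subseteq> T" "T \<subseteq> S" "card T = p ^ j" by auto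
  have "T \<noteq> S" using step T S p_gt_1 by auto
  then obtain T' where "subgroup T' G" "invariant G P T'" "T \<subseteq> T'" "T' \<subseteq> S" "card T' = p * card T"
    using invariant_step[OF P T(1,2) S(1,2) _ SP] T by blast
  then show ?case using T by (auto intro!: exI[of _ T'])
qed

text \<open>T need not be normal in B, so each step is made inside N_B(T), which is larger than T
  and leaves T invariant.\<close>

lemma subgroup_intermediate:
  assumes B: "subgroup B G" "card B = p ^ n" and A: "subgroup A G" "card A = p ^ i" "A \<subseteq> B"
    and ij: "i \<le> j" "j \<le> n"
  shows "\<exists>T. subgroup T G \<and> A \<subseteq> T \<and> T \<subseteq> B \<and> card T = p ^ j"
  using ij
proof (induction j rule: dec_induct)
  case base then show ?case using A by blast
next
  case (step j)
  then obtain T where T: "subgroup T G" "A \<subseteq> T" "T \<subseteq> B" "card T = p ^ j" by auto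
  let ?N = "normalizer_in G B T"
  have "T \<noteq> B" using step T B p_gt_1 by auto
  then have TN: "T \<subset> ?N" using normalizer_grows[OF T(1) B(1) _ B(2)] T by blast
  have N: "subgroup ?N G" using normalizer_in_subgroup[OF B(1) subgroup_sub[OF T(1)]] .
  have NB: "?N \<subseteq> B" by (auto simp: normalizer_in_def)
  obtain m where m: "card ?N = p ^ m" using card_p_power_sub[OF N B(1) NB B(2)] by auto
  have "invariant G ?N T" by (auto simp: invariant_def normalizer_in_def)
  then obtain T' where "subgroup T' G" "T \<subseteq> T'" "T' \<subseteq> ?N" "card T' = p * card T"
    using invariant_step[OF N m T(1) _ N invariant_self[OF N] TN] by auto
  then show ?case using T NB by (auto intro!: exI[of _ T'])
qed

text \<open>The normalizer of S exceeds S, and index p leaves only P for it.\<close>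

lemma index_p_invariant:
  assumes P: "subgroup P G" "card P = p ^ Suc n" and S: "subgroup S G" "S \<subseteq> P" "card S = p ^ n"
  shows "invariant G P S"
proof -
  have "S \<noteq> P" using P S p_gt_1 by auto
  then have g: "S \<subset> normalizer_in G P S" using normalizer_grows[OF S(1) P(1) _ P(2)] S by blast
  have N: "subgroup (normalizer_in G P S) G" using normalizer_in_subgroup[OF P(1) subgroup_sub[OF S(1)]] .
  obtain k where k: "k \<le> Suc n" "card (normalizer_in G P S) = p ^ k"
    using card_p_power_sub[OF N P(1) _ P(2)] by (auto simp: normalizer_in_def)
  have "card S < card (normalizer_in G P S)" using g finite_subgroup[OF N] psubset_card_mono by blast
  then have "n < k" using S k p_gt_1 by (simp add: power_strict_increasing_iff)
  then have "k = Suc n" using k by simp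
  then have "normalizer_in G P S = P" using subgroup_psubset_card[OF N P(1)] k P by (auto simp: normalizer_in_def)
  then show ?thesis by (auto simp: normalizer_in_def invariant_def)
qed

section \<open>Sylow subgroups for all primes and elements of order prime to p\<close>

lemma sylow_prime_power:
  assumes N: "subgroup N G" and r: "Factorial_Ring.prime r" "r ^ a dvd card N"
  shows "\<exists>H. subgroup H G \<and> H \<subseteq> N \<and> card H = r ^ a"
proof -
  let ?N = "G\<lparr>carrier := N\<rparr>"
  obtain m where m: "card N = r ^ a * m" using r(2) by blast
  have "group ?N" using N subgroup_imp_group by blast
  moreover have "finite (carrier ?N)" using finite_subgroup[OF N] by simp
  ultimately obtain H where "subgroup H ?N" "card H = r ^ a"
    using sylow_thm[of r ?N a m] r m by (auto simp: order_def)
  then show ?thesis using incl_subgroup[OF N] subgroup.subset by fastforce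
qed

lemma exists_sylow_in:
  assumes N: "subgroup N G"
  shows "\<exists>S. sylow_in G p S N"
proof -
  have pos: "card N \<noteq> 0" using card_subgroup_pos[OF N] by simp
  obtain m where m: "card N = p ^ multiplicity p (card N) * m" "\<not> p dvd m"
    using multiplicity_decompose'[of "card N" p] pos prime_p p_gt_1
    by (metis not_prime_unit)
  obtain S where "subgroup S G" "S \<subseteq> N" "card S = p ^ multiplicity p (card N)"
    using sylow_prime_power[OF N prime_p, of "multiplicity p (card N)"] multiplicity_dvd by blast
  then show ?thesis using N m unfolding sylow_in_def by (metis mult.commute)
qed

text \<open>An exponent prime to p replaces the order: it passes to conjugates and to homomorphic
  images without any computation of orders.\<close>

definition p'_elt where "p'_elt x \<longleftrightarrow> (\<exists>m::nat. coprime m p \<and> x [^] m = \<one>)"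

text \<open>For a prime r other than p, a Sylow r-subgroup of N consists of p'-elements and so lies
  in U. With the assumption on the p-part, |N| divides |U|.\<close>

lemma subgroup_eq_by_elts:
  assumes U: "subgroup U G" and N: "subgroup N G" and UN: "U \<subseteq> N"
    and p': "\<And>x. x \<in> N \<Longrightarrow> p'_elt x \<Longrightarrow> x \<in> U"
    and m: "card N = m * p ^ a" "\<not> p dvd m" "p ^ a dvd card U"
  shows "U = N"
proof -
  have pos: "card N \<noteq> 0" "card U \<noteq> 0" using card_subgroup_pos N U by auto
  have "card N dvd card U"
  proof (rule multiplicity_le_imp_dvd)
    fix r :: nat assume r: "Factorial_Ring.prime r"
    let ?k = "multiplicity r (card N)"
    have "r ^ ?k dvd card U"
    proof (cases "r = p")
      case True
      have "m \<noteq> 0" using m(2) by (metis dvd_0_right)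
      then have "?k = a" using True m prime_p
        by (simp add: prime_elem_multiplicity_mult_distrib not_dvd_imp_multiplicity_0)
      then show ?thesis using True m by simp
    next
      case False
      obtain H where H: "subgroup H G" "H \<subseteq> N" "card H = r ^ ?k"
        using sylow_prime_power[OF N r, of ?k] multiplicity_dvd by blast
      have "coprime (card H) p" using H False r prime_p by (simp add: primes_coprime)
      then have "p'_elt x" if "x \<in> H" for x
        using pow_card_eq_one[OF H(1) that] unfolding p'_elt_def by blast
      then have "H \<subseteq> U" using p' H(2) by blast
      then show ?thesis using card_dvd[OF H(1) U] H by simp
    qed
    then show "?k \<le> multiplicity r (card U)" using pos r
      by (intro multiplicity_geI) (auto)
  qed (use pos in auto)
  then have "card N \<le> card U" using pos by (simp add: dvd_imp_le)
  then show ?thesis using subgroup_psubset_card[OF U N UN] by blast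
qed

section \<open>Characters modulo \<open>p\<close>\<close>

text \<open>A homomorphism to Z/p carried by integer representatives: sums over cosets are ordinary
  integer sums, and all identities are congruences.\<close>

definition character_on where
  "character_on Q \<theta> \<longleftrightarrow> (\<forall>x\<in>Q. \<forall>y\<in>Q. [\<theta> (x \<otimes> y) = \<theta> x + \<theta> y] (mod int p))" for \<theta> :: "'a \<Rightarrow> int"

lemma characterD: "character_on Q \<theta> \<Longrightarrow> x \<in> Q \<Longrightarrow> y \<in> Q \<Longrightarrow> [\<theta> (x \<otimes> y) = \<theta> x + \<theta> y] (mod int p)"
  by (simp add: character_on_def)

lemma character_one:
  assumes "subgroup Q G" "character_on Q \<theta>"
  shows "[\<theta> \<one> = 0] (mod int p)"
  using characterD[OF assms(2), of \<one> \<one>] subgroup.one_closed[OF assms(1)]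
  by (simp add: cong_iff_dvd_diff)

lemma character_pow:
  assumes "subgroup Q G" "character_on Q \<theta>" "x \<in> Q"
  shows "[\<theta> (x [^] (n::nat)) = int n * \<theta> x] (mod int p)"
proof (induction n)
  case 0 show ?case using character_one[OF assms(1,2)] by simp
next
  case (Suc n)
  have "[\<theta> (x [^] n \<otimes> x) = \<theta> (x [^] n) + \<theta> x] (mod int p)"
    using characterD[OF assms(2)] subgroup_pow[OF assms(1,3)] assms(3) by blast
  also have "[\<theta> (x [^] n) + \<theta> x = int n * \<theta> x + \<theta> x] (mod int p)"
    using Suc by (simp add: cong_add)
  finally show ?case by (simp add: algebra_simps)
qed

lemma character_inv:
  assumes "subgroup Q G" "character_on Q \<theta>" "x \<in> Q"
  shows "[\<theta> (inv x) = - \<theta> x] (mod int p)"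
proof -
  have "[\<theta> (inv x \<otimes> x) = \<theta> (inv x) + \<theta> x] (mod int p)"
    using characterD[OF assms(2)] subgroup.m_inv_closed[OF assms(1,3)] assms(3) by blast
  then have "[0 = \<theta> (inv x) + \<theta> x] (mod int p)"
    using character_one[OF assms(1,2)] subgroup_mem[OF assms(1,3)] cong_sym cong_trans by (metis l_inv)
  then show ?thesis by (simp add: cong_iff_dvd_diff) (metis dvd_minus_iff minus_add_distrib uminus_add_conv_diff add.commute)
qed

text \<open>Q/M has order p and is generated by any a outside M; \<theta> x is an exponent i with x
  in M a^i, unique modulo p.\<close>

lemma exists_character:
  assumes Q: "subgroup Q G" and M: "subgroup M G" "M \<subseteq> Q" "invariant G Q M" and c: "card Q = p * card M"
  shows "\<exists>\<theta>. character_on Q \<theta> \<and> (\<forall>x\<in>Q. [\<theta> x = 0] (mod int p) \<longleftrightarrow> x \<in> M)"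
proof -
  have Mpos: "card M > 0" using card_subgroup_pos[OF M(1)] .
  have "Q \<noteq> M" using c Mpos p_gt_1 by auto
  then obtain a where a: "a \<in> Q" "a \<notin> M" using M by auto
  have ac: "a \<in> carrier G" using subgroup_mem[OF Q a(1)] .
  have Mc: "x \<in> M \<Longrightarrow> x \<in> carrier G" for x using subgroup_mem[OF M(1)] .
  have iM: "inv a \<in> Q" using subgroup.m_inv_closed[OF Q a(1)] .
  define T where "T = (\<Union>i::nat. M #> (a [^] i))"
  have T: "subgroup T G" unfolding T_def
    using M(3) a iM by (intro rcos_pow_cl[OF M(1) ac]) (auto simp: invariant_def)
  have MT: "M \<subseteq> T" unfolding T_def using Mc by (auto simp: r_coset_def intro!: exI[of _ 0])
  have aT: "a \<in> T" unfolding T_def using rcos_self[OF ac M(1)] by (auto intro!: exI[of _ "1::nat"] simp: ac)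
  have TQ: "T \<subseteq> Q" unfolding T_def r_coset_def
    using M(2) subgroup_pow[OF Q a(1)] subgroup.m_closed[OF Q] by blast
  have cT: "card (cosets_in G T M) * card M = card T" by (rule lagrange_in[OF M(1) T MT])
  have "card T dvd card Q" by (rule card_dvd[OF T Q TQ])
  then have "card (cosets_in G T M) dvd p" using cT c Mpos by (metis dvd_times_right_cancel_iff gr_implies_not0)
  moreover have "card (cosets_in G T M) \<noteq> 1"
    using cT a aT MT subgroup_psubset_card[OF M(1) T MT] by auto
  ultimately have cosp: "card (cosets_in G T M) = p" using prime_p prime_nat_iff by blast
  then have "card Q = card T" using cT c by simp
  then have TQ: "T = Q" using subgroup_psubset_card[OF T Q TQ] by simp
  have pw: "a [^] (j - i) \<in> M" if "M #> (a [^] i) = M #> (a [^] j)" "i \<le> j" for i j :: nat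
  proof -
    have "a [^] j \<otimes> inv (a [^] i) \<in> M"
      using that rcos_eq_iff[OF M(1), of "a [^] j" "a [^] i"] ac by auto
    moreover have "a [^] j = a [^] (j - i) \<otimes> a [^] i" using that ac by (simp add: nat_pow_mult)
    ultimately show ?thesis using ac by (simp add: m_assoc)
  qed
  have "\<exists>k. 0 < k \<and> a [^] (k::nat) \<in> M"
    using pow_card_eq_one[OF Q a(1)] card_subgroup_pos[OF Q] subgroup.one_closed[OF M(1)] by metis
  \<comment> \<open>The order of a modulo M; counting the cosets M a^i shows below that it is
    p.\<close>
  define q where "q = (LEAST k. 0 < k \<and> a [^] (k::nat) \<in> M)"
  have q: "0 < q" "a [^] q \<in> M"
    using LeastI_ex[OF \<open>\<exists>k. 0 < k \<and> a [^] (k::nat) \<in> M\<close>] unfolding q_def by auto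
  have qmin: "\<not> (0 < k \<and> a [^] k \<in> M)" if "k < q" for k :: nat
    using not_less_Least that unfolding q_def by blast
  have red: "M #> (a [^] i) = M #> (a [^] (i mod q))" for i
  proof -
    have "a [^] i = (a [^] q) [^] (i div q) \<otimes> a [^] (i mod q)"
      using ac by (simp add: nat_pow_pow nat_pow_mult)
    then have "a [^] i \<otimes> inv (a [^] (i mod q)) \<in> M"
      using ac subgroup_pow[OF M(1) q(2)] by (simp add: m_assoc Mc)
    then show ?thesis using rcos_eq_iff[OF M(1)] ac by simp
  qed
  have inj: "inj_on (\<lambda>i. M #> (a [^] i)) {..<q}"
  proof (rule linorder_inj_onI')
    fix i j assume "i \<in> {..<q}" "j \<in> {..<q}" "i < j"
    then show "M #> (a [^] i) \<noteq> M #> (a [^] j)" using pw[of i j] qmin[of "j - i"] by auto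
  qed
  have cos_eq: "cosets_in G T M = (\<lambda>i. M #> (a [^] i)) ` {..<q}"
  proof
    show "cosets_in G T M \<subseteq> (\<lambda>i. M #> (a [^] i)) ` {..<q}"
    proof
      fix C assume "C \<in> cosets_in G T M"
      then obtain x i where x: "x \<in> M #> (a [^] (i::nat))" "C = M #> x" by (auto simp: cosets_in_def T_def)
      have "C = M #> (a [^] i)" using repr_independence[OF x(1) _ M(1)] x(2) ac by simp
      then show "C \<in> (\<lambda>i. M #> (a [^] i)) ` {..<q}" using red[of i] q(1) by auto
    qed
    show "(\<lambda>i. M #> (a [^] i)) ` {..<q} \<subseteq> cosets_in G T M"
      using subgroup_pow[OF T aT] by (auto simp: cosets_in_def)
  qed
  have qp: "q = p" using cosp cos_eq inj by (simp add: card_image)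
  have uniq: "[i = j] (mod p)" if "x \<in> M #> (a [^] i)" "x \<in> M #> (a [^] j)" for x and i j :: nat
  proof -
    have "M #> (a [^] (i mod p)) = M #> (a [^] (j mod p))"
      using that repr_independence[OF _ _ M(1)] red ac qp by (metis nat_pow_closed)
    then show ?thesis using inj qp p_gt_1 by (auto simp: inj_on_def cong_def)
  qed
  define \<theta> where "\<theta> x = int (SOME i. x \<in> M #> (a [^] (i::nat)))" for x
  have lam: "[\<theta> x = int i] (mod int p)" if "x \<in> M #> (a [^] i)" for x i
    unfolding \<theta>_def using uniq[OF someI[of "\<lambda>i. x \<in> M #> (a [^] i)", OF that] that]
    by (simp add: cong_int_iff)
  have "character_on Q \<theta>"
    unfolding character_on_def
  proof (intro ballI)
    fix x y assume "x \<in> Q" "y \<in> Q"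
    then obtain i j where i: "x \<in> M #> (a [^] (i::nat))" and j: "y \<in> M #> (a [^] (j::nat))"
      using TQ unfolding T_def by blast
    then obtain r s where r: "r \<in> M" "x = r \<otimes> a [^] i" and s: "s \<in> M" "y = s \<otimes> a [^] j"
      by (auto simp: r_coset_def)
    have "cj (inv (a [^] i)) s \<in> M"
      using invariantD[OF M(3)] subgroup.m_inv_closed[OF Q] subgroup_pow[OF Q a(1)] s by blast
    then have "r \<otimes> cj (inv (a [^] i)) s \<in> M" using r subgroup.m_closed[OF M(1)] by blast
    moreover have "x \<otimes> y = (r \<otimes> cj (inv (a [^] i)) s) \<otimes> a [^] (i + j)"
      using r s ac Mc by (simp add: conj_by_def m_assoc nat_pow_mult[symmetric])
    ultimately have "x \<otimes> y \<in> M #> (a [^] (i + j))" by (auto simp: r_coset_def)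
    from lam[OF this] have "[\<theta> (x \<otimes> y) = int i + int j] (mod int p)" by simp
    then show "[\<theta> (x \<otimes> y) = \<theta> x + \<theta> y] (mod int p)"
      using cong_add[OF lam[OF i] lam[OF j]] cong_sym cong_trans by blast
  qed
  moreover have "[\<theta> x = 0] (mod int p) \<longleftrightarrow> x \<in> M" if xQ: "x \<in> Q" for x
  proof
    assume "x \<in> M"
    then have "x \<in> M #> (a [^] (0::nat))" using Mc by (auto simp: r_coset_def)
    from lam[OF this] show "[\<theta> x = 0] (mod int p)" by simp
  next
    assume z: "[\<theta> x = 0] (mod int p)"
    obtain i where i: "x \<in> M #> (a [^] (i::nat))" using xQ TQ unfolding T_def by blast
    have "[int i = 0] (mod int p)" using lam[OF i] z cong_sym cong_trans by blast
    then have "i mod p = 0" by (metis cong_0_iff cong_int_iff dvd_imp_mod_0 of_nat_0)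
    then have "x \<in> M #> \<one>" using i red[of i] qp by simp
    then show "x \<in> M" using subgroup_sub[OF M(1)] by simp
  qed
  ultimately show ?thesis by blast
qed

lemma eq_one_if_coprime_pows:
  assumes "x \<in> carrier G" "x [^] (a::nat) = \<one>" "x [^] (b::nat) = \<one>" "coprime a b"
  shows "x = \<one>"
proof -
  have "ord x dvd a" "ord x dvd b" using assms pow_eq_id by auto
  then have "ord x dvd 1" using assms(4) by (metis coprime_common_divisor_nat nat_dvd_1_iff_1 coprime_def)
  then show ?thesis using ord_eq_1 assms(1) by simp
qed

text \<open>Since g fixes d, conjugation by g^i sends x to d^i x. Hence d^m = 1 for some m prime to
  p, while d has p-power order, so d = 1.\<close>

lemma p'_fixed_quotient:
  assumes g: "g \<in> carrier G" "p'_elt g" and x: "x \<in> carrier G" and d: "d \<in> A" "subgroup A G" "card A = p ^ n"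
    and e: "cj g x = d \<otimes> x" "cj g d = d"
  shows "cj g x = x"
proof -
  have dc: "d \<in> carrier G" using d subgroup_mem by blast
  have it: "cj (g [^] (i::nat)) x = d [^] i \<otimes> x \<and> cj (g [^] i) d = d" for i
  proof (induction i)
    case (Suc i)
    have "cj (g [^] Suc i) x = cj g (cj (g [^] i) x)" "cj (g [^] Suc i) d = cj g (cj (g [^] i) d)"
      using g x dc by (simp_all add: cj_cj)
    then show ?case using Suc g x dc e by (simp add: cj_mult cj_pow m_assoc)
  qed (use x dc in simp)
  obtain m where m: "coprime m p" "g [^] (m::nat) = \<one>" using g(2) by (auto simp: p'_elt_def)
  have "d [^] m = \<one>" using it[of m] m x dc by (simp add: l_cancel_one r_cancel_one')
  moreover have "d [^] (p ^ n) = \<one>" using pow_card_eq_one[OF d(2,1)] d(3) by simp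
  ultimately have "d = \<one>" using eq_one_if_coprime_pows[OF dc] m(1) by (metis coprime_power_right_iff)
  then show ?thesis using e x by simp
qed

text \<open>Calculus of nilpotency class two: z is the commutator of x and d and commutes with both;
  the sum in the last exponent is k choose 2.\<close>

lemma central_commutator_pow:
  assumes "d \<in> carrier G" "x \<in> carrier G" "z \<in> carrier G"
    and e: "x \<otimes> d = d \<otimes> x \<otimes> z" "z \<otimes> d = d \<otimes> z" "z \<otimes> x = x \<otimes> z"
  shows "x [^] (k::nat) \<otimes> d = d \<otimes> x [^] k \<otimes> z [^] k"
    and "(d \<otimes> x) [^] k = d [^] k \<otimes> x [^] k \<otimes> z [^] (\<Sum>i<k. i)"
proof -
  have zx: "z [^] (i::nat) \<otimes> x = x \<otimes> z [^] i" for i using assms by (metis group_commutes_pow)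
  have zd: "z [^] (i::nat) \<otimes> d = d \<otimes> z [^] i" for i using assms by (metis group_commutes_pow)
  show 1: "x [^] (k::nat) \<otimes> d = d \<otimes> x [^] k \<otimes> z [^] k" for k
  proof (induction k)
    case (Suc k)
    have "x [^] Suc k \<otimes> d = x [^] k \<otimes> (d \<otimes> x \<otimes> z)" using assms(1-3) e(1) by (simp add: m_assoc)
    also have "\<dots> = (x [^] k \<otimes> d) \<otimes> x \<otimes> z" using assms(1-3) by (simp add: m_assoc)
    also have "\<dots> = d \<otimes> x [^] k \<otimes> (z [^] k \<otimes> x) \<otimes> z" using assms(1-3) Suc by (simp add: m_assoc)
    also have "\<dots> = d \<otimes> x [^] Suc k \<otimes> z [^] Suc k" using assms(1-3) zx by (simp add: m_assoc)
    finally show ?case .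
  qed (use assms in simp)
  show "(d \<otimes> x) [^] k = d [^] k \<otimes> x [^] k \<otimes> z [^] (\<Sum>i<k. i)"
  proof (induction k)
    case (Suc k)
    let ?s = "\<Sum>i<k. i"
    have zdx: "z [^] ?s \<otimes> (d \<otimes> x) = (d \<otimes> x) \<otimes> z [^] ?s"
      using zx zd assms(1-3) by (metis m_assoc m_closed nat_pow_closed)
    have "(d \<otimes> x) [^] Suc k = d [^] k \<otimes> x [^] k \<otimes> (z [^] ?s \<otimes> (d \<otimes> x))"
      using Suc assms(1-3) by (simp add: m_assoc)
    also have "\<dots> = d [^] k \<otimes> (x [^] k \<otimes> d) \<otimes> x \<otimes> z [^] ?s"
      unfolding zdx using assms(1-3) by (simp add: m_assoc)
    also have "\<dots> = d [^] Suc k \<otimes> x [^] k \<otimes> (z [^] k \<otimes> x) \<otimes> z [^] ?s"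
      unfolding 1 using assms(1-3) by (simp add: m_assoc)
    also have "\<dots> = d [^] Suc k \<otimes> x [^] Suc k \<otimes> (z [^] k \<otimes> z [^] ?s)"
      unfolding zx using assms(1-3) by (simp add: m_assoc)
    also have "z [^] k \<otimes> z [^] ?s = z [^] (\<Sum>i<Suc k. i)" using assms(3) by (simp add: nat_pow_mult add.commute)
    finally show ?case .
  qed (use assms in simp)
qed

section \<open>Coprime automorphisms\<close>

text \<open>C modulo the kernel of \<theta> has order 1 or p, and g acts on it as multiplication by
  a scalar k modulo p. If the order is p, then k^|G| = 1 and k^(p-1) = 1, whence k = 1.\<close>

lemma character_conj_invariant:
  assumes Q: "subgroup Q G" and ch: "character_on Q \<theta>" and C: "subgroup C G" "C \<subseteq> Q"
    and g: "g \<in> carrier G" "\<And>x. x \<in> C \<Longrightarrow> cj g x \<in> C"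
    and ker: "\<And>x. x \<in> C \<Longrightarrow> [\<theta> x = 0] (mod int p) \<Longrightarrow> [\<theta> (cj g x) = 0] (mod int p)"
    and cop: "coprime (order G) (p - 1)" and y: "y \<in> C"
  shows "[\<theta> (cj g y) = \<theta> y] (mod int p)"
proof (cases "\<forall>x\<in>C. [\<theta> x = 0] (mod int p)")
  case True
  then show ?thesis using g(2)[OF y] y cong_sym cong_trans by blast
next
  case False
  then obtain x where x: "x \<in> C" "\<not> [\<theta> x = 0] (mod int p)" by auto
  have Cc: "w \<in> C \<Longrightarrow> w \<in> carrier G" for w using subgroup_mem[OF C(1)] .
  have CQ: "w \<in> C \<Longrightarrow> w \<in> Q" for w using C by blast
  have "Factorial_Ring.prime (int p)" using prime_p by simp
  then have "coprime (\<theta> x) (int p)"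
    using x(2) by (metis cong_0_iff coprime_commute prime_imp_coprime)
  then obtain u where u: "[\<theta> x * u = 1] (mod int p)" using cong_solve_coprime_int by blast
  define k where "k = u * \<theta> (cj g x)"
  have lin: "[\<theta> (cj g y) = k * \<theta> y] (mod int p)" if y: "y \<in> C" for y
  proof -
    \<comment> \<open>With this j, x^j and y have the same value under \<theta>, so they differ by
      an element z of the kernel, to which \<open>ker\<close> applies.\<close>
    define j where "j = nat ((u * \<theta> y) mod int p)"
    have j: "[int j = u * \<theta> y] (mod int p)" using p_gt_1 by (simp add: j_def)
    have xj: "x [^] j \<in> C" using subgroup_pow[OF C(1) x(1)] .
    define z where "z = y \<otimes> inv (x [^] j)"
    have iC: "inv (x [^] j) \<in> C" using xj subgroup.m_inv_closed[OF C(1)] by blast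
    have z: "z \<in> C" unfolding z_def using y iC subgroup.m_closed[OF C(1)] by blast
    have yz: "y = z \<otimes> x [^] j" unfolding z_def using y xj Cc by (simp add: m_assoc)
    have "[\<theta> y = \<theta> z + int j * \<theta> x] (mod int p)"
      using characterD[OF ch CQ[OF z] CQ[OF xj]] character_pow[OF Q ch CQ[OF x(1)], of j] yz
      by (metis cong_add cong_refl cong_trans)
    moreover have "[int j * \<theta> x = (u * \<theta> y) * \<theta> x] (mod int p)" using j by (rule cong_scalar_right)
    moreover have "[(u * \<theta> y) * \<theta> x = \<theta> y] (mod int p)"
      using cong_scalar_left[OF u, of "\<theta> y"] by (simp add: ac_simps)
    ultimately have "[\<theta> y = \<theta> z + \<theta> y] (mod int p)" by (metis cong_add_lcancel cong_trans)
    then have "[\<theta> z = 0] (mod int p)" by (simp add: cong_iff_dvd_diff)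
    then have gz: "[\<theta> (cj g z) = 0] (mod int p)" using ker z by blast
    have "cj g y = cj g z \<otimes> cj g x [^] j" unfolding yz using Cc z xj g x by (simp add: cj_mult cj_pow)
    then have "[\<theta> (cj g y) = \<theta> (cj g z) + \<theta> (cj g x [^] j)] (mod int p)"
      using characterD[OF ch] CQ g(2)[OF z] subgroup_pow[OF C(1) g(2)[OF x(1)]] by simp
    moreover have "[\<theta> (cj g x [^] j) = int j * \<theta> (cj g x)] (mod int p)"
      using character_pow[OF Q ch] CQ g(2)[OF x(1)] by blast
    moreover have "[int j * \<theta> (cj g x) = (u * \<theta> y) * \<theta> (cj g x)] (mod int p)"
      using j by (rule cong_scalar_right)
    ultimately have "[\<theta> (cj g y) = 0 + (u * \<theta> y) * \<theta> (cj g x)] (mod int p)"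
      using gz by (meson cong_add cong_trans)
    then show ?thesis by (simp add: k_def ac_simps)
  qed
  have it: "cj (g [^] (i::nat)) y \<in> C \<and> [\<theta> (cj (g [^] i) y) = k ^ i * \<theta> y] (mod int p)" if y: "y \<in> C" for y i
  proof (induction i)
    case 0 show ?case using y Cc by simp
  next
    case (Suc i)
    have e: "cj (g [^] Suc i) y = cj g (cj (g [^] i) y)" using g y Cc by (simp add: cj_cj)
    have "[\<theta> (cj g (cj (g [^] i) y)) = k * \<theta> (cj (g [^] i) y)] (mod int p)" using lin Suc by blast
    also have "[k * \<theta> (cj (g [^] i) y) = k * (k ^ i * \<theta> y)] (mod int p)" using Suc cong_scalar_left by blast
    finally show ?case unfolding e using Suc g(2) by (simp add: ac_simps)
  qed
  have "g [^] order G = \<one>" using pow_order_eq_1 g by blast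
  then have "[\<theta> x = k ^ order G * \<theta> x] (mod int p)" using it[OF x(1), of "order G"] x(1) Cc by simp
  then have "[\<theta> x * u = k ^ order G * \<theta> x * u] (mod int p)" by (rule cong_scalar_right)
  then have "[1 = k ^ order G * (\<theta> x * u)] (mod int p)" using u by (metis cong_sym cong_trans mult.assoc)
  then have kN: "[k ^ order G = 1] (mod int p)"
    using cong_scalar_left[OF u, of "k ^ order G"] by (metis cong_sym cong_trans mult.right_neutral)
  have opos: "order G \<noteq> 0" using fin order_gt_0_iff_finite by simp
  have ndvd: "\<not> int p dvd k"
  proof
    assume "int p dvd k"
    then have "int p dvd k ^ order G" using opos by (simp add: dvd_power_iff dvd_trans dvd_power)
    then have "int p dvd 1" using kN cong_dvd_iff by blast
    then show False using p_gt_1 by simp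
  qed
  define k' where "k' = nat (k mod int p)"
  have k': "[int k' = k] (mod int p)" using p_gt_1 by (simp add: k'_def)
  have "\<not> p dvd k'" using ndvd k' cong_dvd_iff by (metis int_dvd_int_iff)
  then have "[int (k' ^ (p - 1)) = int 1] (mod int p)"
    using fermat_theorem[OF prime_p] cong_int_iff by blast
  then have fer: "[k ^ (p - 1) = 1] (mod int p)"
    using cong_pow[OF k', of "p - 1"] by (metis cong_sym cong_trans of_nat_1 of_nat_power)
  \<comment> \<open>Bezout for the coprime exponents |G| and p - 1, both of which send k to
    1.\<close>
  obtain a b where ab: "order G * a = (p - 1) * b + 1"
    using bezout_nat[OF opos, of "p - 1"] cop by auto
  have "[(k ^ order G) ^ a = 1 ^ a] (mod int p)" using kN by (rule cong_pow)
  moreover have "(k ^ order G) ^ a = (k ^ (p - 1)) ^ b * k"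
    by (metis ab power_add power_mult power_one_right)
  moreover have "[(k ^ (p - 1)) ^ b * k = 1 ^ b * k] (mod int p)" using cong_pow[OF fer] cong_scalar_right by blast
  ultimately have "[k = 1] (mod int p)" by (metis cong_sym cong_trans mult_1 power_one)
  then have "[k * \<theta> y = 1 * \<theta> y] (mod int p)" by (rule cong_scalar_right)
  then show ?thesis using lin[OF y] cong_trans by fastforce
qed

lemma mult_eq_mult_commutator:
  "x \<in> carrier G \<Longrightarrow> y \<in> carrier G \<Longrightarrow> x \<otimes> y = y \<otimes> x \<otimes> (inv (y \<otimes> x) \<otimes> (x \<otimes> y))"
  by (simp add: m_assoc[symmetric])

lemma finite_has_maximal_card:
  assumes "finite \<M>" "L \<in> \<M>"
  shows "\<exists>M\<in>\<M>. \<forall>L\<in>\<M>. card L \<le> card M"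
proof -
  have "Max (card ` \<M>) \<in> card ` \<M>" using assms by (intro Max_in) auto
  then obtain M where "M \<in> \<M>" "card M = Max (card ` \<M>)" by auto
  then show ?thesis using assms(1) by (metis Max_ge finite_imageI image_eqI)
qed

text \<open>In a minimal counterexample g fixes a large normal subgroup M of A, and A/M is
  elementary abelian. The element d = [g, x] centralizes M. Either induction applies to the
  centralizer of M, or A has class at most two and d has order dividing p, or 4 if p = 2. In both
  cases g fixes d, and \<open>p'_fixed_quotient\<close> finishes.\<close>

lemma p'_automorphism_trivial:
  assumes "subgroup A G" "card A = p ^ n" "g \<in> carrier G" "p'_elt g"
    and "\<And>x. x \<in> A \<Longrightarrow> cj g x \<in> A"
    and "\<And>x. x \<in> A \<Longrightarrow> x [^] (if p = 2 then 4 else p) = \<one> \<Longrightarrow> cj g x = x"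
    and "x \<in> A"
  shows "cj g x = x"
  using assms(1,2,5,6,7)
proof (induction "card A" arbitrary: A n x rule: less_induct)
  case less
  note A = less.prems(1) and cA = less.prems(2) and gA = less.prems(3) and small = less.prems(4) and xA = less.prems(5)
  note g = \<open>g \<in> carrier G\<close> and p'g = \<open>p'_elt g\<close>
  have Ac: "w \<in> A \<Longrightarrow> w \<in> carrier G" for w using subgroup_mem[OF A] .
  have IH: "cj g y = y" if B: "subgroup B G" "B \<subset> A" "\<And>x. x \<in> B \<Longrightarrow> cj g x \<in> B" "y \<in> B" for B y
  proof -
    obtain k where k: "card B = p ^ k" using card_p_power_sub[OF B(1) A _ cA] B(2) by auto
    have "card B < card A" using B(2) psubset_card_mono finite_subgroup[OF A] by blast
    from less.hyps[OF this B(1) k B(3)] small B(2,4) show ?thesis by blast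
  qed
  show ?case
  proof (cases "A = {\<one>}")
    case True then show ?thesis using xA g by simp
  next
    case False
    \<comment> \<open>The proper normal subgroups of A stable under g; by induction g fixes each of
      them elementwise, in particular one of largest order.\<close>
    define \<M> where "\<M> = {M. subgroup M G \<and> invariant G A M \<and> M \<subset> A \<and> (\<forall>x\<in>M. cj g x \<in> M)}"
    have "\<M> \<subseteq> Pow A" by (auto simp: \<M>_def)
    then have fM: "finite \<M>" using finite_subgroup[OF A] by (meson finite_Pow_iff finite_subset)
    have oM: "{\<one>} \<in> \<M>"
      using False triv_subgroup subgroup.one_closed[OF A] g Ac by (auto simp: \<M>_def invariant_def)
    obtain M where M: "M \<in> \<M>" "\<And>L. L \<in> \<M> \<Longrightarrow> card L \<le> card M"
      using finite_has_maximal_card[OF fM oM] by blast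
    have MG: "subgroup M G" and MA: "invariant G A M" and MsA: "M \<subset> A" and gM: "\<And>x. x \<in> M \<Longrightarrow> cj g x \<in> M"
      using M(1) by (auto simp: \<M>_def)
    have Mfix: "cj g y = y" if "y \<in> M" for y using IH[OF MG MsA gM that] .
    obtain i where i: "i \<le> n" "card M = p ^ i" using card_p_power_sub[OF MG A _ cA] MsA by auto
    have "card M < card A" using MsA psubset_card_mono finite_subgroup[OF A] by blast
    then have "i < n" using i cA by (metis le_neq_implies_less less_irrefl)
    then obtain n' where n': "n = Suc n'" "i \<le> n'" by (cases n) auto
    obtain N where N: "subgroup N G" "invariant G A N" "M \<subseteq> N" "N \<subseteq> A" "card N = p ^ n'"
      using invariant_intermediate[OF A cA MG MA i(2) A invariant_self[OF A] cA, of n'] MsA n' by auto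
    obtain \<theta> where th: "character_on A \<theta>" and ker: "\<And>x. x \<in> A \<Longrightarrow> [\<theta> x = 0] (mod int p) \<longleftrightarrow> x \<in> N"
      using exists_character[OF A N(1,4,2)] N(5) cA n' by auto
    \<comment> \<open>The intersection of the preimages of N under the powers of g. It belongs to
      \<open>\<M>\<close> and contains M, so it is M. Hence p-th powers and commutators of A, which
      always lie in N, lie in M.\<close>
    define L where "L = {x \<in> A. \<forall>i::nat. cj (g [^] i) x \<in> N}"
    have giA: "cj (g [^] (i::nat)) x \<in> A" if "x \<in> A" for i x
    proof (induction i)
      case (Suc i)
      have "cj (g [^] Suc i) x = cj g (cj (g [^] i) x)" using g that Ac by (simp add: cj_cj)
      then show ?case using Suc gA by simp
    qed (use that Ac in simp)
    have "L \<in> \<M>"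
      unfolding \<M>_def
    proof (intro CollectI conjI)
      show "subgroup L G"
        by (rule finite_submonoid_subgroup)
          (use g Ac subgroup.m_closed[OF A] subgroup.m_closed[OF N(1)] subgroup.one_closed[OF A] subgroup.one_closed[OF N(1)]
            in \<open>auto simp: L_def cj_mult\<close>)
      show "invariant G A L"
        unfolding invariant_def L_def
      proof (intro ballI CollectI conjI allI)
        fix u x and i :: nat assume u: "u \<in> A" and x: "x \<in> {x \<in> A. \<forall>i::nat. cj (g [^] i) x \<in> N}"
        show "cj u x \<in> A" using u x subgroup_cj[OF A] by blast
        have "cj (g [^] i) (cj u x) = cj (cj (g [^] i) u) (cj (g [^] i) x)"
          using u x Ac g by (intro cj_cj_dist) auto
        then show "cj (g [^] i) (cj u x) \<in> N" using invariantD[OF N(2) giA[OF u]] x by simp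
      qed
      have "x \<in> N" if "x \<in> L" for x
      proof -
        have "cj (g [^] (0::nat)) x \<in> N" "x \<in> A" using that unfolding L_def by blast+
        then show ?thesis using Ac by simp
      qed
      moreover have "N \<noteq> A" using N(5) cA n' p_gt_1 by auto
      ultimately show "L \<subset> A" using N(4) by blast
      show "\<forall>x\<in>L. cj g x \<in> L"
      proof
        fix x assume x: "x \<in> L"
        have "cj (g [^] i) (cj g x) \<in> N" for i :: nat
        proof -
          have "cj (g [^] i) (cj g x) = cj (g [^] Suc i) x"
            using g x Ac nat_pow_Suc2[OF g, of i] by (simp add: cj_cj L_def)
          moreover have "cj (g [^] Suc i) x \<in> N" using x unfolding L_def by blast
          ultimately show ?thesis by (simp only:)
        qed
        then show "cj g x \<in> L" using x gA by (auto simp: L_def)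
      qed
    qed
    moreover have "M \<subseteq> L"
    proof
      fix y assume y: "y \<in> M"
      have "cj (g [^] (i::nat)) y = y" for i
      proof (induction i)
        case (Suc i)
        have "cj (g [^] Suc i) y = cj g (cj (g [^] i) y)" using g y MsA Ac by (simp add: cj_cj psubsetD)
        then show ?case using Suc Mfix[OF y] by simp
      qed (use y MsA Ac in auto)
      then show "y \<in> L" using y N(3) MsA by (auto simp: L_def)
    qed
    ultimately have LM: "L = M"
      using M(2) subgroup_psubset_card[OF MG, of L] by (auto simp: \<M>_def)
    have powM: "y [^] p \<in> M" if y: "y \<in> A" for y
    proof -
      have "w [^] p \<in> N" if "w \<in> A" for w
      proof -
        have "[\<theta> (w [^] p) = int p * \<theta> w] (mod int p)" using character_pow[OF A th that] .
        then have "[\<theta> (w [^] p) = 0] (mod int p)" by (simp add: cong_def)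
        then show ?thesis using ker subgroup_pow[OF A that] by blast
      qed
      then have "y [^] p \<in> L"
        unfolding L_def using y giA subgroup_pow[OF A y] g Ac by (auto simp: cj_pow)
      then show ?thesis using LM by simp
    qed
    have comM: "inv (y \<otimes> x) \<otimes> (x \<otimes> y) \<in> M" if y: "y \<in> A" and x: "x \<in> A" for x y
    proof -
      have comA: "inv (y \<otimes> x) \<otimes> (x \<otimes> y) \<in> A" if "y \<in> A" "x \<in> A" for x y
        using that subgroup.m_closed[OF A] subgroup.m_inv_closed[OF A] by blast
      have comN: "inv (y \<otimes> x) \<otimes> (x \<otimes> y) \<in> N" if "y \<in> A" "x \<in> A" for x y
      proof -
        have yx: "y \<otimes> x \<in> A" "x \<otimes> y \<in> A" "inv (y \<otimes> x) \<in> A"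
          using that subgroup.m_closed[OF A] subgroup.m_inv_closed[OF A] by blast+
        have "[\<theta> (inv (y \<otimes> x) \<otimes> (x \<otimes> y)) = \<theta> (inv (y \<otimes> x)) + \<theta> (x \<otimes> y)] (mod int p)"
          using characterD[OF th yx(3,2)] .
        also have "[\<theta> (inv (y \<otimes> x)) + \<theta> (x \<otimes> y) = - \<theta> (y \<otimes> x) + (\<theta> x + \<theta> y)] (mod int p)"
          using character_inv[OF A th yx(1)] characterD[OF th] that by (intro cong_add) auto
        also have "[- \<theta> (y \<otimes> x) + (\<theta> x + \<theta> y) = - (\<theta> y + \<theta> x) + (\<theta> x + \<theta> y)] (mod int p)"
          by (rule cong_add[OF _ cong_refl], subst cong_minus_minus_iff, rule characterD[OF th that])
        finally have "[\<theta> (inv (y \<otimes> x) \<otimes> (x \<otimes> y)) = 0] (mod int p)" by simp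
        then show ?thesis using ker comA[OF that] by blast
      qed
      have "inv (y \<otimes> x) \<otimes> (x \<otimes> y) \<in> L"
        unfolding L_def
      proof (intro CollectI conjI allI)
        fix i :: nat
        let ?h = "g [^] i"
        have "cj ?h (inv (y \<otimes> x) \<otimes> (x \<otimes> y)) = inv (cj ?h y \<otimes> cj ?h x) \<otimes> (cj ?h x \<otimes> cj ?h y)"
          using g x y Ac by (simp add: cj_mult cj_inv)
        then show "cj ?h (inv (y \<otimes> x) \<otimes> (x \<otimes> y)) \<in> N" using comN giA x y by simp
      qed (use comA x y in auto)
      then show ?thesis using LM by simp
    qed
    have Mc: "w \<in> M \<Longrightarrow> w \<in> carrier G" for w using subgroup_mem[OF MG] .
    define d where "d = cj g x \<otimes> inv x"
    have dA: "d \<in> A" unfolding d_def using xA gA subgroup.m_closed[OF A] subgroup.m_inv_closed[OF A] by blast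
    have xc: "x \<in> carrier G" and dc: "d \<in> carrier G" using Ac xA dA by auto
    have dx: "cj g x = d \<otimes> x" unfolding d_def using xc g by (simp add: m_assoc)
    \<comment> \<open>g fixes both m and x^-1 m x, so x and its image d x act alike on M.\<close>
    have dM: "cj d m = m" if m: "m \<in> M" for m
    proof -
      have mc: "m \<in> carrier G" using m Mc by blast
      have "cj g (cj x m) = cj (cj g x) (cj g m)" using g xc mc by (rule cj_cj_dist)
      moreover have "cj x m \<in> M" using invariantD[OF MA xA m] .
      ultimately have "cj x m = cj (d \<otimes> x) m" using Mfix m dx by simp
      then have "cj x m = cj x (cj d m)" using dc xc mc by (simp add: cj_cj)
      then show ?thesis using cj_eq_iff xc mc dc by simp
    qed
    define Z where "Z = {y \<in> A. \<forall>m\<in>M. cj y m = m}"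
    have Zg: "subgroup Z G"
      by (rule finite_submonoid_subgroup)
        (use Ac Mc subgroup.m_closed[OF A] subgroup.one_closed[OF A] in \<open>auto simp: Z_def cj_cj[symmetric]\<close>)
    have gZ: "cj g y \<in> Z" if y: "y \<in> Z" for y
    proof -
      have "cj (cj g y) m = m" if m: "m \<in> M" for m
      proof -
        have "cj g (cj y m) = cj (cj g y) (cj g m)" using g y m Ac Mc by (intro cj_cj_dist) (auto simp: Z_def)
        then show ?thesis using y m Mfix by (simp add: Z_def)
      qed
      then show ?thesis using y gA by (auto simp: Z_def)
    qed
    have dZ: "d \<in> Z" using dA dM by (simp add: Z_def)
    \<comment> \<open>If the centralizer Z of M is proper, induction fixes d. Otherwise M is central
      in A, and a power computation bounds the order of d.\<close>
    have "cj g d = d"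
    proof (cases "Z = A")
      case False
      then have "Z \<subset> A" by (auto simp: Z_def)
      from IH[OF Zg this gZ dZ] show ?thesis .
    next
      case True
      have Mcent: "m \<otimes> y = y \<otimes> m" if "y \<in> A" "m \<in> M" for y m
      proof -
        have "cj y m = m" using that True unfolding Z_def by blast
        then show ?thesis using mult_cj[of y m] that Ac Mc by simp
      qed
      define z where "z = inv (d \<otimes> x) \<otimes> (x \<otimes> d)"
      have zM: "z \<in> M" unfolding z_def using comM[OF dA xA] .
      have zc: "z \<in> carrier G" using Mc zM by blast
      have e: "x \<otimes> d = d \<otimes> x \<otimes> z" unfolding z_def using mult_eq_mult_commutator xc dc by simp
      note cp = central_commutator_pow[OF dc xc zc e Mcent[OF dA zM] Mcent[OF xA zM]]
      have zp: "z [^] p = \<one>"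
      proof -
        have "x [^] p \<otimes> d = d \<otimes> x [^] p \<otimes> z [^] p" by (rule cp(1))
        moreover have "x [^] p \<otimes> d = d \<otimes> x [^] p" using Mcent[OF dA powM[OF xA]] .
        ultimately show ?thesis using xc dc zc by (metis l_cancel_one' m_closed nat_pow_closed)
      qed
      \<comment> \<open>x^p lies in M and is therefore fixed by g, while g sends x to d x.\<close>
      have "(d \<otimes> x) [^] p = x [^] p"
        using Mfix[OF powM[OF xA]] g xc dx by (simp add: cj_pow)
      then have main: "d [^] p \<otimes> x [^] p \<otimes> z [^] (\<Sum>i<p. i) = x [^] p" using cp(2)[of p] by simp
      show ?thesis
      proof (cases "p = 2")
        case True
        \<comment> \<open>For p = 2 the exponent of z is 1, which only yields d^2 = z^-1 and d^4 =
          1; for odd p it is a multiple of p and z disappears.\<close>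
        have "(\<Sum>i<(2::nat). i) = 1" by (simp add: numeral_2_eq_2)
        then have m2: "d [^] (2::nat) \<otimes> x [^] (2::nat) \<otimes> z = x [^] (2::nat)" using main zc True by simp
        have "d [^] (2::nat) \<otimes> z \<otimes> x [^] (2::nat) = x [^] (2::nat)"
          using m2 Mcent[OF subgroup_pow[OF A xA] zM, of 2] dc xc zc by (simp add: m_assoc)
        then have "d [^] (2::nat) \<otimes> z = \<one>" using dc xc zc by (simp add: r_cancel_one)
        then have dz: "d [^] (2::nat) = inv z" using dc zc inv_equality inv_comm by (metis nat_pow_closed inv_inv)
        have "d [^] (4::nat) = (d [^] (2::nat)) [^] (2::nat)" using dc by (simp add: nat_pow_pow)
        also have "\<dots> = inv (z [^] (2::nat))" unfolding dz using zc nat_pow_inv by simp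
        also have "\<dots> = \<one>" using zp True by simp
        finally show ?thesis using small[OF dA] True by simp
      next
        case False
        then have "2 < p" using p_gt_1 by linarith
        then have "odd p" using prime_odd_nat[OF prime_p] by blast
        then have "p dvd (\<Sum>i<p. i)"
        proof -
          have "(\<Sum>i<p. i) = p * ((p - 1) div 2)"
            using \<open>odd p\<close> Sum_Ico_nat[of 0 p] by (auto simp: lessThan_atLeast0 elim!: oddE)
          then show ?thesis by simp
        qed
        then have "z [^] (\<Sum>i<p. i) = \<one>" using zp zc by (metis dvd_def nat_pow_one nat_pow_pow)
        then have "d [^] p = \<one>" using main dc xc by (simp add: r_cancel_one)
        then show ?thesis using small[OF dA] False by simp
      qed
    qed
    then show ?thesis using p'_fixed_quotient[OF g p'g xc dA A cA dx] by blast
  qed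
qed

section \<open>Fusion\<close>

lemma cj_image_subgroup:
  assumes "subgroup H G" "c \<in> carrier G"
  shows "subgroup (cj c ` H) G"
proof (rule finite_submonoid_subgroup)
  show "\<one> \<in> cj c ` H" using assms subgroup.one_closed[OF assms(1)] by (metis cj_one_right imageI)
  fix x y assume "x \<in> cj c ` H" "y \<in> cj c ` H"
  then obtain a b where ab: "a \<in> H" "b \<in> H" "x = cj c a" "y = cj c b" by auto
  then have "x \<otimes> y = cj c (a \<otimes> b)" using assms subgroup_mem[OF assms(1)] by (simp add: cj_mult)
  then show "x \<otimes> y \<in> cj c ` H" using ab subgroup.m_closed[OF assms(1)] by blast
qed (use assms subgroup_mem[OF assms(1)] in auto)

lemma card_cj_image: "H \<subseteq> carrier G \<Longrightarrow> c \<in> carrier G \<Longrightarrow> card (cj c ` H) = card H"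
  by (simp add: card_image cj_inj_on)

lemma cj_image_cj_image:
  "H \<subseteq> carrier G \<Longrightarrow> c \<in> carrier G \<Longrightarrow> d \<in> carrier G \<Longrightarrow> cj d ` cj c ` H = cj (c \<otimes> d) ` H"
  by (auto simp: image_iff cj_cj subset_iff)

text \<open>The elements of N_K(C) that preserve f on C form a subgroup. It contains all p'-elements
  of N_K(C) and its Sylow p-subgroup N_Q(C), so it is everything.\<close>

lemma stable_on_normalizer:
  assumes Q: "subgroup Q G" and K: "subgroup K G" "Q \<subseteq> K" and C: "subgroup C G" "C \<subseteq> Q"
    and S: "sylow_in G p (normalizer_in G Q C) (normalizer_in G K C)"
    and fQ: "\<And>u x. u \<in> Q \<Longrightarrow> x \<in> Q \<Longrightarrow> f (cj u x) = f x"
    and fp: "\<And>g x. g \<in> normalizer_in G K C \<Longrightarrow> p'_elt g \<Longrightarrow> x \<in> C \<Longrightarrow> f (cj g x) = f x"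
    and g: "g \<in> normalizer_in G K C" and x: "x \<in> C"
  shows "f (cj g x) = f x"
proof -
  have Cc: "x \<in> C \<Longrightarrow> x \<in> carrier G" for x using subgroup_mem[OF C(1)] .
  have N: "subgroup (normalizer_in G K C) G" using normalizer_in_subgroup[OF K(1) subgroup_sub[OF C(1)]] .
  define U where "U = {n \<in> normalizer_in G K C. \<forall>x\<in>C. f (cj n x) = f x}"
  have Nc: "n \<in> normalizer_in G K C \<Longrightarrow> n \<in> carrier G" for n using subgroup_mem[OF N] .
  have U: "subgroup U G"
  proof (rule finite_submonoid_subgroup)
    show "U \<subseteq> carrier G" using Nc by (auto simp: U_def)
    show "\<one> \<in> U" using subgroup.one_closed[OF N] Cc by (simp add: U_def)
    fix a b assume ab: "a \<in> U" "b \<in> U"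
    then have n: "a \<in> normalizer_in G K C" "b \<in> normalizer_in G K C" by (auto simp: U_def)
    have "f (cj (a \<otimes> b) x) = f x" if "x \<in> C" for x
    proof -
      have "cj (a \<otimes> b) x = cj b (cj a x)" using n Nc that Cc by (simp add: cj_cj)
      moreover have "cj a x \<in> C" using n that by (simp add: normalizer_in_def)
      ultimately show ?thesis using ab that by (simp add: U_def)
    qed
    then show "a \<otimes> b \<in> U" using subgroup.m_closed[OF N n] by (simp add: U_def)
  qed
  obtain n m where nm: "card (normalizer_in G Q C) = p ^ n" "card (normalizer_in G K C) = m * p ^ n" "\<not> p dvd m"
    using S by (auto simp: sylow_in_def)
  have "normalizer_in G Q C \<subseteq> U" using K(2) C(2) fQ by (auto simp: U_def normalizer_in_def)
  then have "p ^ n dvd card U"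
    using card_dvd[OF normalizer_in_subgroup[OF Q subgroup_sub[OF C(1)]] U] nm by simp
  then have "U = normalizer_in G K C"
    using subgroup_eq_by_elts[OF U N _ _ nm(2,3)] fp by (auto simp: U_def)
  then show ?thesis using g x by (auto simp: U_def)
qed

text \<open>Alperin's fusion argument. For a conjugate \<open>C\<close> of \<open>A\<close> with \<open>|N\<^sub>Q(C)|\<close> maximal,
  \<open>N\<^sub>Q(C)\<close> is Sylow in \<open>N\<^sub>K(C)\<close>, so \<open>N\<^sub>Q(A)\<close>, which is larger than \<open>A\<close>,
  can be conjugated into \<open>N\<^sub>Q(C)\<close> along with \<open>A\<close>.\<close>

theorem fusion_stable:
  assumes Q: "sylow_in G p Q K"
    and fQ: "\<And>u x. u \<in> Q \<Longrightarrow> x \<in> Q \<Longrightarrow> f (cj u x) = f x"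
    and fp: "\<And>C g x. subgroup C G \<Longrightarrow> C \<subseteq> Q \<Longrightarrow> g \<in> normalizer_in G K C \<Longrightarrow> p'_elt g \<Longrightarrow> x \<in> C \<Longrightarrow> f (cj g x) = f x"
    and A: "subgroup A G" "A \<subseteq> Q" and g: "g \<in> K" "cj g ` A \<subseteq> Q" and x: "x \<in> A"
  shows "f (cj g x) = f x"
  using A g x
proof (induction "card Q - card A" arbitrary: A g x rule: less_induct)
  case less
  note A = less.prems(1,2) and g = less.prems(3,4) and x = less.prems(5)
  obtain n m where QG: "subgroup Q G" and KG: "subgroup K G" and QK: "Q \<subseteq> K"
    and cQ: "card Q = p ^ n" and cK: "card K = m * p ^ n" "\<not> p dvd m"
    using Q by (auto simp: sylow_in_def)
  have Kc: "w \<in> K \<Longrightarrow> w \<in> carrier G" for w using subgroup_mem[OF KG] .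
  have Qc: "w \<in> Q \<Longrightarrow> w \<in> carrier G" for w using subgroup_mem[OF QG] .
  have Ac: "A \<subseteq> carrier G" using A Qc by blast
  have finQ: "finite Q" using finite_subgroup[OF QG] .
  define \<C> where "\<C> = {C. \<exists>c\<in>K. C = cj c ` A \<and> C \<subseteq> Q}"
  have "finite \<C>" using finQ by (auto simp: \<C>_def intro: finite_subset[of _ "Pow Q"])
  then have finI: "finite (normalizer_in G Q ` \<C>)" by simp
  have "A = cj \<one> ` A" using Ac by force
  then have AC: "A \<in> \<C>" using A(2) subgroup.one_closed[OF KG] unfolding \<C>_def by blast
  obtain C where C: "C \<in> \<C>" "\<And>D. D \<in> \<C> \<Longrightarrow> card (normalizer_in G Q D) \<le> card (normalizer_in G Q C)"
    using finite_has_maximal_card[OF finI imageI[OF AC]] by blast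
  obtain c where c: "c \<in> K" "C = cj c ` A" and CQ: "C \<subseteq> Q" using C(1) by (auto simp: \<C>_def)
  have CG: "subgroup C G" using cj_image_subgroup[OF A(1) Kc[OF c(1)]] c(2) by simp
  have Cc: "C \<subseteq> carrier G" using subgroup_sub[OF CG] .
  have NK: "subgroup (normalizer_in G K C) G" and NQ: "subgroup (normalizer_in G Q C) G"
    using normalizer_in_subgroup[OF _ Cc] KG QG by auto
  have NQK: "normalizer_in G Q C \<subseteq> normalizer_in G K C" and NQQ: "normalizer_in G Q C \<subseteq> Q" using QK by (auto simp: normalizer_in_def)
  obtain j where j: "card (normalizer_in G Q C) = p ^ j" using card_p_power_sub[OF NQ QG NQQ cQ] by auto
  obtain kC where kC: "card C = p ^ kC" using card_p_power_sub[OF CG QG CQ cQ] by auto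
  have CN: "C \<subseteq> normalizer_in G K C" using CQ QK subgroup_cj[OF CG] by (auto simp: normalizer_in_def)
  \<comment> \<open>A Sylow p-subgroup S of N_K(C) contains C. Conjugating S into Q by k carries C
    to a conjugate D of A, and S into N_Q(D), so |S| \<le> |N_Q(C)| by maximality.\<close>
  have full: "sylow_in G p (normalizer_in G Q C) (normalizer_in G K C)"
  proof -
    obtain S where S: "sylow_in G p S (normalizer_in G K C)" using exists_sylow_in[OF NK] by blast
    then obtain s r where SG: "subgroup S G" "S \<subseteq> normalizer_in G K C"
      and s: "card S = p ^ s" "card (normalizer_in G K C) = r * p ^ s" "\<not> p dvd r"
      by (auto simp: sylow_in_def)
    obtain y where y: "y \<in> normalizer_in G K C" "\<forall>h\<in>C. cj y h \<in> S" using sylow_conj[OF S CG kC CN] by blast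
    have "cj y ` C = C" using normalizer_in_image[OF y(1) subgroup_sub[OF KG] Cc] .
    then have CS: "C \<subseteq> S" using y(2) by (metis image_iff subsetI)
    have SK: "S \<subseteq> K" using SG by (auto simp: normalizer_in_def)
    obtain k where k: "k \<in> K" "\<forall>h\<in>S. cj k h \<in> Q" using sylow_conj[OF Q SG(1) s(1) SK] by blast
    define D where "D = cj k ` C"
    have "D = cj (c \<otimes> k) ` A" unfolding D_def c(2) using cj_image_cj_image Ac Kc c k by simp
    moreover have "D \<subseteq> Q" unfolding D_def using k(2) CS by blast
    ultimately have DC: "D \<in> \<C>" using subgroup.m_closed[OF KG c(1) k(1)] unfolding \<C>_def by blast
    have "cj k ` S \<subseteq> normalizer_in G Q D"
    proof
      fix w assume "w \<in> cj k ` S"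
      then obtain t where t: "t \<in> S" "w = cj k t" by auto
      have "cj w d \<in> D" if dD: "d \<in> D" for d
      proof -
        obtain e where e: "e \<in> C" "d = cj k e" using dD by (auto simp: D_def)
        have "cj w d = cj k (cj t e)"
          unfolding t(2) e(2) using t e k Kc Cc SK by (intro cj_cj_dist[symmetric]) auto
        moreover have "cj t e \<in> C" using t SG(2) e by (auto simp: normalizer_in_def)
        ultimately show ?thesis by (auto simp: D_def)
      qed
      then show "w \<in> normalizer_in G Q D" using k(2) t by (auto simp: normalizer_in_def)
    qed
    moreover have "finite (normalizer_in G Q D)" using finQ by (simp add: normalizer_in_def)
    ultimately have "card (cj k ` S) \<le> card (normalizer_in G Q D)" by (simp add: card_mono)
    moreover have "card (cj k ` S) = card S" using card_cj_image subgroup_sub[OF SG(1)] Kc k by blast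
    ultimately have "card S \<le> card (normalizer_in G Q C)" using C(2)[OF DC] by simp
    then have "p ^ s \<le> p ^ j" using s j by simp
    then have sj: "s \<le> j" using p_gt_1 power_le_imp_le_exp by blast
    have "p ^ j dvd r * p ^ s" using card_dvd[OF NQ NK NQK] j s by simp
    moreover have "p ^ j = p ^ (j - s) * p ^ s" using sj by (metis le_add_diff_inverse2 power_add)
    ultimately have "p ^ (j - s) dvd r" using p_gt_1 by simp
    then have "j - s = 0" using s(3) by (metis dvd_power dvd_trans gr0I)
    then have "j = s" using sj by simp
    then show ?thesis using NQ NK NQK j s unfolding sylow_in_def by blast
  qed
  have onN: "f (cj n x) = f x" if "n \<in> normalizer_in G K C" "x \<in> C" for n x
    using stable_on_normalizer[OF QG KG QK CG CQ full fQ fp[OF CG CQ] that] by blast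
  \<comment> \<open>The element b carries B onto C. It is corrected by some y in N_K(C) so that all
    of N_Q(B) is carried into Q; induction applies to N_Q(B), and \<open>onN\<close> removes y
    again.\<close>
  have good: "f (cj b x) = f x"
    if B: "subgroup B G" "B \<subseteq> Q" "card B = card A" and b: "b \<in> K" "cj b ` B = C" and x: "x \<in> B" for B b x
  proof -
    have Bc: "B \<subseteq> carrier G" using subgroup_sub[OF B(1)] .
    show ?thesis
    proof (cases "B = Q")
      \<comment> \<open>Q has no larger subgroup to pass to, but then C = Q and b itself normalizes
        it.\<close>
      case True
      have "card C = card Q" using card_cj_image[OF Bc Kc[OF b(1)]] b(2) True by simp
      then have "C = Q" using CQ finQ card_subset_eq by blast
      then have "b \<in> normalizer_in G K C" using b True by (auto simp: normalizer_in_def)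
      then show ?thesis using onN x True \<open>C = Q\<close> by blast
    next
      case False
      define NB where "NB = normalizer_in G Q B"
      have NBG: "subgroup NB G" unfolding NB_def using normalizer_in_subgroup[OF QG Bc] .
      have NBQ: "NB \<subseteq> Q" by (auto simp: NB_def normalizer_in_def)
      have BNB: "B \<subset> NB" unfolding NB_def using normalizer_grows[OF B(1) QG _ cQ] B False by blast
      obtain t where t: "card NB = p ^ t" using card_p_power_sub[OF NBG QG NBQ cQ] by auto
      have bc: "b \<in> carrier G" using Kc b by blast
      have "cj b ` NB \<subseteq> normalizer_in G K C"
      proof
        fix w assume "w \<in> cj b ` NB"
        then obtain v where v: "v \<in> NB" "w = cj b v" by auto
        have "w \<in> K" using v b NBQ QK subgroup_cj[OF KG] by blast
        moreover have "cj w d \<in> C" if dC: "d \<in> C" for d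
        proof -
          obtain e where e: "e \<in> B" "d = cj b e" using dC b by auto
          have "cj w d = cj b (cj v e)"
            unfolding v(2) e(2) using v e bc NBQ Qc Bc by (intro cj_cj_dist[symmetric]) auto
          moreover have "cj v e \<in> B" using v e by (auto simp: NB_def normalizer_in_def)
          ultimately show ?thesis using b by auto
        qed
        ultimately show "w \<in> normalizer_in G K C" by (simp add: normalizer_in_def)
      qed
      moreover have "card (cj b ` NB) = p ^ t" using card_cj_image[OF subgroup_sub[OF NBG] bc] t by simp
      ultimately obtain y where y: "y \<in> normalizer_in G K C" "\<forall>h\<in>cj b ` NB. cj y h \<in> normalizer_in G Q C"
        using sylow_conj[OF full cj_image_subgroup[OF NBG bc]] by blast
      have yK: "y \<in> K" using y by (simp add: normalizer_in_def)
      have byK: "b \<otimes> y \<in> K" using subgroup.m_closed[OF KG b(1) yK] .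
      have "cj (b \<otimes> y) ` NB \<subseteq> Q"
        unfolding cj_image_cj_image[OF subgroup_sub[OF NBG] bc Kc[OF yK], symmetric]
        using y(2) NQQ by blast
      moreover have "card NB > card A" using BNB B(3) psubset_card_mono finite_subgroup[OF NBG] by metis
      then have "card Q - card NB < card Q - card A"
        using card_mono[OF finQ NBQ] by linarith
      ultimately have "f (cj (b \<otimes> y) x) = f x"
        using less.hyps[OF _ NBG NBQ byK, of x] x BNB by blast
      moreover have "cj (b \<otimes> y) x = cj y (cj b x)" using bc yK Kc x Bc by (simp add: cj_cj subset_iff)
      moreover have "f (cj y (cj b x)) = f (cj b x)" using onN[OF y(1)] b x by blast
      ultimately show ?thesis by simp
    qed
  qed
  \<comment> \<open>g need not carry A to C. Instead A is carried to C by c, and its image under g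
    by g^-1 c, with the same effect on x.\<close>
  have gc: "g \<in> carrier G" using Kc g by blast
  have "card (cj g ` A) = card A" using card_cj_image[OF Ac gc] .
  moreover have "inv g \<otimes> c \<in> K" using subgroup.m_closed[OF KG] subgroup.m_inv_closed[OF KG g(1)] c by blast
  moreover have e: "g \<otimes> (inv g \<otimes> c) = c" using gc Kc[OF c(1)] by simp
  then have "cj (inv g \<otimes> c) ` cj g ` A = C"
    using cj_image_cj_image[OF Ac gc, of "inv g \<otimes> c"] gc Kc[OF c(1)] c(2) by simp
  ultimately have "f (cj (inv g \<otimes> c) (cj g x)) = f (cj g x)"
    using good[OF cj_image_subgroup[OF A(1) gc] g(2)] x by blast
  moreover have "cj (inv g \<otimes> c) (cj g x) = cj c x"
    using cj_cj[OF gc, of "inv g \<otimes> c" x] gc Kc[OF c(1)] x Ac by auto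
  moreover have "f (cj c x) = f x" using good[OF A refl c(1)] c(2) x by blast
  ultimately show ?case by simp
qed

section \<open>Transfer\<close>

definition powers where "powers x = range (\<lambda>i::nat. x [^] i)"

lemma powers_subgroup: "x \<in> carrier G \<Longrightarrow> subgroup (powers x) G"
  by (rule finite_submonoid_subgroup)
    (auto simp: powers_def nat_pow_mult intro: range_eqI[of _ _ "0::nat"])

lemma powers_self: "x \<in> carrier G \<Longrightarrow> x \<in> powers x"
  by (auto simp: powers_def intro: range_eqI[of _ _ "1::nat"])

lemma powers_subset: "subgroup H G \<Longrightarrow> x \<in> H \<Longrightarrow> powers x \<subseteq> H"
  by (auto simp: powers_def subgroup_pow)

lemma card_powers: "x \<in> carrier G \<Longrightarrow> card (powers x) = ord x"
  using generate_pow_card[of x] generate_pow_on_finite_carrier[OF fin, of x]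
  by (simp add: powers_def full_SetCompr_eq)

text \<open>Stands in for a transversal of Q in K: such an f is determined modulo p by its values on
  coset representatives, and the difference of two of them is constant modulo p on cosets.\<close>

definition equivariant_on where
  "equivariant_on Q K \<theta> f \<longleftrightarrow>
    (\<forall>u\<in>Q. \<forall>x\<in>K. [f (u \<otimes> x) = \<theta> u + f x] (mod int p))" for \<theta> f :: "'a \<Rightarrow> int"

definition coset_rep where "coset_rep K C = (SOME t. t \<in> K \<inter> C)"

lemma coset_rep:
  assumes Q: "subgroup Q G" and K: "subgroup K G" and QK: "Q \<subseteq> K" and C: "C \<in> cosets_in G K Q"
  shows "coset_rep K C \<in> K" "Q #> coset_rep K C = C"
proof -
  obtain x where x: "x \<in> K" "C = Q #> x" using C by (auto simp: cosets_in_def)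
  have "x \<in> K \<inter> C" using x rcos_self[OF subgroup_mem[OF K x(1)] Q] by simp
  then have r: "coset_rep K C \<in> K \<inter> C" unfolding coset_rep_def by (rule someI)
  then show "coset_rep K C \<in> K" by blast
  show "Q #> coset_rep K C = C"
    using repr_independence[OF _ subgroup_mem[OF K x(1)] Q] r x by auto
qed

text \<open>Modulo p, h depends only on the coset, and right translation by y permutes the
  cosets.\<close>

lemma sum_coset_translate:
  assumes Q: "subgroup Q G" and K: "subgroup K G" and QK: "Q \<subseteq> K" and y: "y \<in> K"
    and h: "\<And>u x. u \<in> Q \<Longrightarrow> x \<in> K \<Longrightarrow> [h (u \<otimes> x) = h x] (mod int p)"
  shows "[(\<Sum>C\<in>cosets_in G K Q. h (coset_rep K C \<otimes> y)) = (\<Sum>C\<in>cosets_in G K Q. h (coset_rep K C))] (mod int p)"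
proof -
  note rep = coset_rep[OF Q K QK]
  have Kc: "w \<in> K \<Longrightarrow> w \<in> carrier G" for w using subgroup_mem[OF K] .
  have fin: "finite (cosets_in G K Q)" using finite_subgroup[OF K] by (simp add: cosets_in_def)
  have Ccarr: "C \<subseteq> carrier G" if "C \<in> cosets_in G K Q" for C
    using that Kc r_coset_subset_G[OF subgroup_sub[OF Q]] unfolding cosets_in_def by blast
  have cosmem: "C #> w \<in> cosets_in G K Q" if C: "C \<in> cosets_in G K Q" and w: "w \<in> K" for C w
  proof -
    obtain x where x: "x \<in> K" "C = Q #> x" using C by (auto simp: cosets_in_def)
    have "C #> w = Q #> (x \<otimes> w)" using x w Kc coset_mult_assoc[OF subgroup_sub[OF Q]] by simp
    then show ?thesis using subgroup.m_closed[OF K x(1) w] by (auto simp: cosets_in_def)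
  qed
  have iy: "inv y \<in> K" using subgroup.m_inv_closed[OF K y] .
  have bij: "bij_betw (\<lambda>C. C #> y) (cosets_in G K Q) (cosets_in G K Q)"
    by (rule bij_betwI[where g = "\<lambda>C. C #> inv y"])
      (use cosmem y iy Ccarr Kc in \<open>auto simp: coset_mult_assoc\<close>)
  have "[(\<Sum>C\<in>cosets_in G K Q. h (coset_rep K C \<otimes> y)) =
      (\<Sum>C\<in>cosets_in G K Q. h (coset_rep K (C #> y)))] (mod int p)"
  proof (rule cong_sum)
    fix C assume C: "C \<in> cosets_in G K Q"
    let ?t = "coset_rep K C" and ?s = "coset_rep K (C #> y)"
    have t: "?t \<in> K" "Q #> ?t = C" using rep[OF C] by auto
    have s: "?s \<in> K" "Q #> ?s = C #> y" using rep[OF cosmem[OF C y]] by auto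
    have ty: "?t \<otimes> y \<in> K" using subgroup.m_closed[OF K t(1) y] .
    have "Q #> (?t \<otimes> y) = Q #> ?s"
      using t s coset_mult_assoc[OF subgroup_sub[OF Q] Kc[OF t(1)] Kc[OF y]] by simp
    then have u: "(?t \<otimes> y) \<otimes> inv ?s \<in> Q" using rcos_eq_iff[OF Q Kc[OF ty] Kc[OF s(1)]] by blast
    have "?t \<otimes> y = ((?t \<otimes> y) \<otimes> inv ?s) \<otimes> ?s" using Kc t s y by (simp add: m_assoc)
    then show "[h (?t \<otimes> y) = h ?s] (mod int p)" using h[OF u s(1)] by simp
  qed
  also have "(\<Sum>C\<in>cosets_in G K Q. h (coset_rep K (C #> y))) = (\<Sum>C\<in>cosets_in G K Q. h (coset_rep K C))"
    by (rule sum.reindex_bij_betw[OF bij])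
  finally show ?thesis .
qed

text \<open>On the double coset Q s <u> put f (w s u^j) = \<theta> w + j \<theta> u. If w s u^i = v
  s u^j, then v^-1 w = s u^(j-i) s^-1, and \<open>st\<close> makes the two values agree.\<close>

lemma exists_equivariant:
  assumes Q: "subgroup Q G" and K: "subgroup K G" and QK: "Q \<subseteq> K" and th: "character_on Q \<theta>"
    and st: "\<And>g x. g \<in> K \<Longrightarrow> x \<in> Q \<Longrightarrow> cj g x \<in> Q \<Longrightarrow> [\<theta> (cj g x) = \<theta> x] (mod int p)"
    and u: "u \<in> Q"
  shows "\<exists>f. equivariant_on Q K \<theta> f \<and> (\<forall>x\<in>K. [f (x \<otimes> u) = f x + \<theta> u] (mod int p))"
proof -
  have Kc: "w \<in> K \<Longrightarrow> w \<in> carrier G" for w using subgroup_mem[OF K] .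
  have Qc: "w \<in> Q \<Longrightarrow> w \<in> carrier G" for w using subgroup_mem[OF Q] .
  define D where "D x = {w \<otimes> x \<otimes> u [^] (j::nat) | w j. w \<in> Q}" for x
  \<comment> \<open>Chosen from the set D x alone, hence the same for all elements of a double
    coset.\<close>
  define r where "r x = (SOME y. y \<in> D x)" for x
  have D_self: "x \<in> D x" if "x \<in> K" for x
    using that Kc subgroup.one_closed[OF Q] unfolding D_def by (auto intro!: exI[of _ \<one>] exI[of _ "0::nat"])
  have D_left: "D (v \<otimes> x) = D x" if v: "v \<in> Q" and x: "x \<in> K" for v x
  proof -
    have "D (v \<otimes> x) \<subseteq> D x" if v: "v \<in> Q" and x: "x \<in> K" for v x
    proof
      fix y assume "y \<in> D (v \<otimes> x)"
      then obtain w j where y: "w \<in> Q" "y = w \<otimes> (v \<otimes> x) \<otimes> u [^] (j::nat)" by (auto simp: D_def)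
      then have "y = (w \<otimes> v) \<otimes> x \<otimes> u [^] j" using v x Kc Qc u by (simp add: m_assoc)
      then show "y \<in> D x" using subgroup.m_closed[OF Q y(1) v] unfolding D_def by blast
    qed
    from this[OF v x] this[of "inv v" "v \<otimes> x"] show ?thesis
      using v x Qc Kc subgroup.m_inv_closed[OF Q v] subgroup.m_closed[OF K _ x] QK by auto
  qed
  have D_right: "D (x \<otimes> u) = D x" if x: "x \<in> K" for x
  proof
    show "D (x \<otimes> u) \<subseteq> D x"
    proof
      fix y assume "y \<in> D (x \<otimes> u)"
      then obtain w j where y: "w \<in> Q" "y = w \<otimes> (x \<otimes> u) \<otimes> u [^] (j::nat)" by (auto simp: D_def)
      then have "y = w \<otimes> x \<otimes> u [^] Suc j"
        using x Kc Qc u nat_pow_Suc2[of u j] by (simp add: m_assoc)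
      then show "y \<in> D x" using y(1) unfolding D_def by blast
    qed
    obtain k where k: "inv u = u [^] (k::nat)" using inv_as_pow Qc u by blast
    show "D x \<subseteq> D (x \<otimes> u)"
    proof
      fix y assume "y \<in> D x"
      then obtain w j where y: "w \<in> Q" "y = w \<otimes> x \<otimes> u [^] (j::nat)" by (auto simp: D_def)
      have "u \<otimes> u [^] (k + j) = u [^] j"
        using Qc[OF u] k by (metis inv_cancel_left(2) nat_pow_closed nat_pow_mult)
      then have "y = w \<otimes> (x \<otimes> u) \<otimes> u [^] (k + j)"
        using y x Kc Qc u by (simp add: m_assoc)
      then show "y \<in> D (x \<otimes> u)" using y(1) unfolding D_def by blast
    qed
  qed
  have rK: "r x \<in> K \<and> (\<exists>w j. w \<in> Q \<and> x = w \<otimes> r x \<otimes> u [^] (j::nat))" if x: "x \<in> K" for x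
  proof -
    have "r x \<in> D x" unfolding r_def using D_self[OF x] by (rule someI)
    then obtain w j where w: "w \<in> Q" "r x = w \<otimes> x \<otimes> u [^] (j::nat)" by (auto simp: D_def)
    have uj: "u [^] j \<in> carrier G" using Qc u by simp
    obtain k where k: "inv (u [^] j) = (u [^] j) [^] (k::nat)" using inv_as_pow[OF uj] by blast
    have "inv w \<otimes> r x \<otimes> inv (u [^] j) = x" using w x Kc Qc uj by (simp add: m_assoc)
    then have "x = inv w \<otimes> r x \<otimes> u [^] (j * k)" using k Qc[OF u] by (simp add: nat_pow_pow)
    moreover have "r x \<in> K"
      unfolding w(2) by (intro subgroup.m_closed[OF K] x subsetD[OF QK] w(1) subgroup_pow[OF Q u])
    ultimately show ?thesis using subgroup.m_inv_closed[OF Q w(1)] by blast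
  qed
  have wd: "[\<theta> w + int i * \<theta> u = \<theta> v + int j * \<theta> u] (mod int p)"
    if w: "w \<in> Q" and v: "v \<in> Q" and s: "s \<in> K" and e: "w \<otimes> s \<otimes> u [^] i = v \<otimes> s \<otimes> u [^] j" and ij: "i \<le> j"
    for w v s and i j :: nat
  proof -
    have c: "w \<in> carrier G" "v \<in> carrier G" "s \<in> carrier G" "u \<in> carrier G" using w v s u Qc Kc by auto
    have uij: "u [^] (j - i) \<in> Q" using subgroup_pow[OF Q u] .
    have "u [^] j = u [^] (j - i) \<otimes> u [^] i" using ij c by (simp add: nat_pow_mult)
    then have "w \<otimes> s \<otimes> u [^] i = (v \<otimes> s \<otimes> u [^] (j - i)) \<otimes> u [^] i" using e c by (simp add: m_assoc)
    then have "w \<otimes> s = v \<otimes> s \<otimes> u [^] (j - i)" using c by (metis m_closed nat_pow_closed right_cancel)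
    then have "inv v \<otimes> w = inv v \<otimes> (v \<otimes> s \<otimes> u [^] (j - i)) \<otimes> inv s" using c by (metis inv_solve_right m_assoc m_closed inv_closed)
    also have "\<dots> = cj (inv s) (u [^] (j - i))" using c by (simp add: conj_by_def m_assoc)
    finally have e2: "cj (inv s) (u [^] (j - i)) = inv v \<otimes> w" by simp
    have iv: "inv v \<in> Q" using subgroup.m_inv_closed[OF Q v] .
    have "inv v \<otimes> w \<in> Q" using subgroup.m_closed[OF Q iv w] .
    then have "[\<theta> (inv v \<otimes> w) = \<theta> (u [^] (j - i))] (mod int p)"
      using st[OF subgroup.m_inv_closed[OF K s] uij] e2 by simp
    moreover have "[\<theta> (inv v \<otimes> w) = - \<theta> v + \<theta> w] (mod int p)"
      using characterD[OF th iv w] character_inv[OF Q th v] by (meson cong_add cong_refl cong_trans)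
    moreover have "[\<theta> (u [^] (j - i)) = int (j - i) * \<theta> u] (mod int p)" using character_pow[OF Q th u] .
    ultimately have "[- \<theta> v + \<theta> w = int (j - i) * \<theta> u] (mod int p)" by (meson cong_sym cong_trans)
    then have "[(- \<theta> v + \<theta> w) + (\<theta> v + int i * \<theta> u) = int (j - i) * \<theta> u + (\<theta> v + int i * \<theta> u)] (mod int p)"
      by (rule cong_add) simp
    then show ?thesis using ij by (simp add: of_nat_diff algebra_simps)
  qed
  \<comment> \<open>The pair w, j is not unique; by \<open>wd\<close> the chosen value is well
    defined modulo p.\<close>
  define f where "f x = (SOME c. \<exists>w j. w \<in> Q \<and> x = w \<otimes> r x \<otimes> u [^] (j::nat) \<and> c = \<theta> w + int j * \<theta> u)" for x
  have feq: "[f x = \<theta> w + int j * \<theta> u] (mod int p)"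
    if x: "x \<in> K" and w: "w \<in> Q" "x = w \<otimes> r x \<otimes> u [^] j" for x w and j :: nat
  proof -
    have "\<exists>v i. v \<in> Q \<and> x = v \<otimes> r x \<otimes> u [^] (i::nat) \<and> f x = \<theta> v + int i * \<theta> u"
      unfolding f_def by (rule someI_ex) (use rK[OF x] in blast)
    then obtain v i where v: "v \<in> Q" "x = v \<otimes> r x \<otimes> u [^] (i::nat)" "f x = \<theta> v + int i * \<theta> u" by blast
    have rx: "r x \<in> K" using rK[OF x] by blast
    have e: "v \<otimes> r x \<otimes> u [^] i = w \<otimes> r x \<otimes> u [^] j" using v(2) w(2) by simp
    consider "i \<le> j" | "j \<le> i" by linarith
    then show ?thesis
    proof cases
      case 1 then show ?thesis using wd[OF v(1) w(1) rx e] v(3) by simp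
    next
      case 2 then show ?thesis using wd[OF w(1) v(1) rx e[symmetric]] v(3) cong_sym by metis
    qed
  qed
  have "equivariant_on Q K \<theta> f"
    unfolding equivariant_on_def
  proof (intro ballI)
    fix v x assume v: "v \<in> Q" and x: "x \<in> K"
    obtain w j where w: "w \<in> Q" "x = w \<otimes> r x \<otimes> u [^] (j::nat)" and rx: "r x \<in> K" using rK[OF x] by blast
    have rr: "r (v \<otimes> x) = r x" unfolding r_def using D_left[OF v x] by simp
    have vx: "v \<otimes> x \<in> K" using subgroup.m_closed[OF K] v x QK by blast
    have vw: "v \<otimes> w \<in> Q" using subgroup.m_closed[OF Q v w(1)] .
    have "v \<otimes> x = v \<otimes> (w \<otimes> r x \<otimes> u [^] j)" using w(2) by simp
    also have "\<dots> = (v \<otimes> w) \<otimes> r (v \<otimes> x) \<otimes> u [^] j" using rr v w(1) rx Qc Kc u by (simp add: m_assoc)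
    finally have "[f (v \<otimes> x) = \<theta> (v \<otimes> w) + int j * \<theta> u] (mod int p)" using feq[OF vx vw] by blast
    also have "[\<theta> (v \<otimes> w) + int j * \<theta> u = (\<theta> v + \<theta> w) + int j * \<theta> u] (mod int p)"
      by (rule cong_add[OF characterD[OF th v w(1)] cong_refl])
    also have "(\<theta> v + \<theta> w) + int j * \<theta> u = \<theta> v + (\<theta> w + int j * \<theta> u)" by simp
    also have "[\<dots> = \<theta> v + f x] (mod int p)"
      by (rule cong_add[OF cong_refl cong_sym[OF feq[OF x w]]])
    finally show "[f (v \<otimes> x) = \<theta> v + f x] (mod int p)" .
  qed
  moreover have "[f (x \<otimes> u) = f x + \<theta> u] (mod int p)" if x: "x \<in> K" for x
  proof -
    obtain w j where w: "w \<in> Q" "x = w \<otimes> r x \<otimes> u [^] (j::nat)" and rx: "r x \<in> K" using rK[OF x] by blast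
    have rr: "r (x \<otimes> u) = r x" unfolding r_def using D_right[OF x] by simp
    have xu: "x \<otimes> u \<in> K" using subgroup.m_closed[OF K x] u QK by blast
    have "x \<otimes> u = (w \<otimes> r x \<otimes> u [^] j) \<otimes> u" using w(2) by simp
    also have "\<dots> = w \<otimes> r (x \<otimes> u) \<otimes> u [^] Suc j" using rr w(1) rx Qc Kc u by (simp add: m_assoc)
    finally have "[f (x \<otimes> u) = \<theta> w + int (Suc j) * \<theta> u] (mod int p)" using feq[OF xu w(1)] by blast
    also have "\<theta> w + int (Suc j) * \<theta> u = (\<theta> w + int j * \<theta> u) + \<theta> u" by (simp add: algebra_simps)
    also have "[\<dots> = f x + \<theta> u] (mod int p)"
      by (rule cong_add[OF cong_sym[OF feq[OF x w]] cong_refl])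
    finally show ?thesis .
  qed
  ultimately show ?thesis by blast
qed

text \<open>V y is the sum of f (t y) - f t over coset representatives t. Modulo p it does not
  depend on the equivariant f, and for a given u some F satisfies F (x u) = F x + \<theta> u, which
  makes every summand \<theta> u. This replaces the usual splitting of the cosets into cycles of
  u.\<close>

theorem transfer:
  assumes Q: "subgroup Q G" and K: "subgroup K G" and QK: "Q \<subseteq> K" and th: "character_on Q \<theta>"
    and st: "\<And>g x. g \<in> K \<Longrightarrow> x \<in> Q \<Longrightarrow> cj g x \<in> Q \<Longrightarrow> [\<theta> (cj g x) = \<theta> x] (mod int p)"
  shows "\<exists>V. character_on K V \<and> (\<forall>u\<in>Q. [V u = int (card (cosets_in G K Q)) * \<theta> u] (mod int p))"
proof -
  note rep = coset_rep[OF Q K QK]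
  have Kc: "w \<in> K \<Longrightarrow> w \<in> carrier G" for w using subgroup_mem[OF K] .
  have Qc: "w \<in> Q \<Longrightarrow> w \<in> carrier G" for w using subgroup_mem[OF Q] .
  have trans: "[(\<Sum>C\<in>cosets_in G K Q. h (coset_rep K C \<otimes> y)) = (\<Sum>C\<in>cosets_in G K Q. h (coset_rep K C))] (mod int p)"
    if "y \<in> K" "\<And>u x. u \<in> Q \<Longrightarrow> x \<in> K \<Longrightarrow> [h (u \<otimes> x) = h x] (mod int p)" for h y
    using sum_coset_translate[OF Q K QK that] .
  obtain f where f: "equivariant_on Q K \<theta> f"
    using exists_equivariant[OF Q K QK th st subgroup.one_closed[OF Q]] by blast
  have fD: "[f (u \<otimes> x) = \<theta> u + f x] (mod int p)" if "u \<in> Q" "x \<in> K" for u x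
    using f that by (simp add: equivariant_on_def)
  define V where "V y = (\<Sum>C\<in>cosets_in G K Q. f (coset_rep K C \<otimes> y) - f (coset_rep K C))" for y
  have "character_on K V"
    unfolding character_on_def
  proof (intro ballI)
    fix y z assume y: "y \<in> K" and z: "z \<in> K"
    \<comment> \<open>Constant modulo p on cosets, so that moving the representatives by y does not
      change its sum V z; this is the additivity of V.\<close>
    define h where "h x = f (x \<otimes> z) - f x" for x
    have hh: "[h (u \<otimes> x) = h x] (mod int p)" if u: "u \<in> Q" and x: "x \<in> K" for u x
    proof -
      have "u \<otimes> x \<otimes> z = u \<otimes> (x \<otimes> z)" using u x z Kc Qc by (simp add: m_assoc)
      then have "[h (u \<otimes> x) = (\<theta> u + f (x \<otimes> z)) - (\<theta> u + f x)] (mod int p)"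
        unfolding h_def using fD[OF u subgroup.m_closed[OF K x z]] fD[OF u x] cong_diff by metis
      then show ?thesis by (simp add: h_def)
    qed
    have "V (y \<otimes> z) = (\<Sum>C\<in>cosets_in G K Q. h (coset_rep K C \<otimes> y)) + V y"
      unfolding V_def h_def sum.distrib[symmetric]
    proof (rule sum.cong[OF refl])
      fix C assume "C \<in> cosets_in G K Q"
      then have "coset_rep K C \<in> carrier G" using rep(1) Kc by blast
      then show "f (coset_rep K C \<otimes> (y \<otimes> z)) - f (coset_rep K C) =
          f (coset_rep K C \<otimes> y \<otimes> z) - f (coset_rep K C \<otimes> y) + (f (coset_rep K C \<otimes> y) - f (coset_rep K C))"
        using y z Kc by (simp add: m_assoc)
    qed
    moreover have "(\<Sum>C\<in>cosets_in G K Q. h (coset_rep K C)) = V z" by (simp add: V_def h_def)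
    ultimately show "[V (y \<otimes> z) = V y + V z] (mod int p)"
      using cong_add[OF trans[where h = h, OF y hh] cong_refl[of "V y"]] by (simp add: add.commute)
  qed
  moreover have "[V u = int (card (cosets_in G K Q)) * \<theta> u] (mod int p)" if u: "u \<in> Q" for u
  proof -
    obtain F where F: "equivariant_on Q K \<theta> F" and Fu: "\<And>x. x \<in> K \<Longrightarrow> [F (x \<otimes> u) = F x + \<theta> u] (mod int p)"
      using exists_equivariant[OF Q K QK th st u] by blast
    have uK: "u \<in> K" using u QK by blast
    \<comment> \<open>The difference of two equivariant functions is constant on cosets, so F may
      replace f in computing V u.\<close>
    define h where "h x = F x - f x" for x
    have hh: "[h (v \<otimes> x) = h x] (mod int p)" if v: "v \<in> Q" and x: "x \<in> K" for v x
    proof -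
      have "[F (v \<otimes> x) = \<theta> v + F x] (mod int p)" using F v x by (simp add: equivariant_on_def)
      then have "[h (v \<otimes> x) = (\<theta> v + F x) - (\<theta> v + f x)] (mod int p)"
        unfolding h_def using fD[OF v x] cong_diff by metis
      then show ?thesis by (simp add: h_def)
    qed
    let ?A = "\<Sum>C\<in>cosets_in G K Q. h (coset_rep K C \<otimes> u)" and ?B = "\<Sum>C\<in>cosets_in G K Q. h (coset_rep K C)"
    have 1: "[(\<Sum>C\<in>cosets_in G K Q. F (coset_rep K C \<otimes> u) - F (coset_rep K C)) = (\<Sum>C\<in>cosets_in G K Q. \<theta> u)] (mod int p)"
    proof (rule cong_sum)
      fix C assume "C \<in> cosets_in G K Q"
      then have "[F (coset_rep K C \<otimes> u) = F (coset_rep K C) + \<theta> u] (mod int p)" using Fu rep(1) by blast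
      then show "[F (coset_rep K C \<otimes> u) - F (coset_rep K C) = \<theta> u] (mod int p)"
        by (simp add: cong_iff_dvd_diff algebra_simps)
    qed
    have 2: "(\<Sum>C\<in>cosets_in G K Q. F (coset_rep K C \<otimes> u) - F (coset_rep K C)) = V u + (?A - ?B)"
      by (simp add: V_def h_def sum_subtractf)
    have "[V u + (?A - ?B) = V u + (?B - ?B)] (mod int p)"
      by (intro cong_add cong_diff cong_refl trans[where h = h, OF uK hh])
    then have 3: "[V u + (?A - ?B) = V u] (mod int p)" by simp
    have "[V u = (\<Sum>C\<in>cosets_in G K Q. \<theta> u)] (mod int p)"
      using cong_trans[OF cong_sym[OF 3] 1[unfolded 2]] .
    then show ?thesis by simp
  qed
  ultimately show ?thesis by blast
qed

text \<open>This says K = O^p(K), phrased as an induction rule: a property that cuts out a subgroup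
  of K need only be checked on p'-elements.\<close>

definition p'_generated where
  "p'_generated K \<longleftrightarrow> subgroup K G \<and>
    (\<forall>U. subgroup U G \<and> U \<subseteq> K \<and> (\<forall>x\<in>K. p'_elt x \<longrightarrow> x \<in> U) \<longrightarrow> U = K)"

lemma p'_generatedD:
  assumes "p'_generated K" "subgroup U G" "U \<subseteq> K" "\<And>x. x \<in> K \<Longrightarrow> p'_elt x \<Longrightarrow> x \<in> U"
  shows "U = K"
  using assms by (auto simp: p'_generated_def)

text \<open>The kernel of V is a subgroup containing every p'-element x, since m * V x vanishes
  modulo p for some m prime to p.\<close>

lemma p'_generated_no_character:
  assumes K: "p'_generated K" and V: "character_on K V" and x: "x \<in> K"
  shows "[V x = 0] (mod int p)"
proof -
  have KG: "subgroup K G" using K by (simp add: p'_generated_def)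
  define U where "U = {x \<in> K. [V x = 0] (mod int p)}"
  have "U = K"
  proof (rule p'_generatedD[OF K])
    show "subgroup U G"
    proof (rule finite_submonoid_subgroup)
      show "U \<subseteq> carrier G" using subgroup_mem[OF KG] by (auto simp: U_def)
      show "\<one> \<in> U" using character_one[OF KG V] subgroup.one_closed[OF KG] by (simp add: U_def)
      fix x y assume xy: "x \<in> U" "y \<in> U"
      then have "[V (x \<otimes> y) = 0 + 0] (mod int p)"
        using characterD[OF V, of x y] unfolding U_def by (metis (no_types, lifting) cong_add cong_trans mem_Collect_eq)
      then show "x \<otimes> y \<in> U" using xy subgroup.m_closed[OF KG] by (auto simp: U_def)
    qed
    fix x assume x: "x \<in> K" "p'_elt x"
    then obtain m :: nat where m: "coprime m p" "x [^] m = \<one>" by (auto simp: p'_elt_def)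
    have "[int m * V x = 0] (mod int p)"
      using character_pow[OF KG V x(1), of m] character_one[OF KG V] m(2) by (metis cong_sym cong_trans)
    then have "int p dvd int m * V x" by (simp add: cong_0_iff)
    moreover have "coprime (int p) (int m)" using m(1) by (simp add: coprime_commute)
    ultimately have "int p dvd V x" using coprime_dvd_mult_right_iff by blast
    then show "x \<in> U" using x by (simp add: U_def cong_0_iff)
  qed (auto simp: U_def)
  then show ?thesis using x by (auto simp: U_def)
qed

text \<open>Fusion extends the stability of \<theta> to all of K, so transfer yields a character V
  of K that restricts to |K : Q| \<theta> on Q. V vanishes, and the index is prime to p.\<close>

theorem no_p'_stable_character:
  assumes K: "p'_generated K" and Q: "sylow_in G p Q K" and th: "character_on Q \<theta>"
    and st: "\<And>C g x. subgroup C G \<Longrightarrow> C \<subseteq> Q \<Longrightarrow> g \<in> normalizer_in G K C \<Longrightarrow> p'_elt g \<Longrightarrow> x \<in> C \<Longrightarrow>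
      [\<theta> (cj g x) = \<theta> x] (mod int p)"
    and u: "u \<in> Q"
  shows "[\<theta> u = 0] (mod int p)"
proof -
  obtain n m where QG: "subgroup Q G" and KG: "subgroup K G" and QK: "Q \<subseteq> K"
    and cQ: "card Q = p ^ n" and cK: "card K = m * p ^ n" "\<not> p dvd m"
    using Q by (auto simp: sylow_in_def)
  \<comment> \<open>\<open>fusion_stable\<close> speaks of equal values, hence the passage to
    residues.\<close>
  define f where "f x = \<theta> x mod int p" for x
  have fQ: "f (cj u x) = f x" if u: "u \<in> Q" and x: "x \<in> Q" for u x
  proof -
    have iu: "inv u \<in> Q" "inv u \<otimes> x \<in> Q"
      using u x subgroup.m_inv_closed[OF QG u] subgroup.m_closed[OF QG] by auto
    have "[\<theta> (cj u x) = \<theta> (inv u \<otimes> x) + \<theta> u] (mod int p)"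
      unfolding conj_by_def using characterD[OF th iu(2) u] .
    also have "[\<theta> (inv u \<otimes> x) + \<theta> u = (\<theta> (inv u) + \<theta> x) + \<theta> u] (mod int p)"
      by (rule cong_add[OF characterD[OF th iu(1) x] cong_refl])
    also have "[(\<theta> (inv u) + \<theta> x) + \<theta> u = (- \<theta> u + \<theta> x) + \<theta> u] (mod int p)"
      by (intro cong_add cong_refl character_inv[OF QG th u])
    finally show ?thesis by (simp add: f_def cong_def)
  qed
  have "[\<theta> (cj g x) = \<theta> x] (mod int p)" if g: "g \<in> K" and x: "x \<in> Q" "cj g x \<in> Q" for g x
  proof -
    have xc: "x \<in> carrier G" and gc: "g \<in> carrier G" using x g subgroup_mem QG KG by auto
    have gA: "cj g ` powers x \<subseteq> Q" using subgroup_pow[OF QG x(2)] gc xc by (auto simp: powers_def cj_pow)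
    have "f (cj g x) = f x"
      by (rule fusion_stable[OF Q fQ _ powers_subgroup[OF xc] powers_subset[OF QG x(1)] g gA powers_self[OF xc]]) (use st in \<open>auto simp: f_def cong_def\<close>)
    then show ?thesis by (simp add: f_def cong_def)
  qed
  then obtain V where V: "character_on K V" "\<And>u. u \<in> Q \<Longrightarrow> [V u = int (card (cosets_in G K Q)) * \<theta> u] (mod int p)"
    using transfer[OF QG KG QK th] by blast
  have "card (cosets_in G K Q) * p ^ n = m * p ^ n" using lagrange_in[OF QG KG QK] cQ cK by simp
  then have m: "card (cosets_in G K Q) = m" using p_gt_1 by simp
  have "[int m * \<theta> u = 0] (mod int p)"
    using p'_generated_no_character[OF K V(1), of u] V(2)[OF u] m u QK by (metis cong_sym cong_trans subsetD)
  then have "int p dvd int m * \<theta> u" by (simp add: cong_0_iff)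
  moreover have "coprime (int p) (int m)" using cK(2) prime_p by (simp add: prime_imp_coprime)
  ultimately show ?thesis by (simp add: coprime_dvd_mult_right_iff cong_0_iff)
qed

section \<open>Strongly closed subgroups and complements\<close>

definition strongly_closed where
  "strongly_closed Q K R \<longleftrightarrow> (\<forall>x\<in>R. \<forall>g\<in>K. cj g x \<in> Q \<longrightarrow> cj g x \<in> R)"

lemma strongly_closed_invariant:
  assumes "subgroup Q G" "Q \<subseteq> K" "R \<subseteq> Q" "strongly_closed Q K R"
  shows "invariant G Q R"
  using assms subgroup_cj[OF assms(1)] unfolding invariant_def strongly_closed_def by blast

text \<open>R is the kernel of a character of Q. By strong closure conjugation respects this kernel
  on every C, and \<open>character_conj_invariant\<close> makes the character stable, hence
  zero.\<close>

lemma no_strongly_closed_index_p: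
  assumes K: "p'_generated K" and Q: "sylow_in G p Q K" and cop: "coprime (order G) (p - 1)"
    and R: "subgroup R G" "R \<subseteq> Q" "strongly_closed Q K R" and c: "card Q = p * card R"
  shows False
proof -
  have QG: "subgroup Q G" and KG: "subgroup K G" and QK: "Q \<subseteq> K" using Q by (auto simp: sylow_in_def)
  have inv: "invariant G Q R" using strongly_closed_invariant[OF QG QK R(2,3)] .
  obtain \<theta> where th: "character_on Q \<theta>" and ker: "\<And>x. x \<in> Q \<Longrightarrow> [\<theta> x = 0] (mod int p) \<longleftrightarrow> x \<in> R"
    using exists_character[OF QG R(1,2) inv c] by auto
  have "[\<theta> (cj g x) = \<theta> x] (mod int p)"
    if C: "subgroup C G" "C \<subseteq> Q" and g: "g \<in> normalizer_in G K C" and x: "x \<in> C" for C g x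
  proof (rule character_conj_invariant[OF QG th C _ _ _ cop x])
    have gK: "g \<in> K" and gC: "\<And>y. y \<in> C \<Longrightarrow> cj g y \<in> C" using g by (auto simp: normalizer_in_def)
    show "g \<in> carrier G" using gK subgroup_mem[OF KG] by blast
    show "cj g y \<in> C" if "y \<in> C" for y using gC that .
    show "[\<theta> (cj g y) = 0] (mod int p)" if y: "y \<in> C" "[\<theta> y = 0] (mod int p)" for y
    proof -
      have "y \<in> R" using ker y C by blast
      moreover have "cj g y \<in> Q" using gC[OF y(1)] C by blast
      ultimately show ?thesis using R(3) gK ker by (simp add: strongly_closed_def)
    qed
  qed
  then have "\<And>u. u \<in> Q \<Longrightarrow> [\<theta> u = 0] (mod int p)"
    using no_p'_stable_character[OF K Q th] by blast
  then have "Q = R" using ker R(2) by blast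
  then show False using c card_subgroup_pos[OF R(1)] p_gt_1 by simp
qed

section \<open>Products of subgroups\<close>

lemma set_mult_mem: "x \<in> H <#> K \<longleftrightarrow> (\<exists>h\<in>H. \<exists>k\<in>K. x = h \<otimes> k)"
  by (auto simp: set_mult_def)

lemma invariant_set_mult_subgroup:
  assumes M: "subgroup M G" and Y: "subgroup Y G" and inv: "invariant G Y M"
  shows "subgroup (M <#> Y) G"
proof (rule finite_submonoid_subgroup)
  have Mc: "x \<in> M \<Longrightarrow> x \<in> carrier G" and Yc: "x \<in> Y \<Longrightarrow> x \<in> carrier G" for x
    using subgroup_mem M Y by auto
  show "M <#> Y \<subseteq> carrier G" using Mc Yc by (auto simp: set_mult_mem)
  show "\<one> \<in> M <#> Y"
    using subgroup.one_closed[OF M] subgroup.one_closed[OF Y] unfolding set_mult_mem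
    by (intro bexI[of _ \<one>]) auto
  fix x y assume "x \<in> M <#> Y" "y \<in> M <#> Y"
  then obtain m u m' u' where e: "m \<in> M" "u \<in> Y" "x = m \<otimes> u" "m' \<in> M" "u' \<in> Y" "y = m' \<otimes> u'"
    by (auto simp: set_mult_mem)
  have "x \<otimes> y = (m \<otimes> cj (inv u) m') \<otimes> (u \<otimes> u')"
    using e Mc Yc by (simp add: conj_by_def m_assoc)
  moreover have "cj (inv u) m' \<in> M" using invariantD[OF inv subgroup.m_inv_closed[OF Y e(2)] e(4)] .
  ultimately show "x \<otimes> y \<in> M <#> Y"
    using subgroup.m_closed[OF M e(1)] subgroup.m_closed[OF Y e(2,5)] unfolding set_mult_mem by blast
qed

lemma subset_set_mult:
  assumes M: "subgroup M G" and Y: "subgroup Y G"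
  shows "M \<subseteq> M <#> Y" "Y \<subseteq> M <#> Y"
proof -
  show "M \<subseteq> M <#> Y"
  proof
    fix x assume "x \<in> M"
    then have "x = x \<otimes> \<one>" using subgroup_mem[OF M] by simp
    then show "x \<in> M <#> Y" using \<open>x \<in> M\<close> subgroup.one_closed[OF Y] unfolding set_mult_mem by blast
  qed
  show "Y \<subseteq> M <#> Y"
  proof
    fix x assume "x \<in> Y"
    then have "x = \<one> \<otimes> x" using subgroup_mem[OF Y] by simp
    then show "x \<in> M <#> Y" using \<open>x \<in> Y\<close> subgroup.one_closed[OF M] unfolding set_mult_mem by blast
  qed
qed

text \<open>The cosets M y in the product correspond to the cosets of the intersection in Y.\<close>

lemma card_set_mult:
  assumes M: "subgroup M G" and Y: "subgroup Y G" and inv: "invariant G Y M"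
  shows "card (M <#> Y) * card (M \<inter> Y) = card M * card Y"
proof -
  have Mc: "x \<in> M \<Longrightarrow> x \<in> carrier G" and Yc: "x \<in> Y \<Longrightarrow> x \<in> carrier G" for x
    using subgroup_mem M Y by auto
  have T: "subgroup (M <#> Y) G" by (rule invariant_set_mult_subgroup[OF assms])
  have I: "subgroup (M \<inter> Y) G" using M Y by (rule subgroups_Inter_pair)
  have "cosets_in G (M <#> Y) M = (\<lambda>y. M #> y) ` Y"
  proof
    show "cosets_in G (M <#> Y) M \<subseteq> (\<lambda>y. M #> y) ` Y"
    proof
      fix C assume "C \<in> cosets_in G (M <#> Y) M"
      then obtain m y where my: "m \<in> M" "y \<in> Y" "C = M #> (m \<otimes> y)" by (auto simp: cosets_in_def set_mult_mem)
      have "M #> (m \<otimes> y) = M #> y" using my Mc Yc rcos_eq_iff[OF M, of "m \<otimes> y" y] by (simp add: m_assoc)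
      then show "C \<in> (\<lambda>y. M #> y) ` Y" using my by blast
    qed
    show "(\<lambda>y. M #> y) ` Y \<subseteq> cosets_in G (M <#> Y) M"
      using subset_set_mult(2)[OF M Y] by (auto simp: cosets_in_def)
  qed
  moreover have "card ((\<lambda>y. M #> y) ` Y) = card (cosets_in G Y (M \<inter> Y))"
  proof (rule bij_betw_same_card[of "\<lambda>C. THE D. \<exists>y\<in>Y. C = M #> y \<and> D = (M \<inter> Y) #> y"])
    have key: "M #> x = M #> y \<longleftrightarrow> (M \<inter> Y) #> x = (M \<inter> Y) #> y" if "x \<in> Y" "y \<in> Y" for x y
      using that rcos_eq_iff[OF M] rcos_eq_iff[OF I] Yc subgroup.m_closed[OF Y] subgroup.m_inv_closed[OF Y] by simp
    have the: "(THE D. \<exists>y\<in>Y. M #> x = M #> y \<and> D = (M \<inter> Y) #> y) = (M \<inter> Y) #> x" if "x \<in> Y" for x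
      by (rule the_equality) (use that key in blast)+
    show "bij_betw (\<lambda>C. THE D. \<exists>y\<in>Y. C = M #> y \<and> D = (M \<inter> Y) #> y) ((\<lambda>y. M #> y) ` Y) (cosets_in G Y (M \<inter> Y))"
      unfolding bij_betw_def inj_on_def cosets_in_def using the key by (auto simp: image_iff)
  qed
  ultimately have "card (cosets_in G (M <#> Y) M) = card (cosets_in G Y (M \<inter> Y))" by simp
  moreover have "card (cosets_in G (M <#> Y) M) * card M = card (M <#> Y)"
    using lagrange_in[OF M T subset_set_mult(1)[OF M Y]] .
  moreover have "card (cosets_in G Y (M \<inter> Y)) * card (M \<inter> Y) = card Y"
    using lagrange_in[OF I Y] by simp
  ultimately show ?thesis by (metis mult.assoc mult.commute)
qed

lemma pow_mem_coprime:
  assumes R: "subgroup R G" and y: "y \<in> carrier G" "y [^] (a::nat) \<in> R" "y [^] (b::nat) \<in> R" "coprime a b"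
  shows "y \<in> R"
proof (cases "a = 0")
  case True
  then show ?thesis using y by simp
next
  case False
  obtain s t where st: "a * s = b * t + 1" using bezout_nat[OF False, of b] y(4) by auto
  have "(y [^] a) [^] s = (y [^] b) [^] t \<otimes> y"
    using y(1) st by (simp add: nat_pow_pow)
  then have "y = inv ((y [^] b) [^] t) \<otimes> (y [^] a) [^] s" using y(1) by simp
  moreover have "(y [^] a) [^] s \<in> R" "inv ((y [^] b) [^] t) \<in> R"
    using subgroup_pow[OF R] subgroup.m_inv_closed[OF R] y by auto
  ultimately show ?thesis using subgroup.m_closed[OF R] by metis
qed

text \<open>Gaschuetz-style averaging, giving the instance of Tate's theorem that is needed. The extension
  of \<open>P/Q = G/K\<close> by \<open>Q/R\<close> carried by \<open>P/R\<close> is pulled back to \<open>G\<close>. On \<open>P\<close> the map \<open>f\<close> is a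
  lift, so the cocycle \<open>\<theta> (w x y)\<close> only depends on the coset \<open>P x\<close>; averaging over these
  cosets splits it, and the corrected map \<open>f'\<close> is a homomorphism modulo \<open>R\<close> whose image is the
  complement \<open>S\<close>.\<close>

theorem complement_modulo:
  assumes K: "p'_generated K" "invariant G (carrier G) K"
    and P: "sylow_in G p P (carrier G)" and PK: "\<And>x. x \<in> carrier G \<Longrightarrow> \<exists>k\<in>K. x \<otimes> k \<in> P"
    and cop: "coprime (order G) (p - 1)"
    and R: "subgroup R G" "R \<subseteq> P \<inter> K" "invariant G P R" and cR: "card (P \<inter> K) = p * card R"
  shows "\<exists>S. subgroup S G \<and> S \<subseteq> P \<and> S \<inter> K = R \<and> card P = p * card S"
proof -
  define Q where "Q = P \<inter> K"
  obtain n m where PG: "subgroup P G" and cP: "card P = p ^ n" and cG: "order G = m * p ^ n" "\<not> p dvd m"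
    using P by (auto simp: sylow_in_def order_def)
  have KG: "subgroup K G" using K by (simp add: p'_generated_def)
  have QG: "subgroup Q G" unfolding Q_def using PG KG by (rule subgroups_Inter_pair)
  have Gs: "subgroup (carrier G) G" by (rule subgroup_self)
  have Pc: "x \<in> P \<Longrightarrow> x \<in> carrier G" and Kc: "x \<in> K \<Longrightarrow> x \<in> carrier G" and Rc: "x \<in> R \<Longrightarrow> x \<in> carrier G"
    and Qc: "x \<in> Q \<Longrightarrow> x \<in> carrier G" for x
    using subgroup_mem PG KG R(1) QG by auto
  have PcG: "P \<subseteq> carrier G" using Pc by blast
  have Qinv: "invariant G P Q"
    using invariantD[OF K(2)] subgroup_cj[OF PG] Pc unfolding invariant_def Q_def by blast
  have RQ: "R \<subseteq> Q" using R by (simp add: Q_def)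
  have RP: "R \<subseteq> P" using R by blast
  obtain \<theta> where th: "character_on Q \<theta>" and ker: "\<And>x. x \<in> Q \<Longrightarrow> [\<theta> x = 0] (mod int p) \<longleftrightarrow> x \<in> R"
    using exists_character[OF QG R(1) RQ invariant_subset[OF R(3)]] cR by (auto simp: Q_def)
  have thinv: "[\<theta> (cj u x) = \<theta> x] (mod int p)" if u: "u \<in> P" and x: "x \<in> Q" for u x
  proof (rule character_conj_invariant[OF QG th QG subset_refl Pc[OF u] _ _ cop x])
    show Q: "cj u y \<in> Q" if "y \<in> Q" for y using invariantD[OF Qinv u that] .
    show "[\<theta> (cj u y) = 0] (mod int p)" if "y \<in> Q" "[\<theta> y = 0] (mod int p)" for y
      using ker that Q invariantD[OF R(3) u] by blast
  qed
  have "Q \<noteq> R" using cR card_subgroup_pos[OF R(1)] p_gt_1 by (auto simp: Q_def)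
  then obtain a0 where a0: "a0 \<in> Q" "\<not> [\<theta> a0 = 0] (mod int p)" using ker RQ by blast
  have pp: "Factorial_Ring.prime (int p)" using prime_p by simp
  then have "coprime (\<theta> a0) (int p)" using a0(2) by (metis cong_0_iff coprime_commute prime_imp_coprime)
  then obtain v where v: "[\<theta> a0 * v = 1] (mod int p)" using cong_solve_coprime_int by blast
  \<comment> \<open>A section of \<theta>: a power of a0 with prescribed value c.\<close>
  define a where "a c = a0 [^] nat ((c * v) mod int p)" for c :: int
  have aQ: "a c \<in> Q" for c unfolding a_def using subgroup_pow[OF QG a0(1)] .
  have tha: "[\<theta> (a c) = c] (mod int p)" for c
  proof -
    have "[\<theta> (a c) = int (nat ((c * v) mod int p)) * \<theta> a0] (mod int p)"
      unfolding a_def using character_pow[OF QG th a0(1)] .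
    also have "[int (nat ((c * v) mod int p)) * \<theta> a0 = (c * v) * \<theta> a0] (mod int p)"
      using p_gt_1 by (intro cong_scalar_right) simp
    also have "(c * v) * \<theta> a0 = c * (\<theta> a0 * v)" by simp
    also have "[\<dots> = c * 1] (mod int p)" using v by (rule cong_scalar_left)
    finally show ?thesis by simp
  qed
  \<comment> \<open>One k serves the whole coset P x, which makes f commute with left multiplication
    by P.\<close>
  define kk where "kk C = (SOME k. k \<in> K \<and> (\<forall>x\<in>C. x \<otimes> k \<in> P))" for C
  have kk: "kk (P #> x) \<in> K \<and> (\<forall>y\<in>P #> x. y \<otimes> kk (P #> x) \<in> P)" if x: "x \<in> carrier G" for x
  proof -
    obtain k where k: "k \<in> K" "x \<otimes> k \<in> P" using PK x by blast
    have "y \<otimes> k \<in> P" if "y \<in> P #> x" for y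
    proof -
      obtain u where "u \<in> P" "y = u \<otimes> x" using \<open>y \<in> P #> x\<close> by (auto simp: r_coset_def)
      then show ?thesis using subgroup.m_closed[OF PG _ k(2)] x k Pc Kc by (simp add: m_assoc)
    qed
    then show ?thesis unfolding kk_def using k someI[of "\<lambda>k. k \<in> K \<and> (\<forall>y\<in>P #> x. y \<otimes> k \<in> P)"] by blast
  qed
  define f where "f x = x \<otimes> kk (P #> x)" for x
  have kkc: "kk (P #> x) \<in> carrier G" if "x \<in> carrier G" for x using kk[OF that] Kc by blast
  have fP: "f x \<in> P" if "x \<in> carrier G" for x
    unfolding f_def using kk[OF that] rcos_self[OF that PG] by blast
  have fu: "f (u \<otimes> x) = u \<otimes> f x" if u: "u \<in> P" and x: "x \<in> carrier G" for u x
  proof -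
    have "P #> (u \<otimes> x) = P #> x" using rcos_eq_iff[OF PG, of "u \<otimes> x" x] u x Pc by (simp add: m_assoc)
    then show ?thesis unfolding f_def using u x Pc kkc by (simp add: m_assoc)
  qed
  have fc: "f x \<in> carrier G" if "x \<in> carrier G" for x using fP[OF that] Pc by blast
  \<comment> \<open>The factor set of f. Its values lie in K because f x lies in x K and K is
    normal.\<close>
  define w where "w x y = inv (f (x \<otimes> y)) \<otimes> (f x \<otimes> f y)" for x y
  have wQ: "w x y \<in> Q" if x: "x \<in> carrier G" and y: "y \<in> carrier G" for x y
  proof -
    have "w x y \<in> P"
      unfolding w_def by (intro subgroup.m_closed[OF PG] subgroup.m_inv_closed[OF PG] fP x y m_closed)
    moreover have "w x y \<in> K"
    proof -
      have "w x y = inv (kk (P #> (x \<otimes> y))) \<otimes> (cj y (kk (P #> x)) \<otimes> kk (P #> y))"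
        unfolding w_def f_def conj_by_def using x y kkc by (simp add: inv_mult_group m_assoc)
      also have "\<dots> \<in> K"
        using kk x y invariantD[OF K(2) y]
        by (intro subgroup.m_closed[OF KG] subgroup.m_inv_closed[OF KG]) auto
      finally show ?thesis .
    qed
    ultimately show ?thesis by (simp add: Q_def)
  qed
  have fmul: "f x \<otimes> f y = f (x \<otimes> y) \<otimes> w x y" if "x \<in> carrier G" "y \<in> carrier G" for x y
    unfolding w_def using fc that by simp
  have coc: "[\<theta> (w (x \<otimes> y) z) + \<theta> (w x y) = \<theta> (w x (y \<otimes> z)) + \<theta> (w y z)] (mod int p)"
    if x: "x \<in> carrier G" and y: "y \<in> carrier G" and z: "z \<in> carrier G" for x y z
  proof -
    \<comment> \<open>Both sides equal f(xyz)^-1 f(x) f(y) f(z).\<close>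
    have e: "w (x \<otimes> y) z \<otimes> cj (f z) (w x y) = w x (y \<otimes> z) \<otimes> w y z"
      unfolding w_def conj_by_def using x y z fc by (simp add: m_assoc)
    have c: "cj (f z) (w x y) \<in> Q" using invariantD[OF Qinv fP[OF z] wQ[OF x y]] .
    have "[\<theta> (w (x \<otimes> y) z) + \<theta> (w x y) = \<theta> (w (x \<otimes> y) z) + \<theta> (cj (f z) (w x y))] (mod int p)"
      using thinv[OF fP[OF z] wQ[OF x y]] by (intro cong_add cong_refl) (rule cong_sym)
    also have "[\<theta> (w (x \<otimes> y) z) + \<theta> (cj (f z) (w x y)) = \<theta> (w (x \<otimes> y) z \<otimes> cj (f z) (w x y))] (mod int p)"
      by (rule cong_sym, rule characterD[OF th wQ c]) (use x y z in auto)
    also have "\<theta> (w (x \<otimes> y) z \<otimes> cj (f z) (w x y)) = \<theta> (w x (y \<otimes> z) \<otimes> w y z)" using e by simp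
    also have "[\<dots> = \<theta> (w x (y \<otimes> z)) + \<theta> (w y z)] (mod int p)"
      using x y z by (intro characterD[OF th] wQ) auto
    finally show ?thesis .
  qed
  have wu: "w (u \<otimes> x) y = w x y" if u: "u \<in> P" and x: "x \<in> carrier G" and y: "y \<in> carrier G" for u x y
    unfolding w_def using fu[OF u] u x y fc Pc by (simp add: m_assoc inv_mult_group)
  let ?Cs = "cosets_in G (carrier G) P"
  note rep = coset_rep[OF PG Gs PcG]
  \<comment> \<open>The sum of the factor set over the cosets of P in its first argument; by the
    cocycle identity its coboundary is m times the factor set, m being the index of P.\<close>
  define b where "b y = (\<Sum>C\<in>?Cs. \<theta> (w (coset_rep (carrier G) C) y))" for y
  have "card ?Cs * p ^ n = m * p ^ n" using lagrange_in[OF PG Gs PcG] cP cG by (simp add: order_def)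
  then have cCs: "card ?Cs = m" using p_gt_1 by simp
  have bsum: "[b z + b y = b (y \<otimes> z) + int m * \<theta> (w y z)] (mod int p)" if y: "y \<in> carrier G" and z: "z \<in> carrier G" for y z
  proof -
    have "[(\<Sum>C\<in>?Cs. \<theta> (w (coset_rep (carrier G) C \<otimes> y) z)) = b z] (mod int p)"
      unfolding b_def by (rule sum_coset_translate[OF PG Gs PcG y]) (use wu z in auto)
    then have "[b z + b y = (\<Sum>C\<in>?Cs. \<theta> (w (coset_rep (carrier G) C \<otimes> y) z)) + b y] (mod int p)"
      by (intro cong_add cong_refl) (rule cong_sym)
    also have "(\<Sum>C\<in>?Cs. \<theta> (w (coset_rep (carrier G) C \<otimes> y) z)) + b y =
        (\<Sum>C\<in>?Cs. \<theta> (w (coset_rep (carrier G) C \<otimes> y) z) + \<theta> (w (coset_rep (carrier G) C) y))"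
      by (simp add: b_def sum.distrib)
    also have "[\<dots> = (\<Sum>C\<in>?Cs. \<theta> (w (coset_rep (carrier G) C) (y \<otimes> z)) + \<theta> (w y z))] (mod int p)"
      using coc rep(1) y z by (intro cong_sum) auto
    also have "(\<Sum>C\<in>?Cs. \<theta> (w (coset_rep (carrier G) C) (y \<otimes> z)) + \<theta> (w y z)) = b (y \<otimes> z) + int m * \<theta> (w y z)"
      by (simp add: b_def sum.distrib cCs)
    finally show ?thesis .
  qed
  have "coprime (int m) (int p)" using cG(2) pp by (metis coprime_commute int_dvd_int_iff prime_imp_coprime)
  then obtain m' where m': "[int m * m' = 1] (mod int p)" using cong_solve_coprime_int by blast
  \<comment> \<open>m' inverts the index m modulo p, so \<theta> takes the value - b / m on q, which
    cancels the factor set.\<close>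
  define q where "q x = a (- (m' * b x))" for x
  have qQ: "q x \<in> Q" for x unfolding q_def by (rule aQ)
  define f' where "f' x = f x \<otimes> q x" for x
  have f'P: "f' x \<in> P" if "x \<in> carrier G" for x
    unfolding f'_def using fP[OF that] qQ subgroup.m_closed[OF PG] by (simp add: Q_def)
  have f'c: "f' x \<in> carrier G" if "x \<in> carrier G" for x using f'P[OF that] Pc by blast
  have hom: "inv (f' (x \<otimes> y)) \<otimes> (f' x \<otimes> f' y) \<in> R" if x: "x \<in> carrier G" and y: "y \<in> carrier G" for x y
  proof -
    have xy: "x \<otimes> y \<in> carrier G" using x y by simp
    let ?r = "inv (q (x \<otimes> y)) \<otimes> (w x y \<otimes> (cj (f y) (q x) \<otimes> q y))"
    have e: "inv (f' (x \<otimes> y)) \<otimes> (f' x \<otimes> f' y) = ?r"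
      unfolding f'_def w_def conj_by_def using x y xy fc qQ Qc by (simp add: inv_mult_group m_assoc)
    have i: "inv (q (x \<otimes> y)) \<in> Q" using subgroup.m_inv_closed[OF QG qQ] .
    have c: "cj (f y) (q x) \<in> Q" using invariantD[OF Qinv fP[OF y] qQ] .
    have c2: "cj (f y) (q x) \<otimes> q y \<in> Q" using subgroup.m_closed[OF QG c qQ] .
    have c3: "w x y \<otimes> (cj (f y) (q x) \<otimes> q y) \<in> Q" using subgroup.m_closed[OF QG wQ[OF x y] c2] .
    have "[\<theta> ?r = \<theta> (inv (q (x \<otimes> y))) + \<theta> (w x y \<otimes> (cj (f y) (q x) \<otimes> q y))] (mod int p)"
      by (rule characterD[OF th i c3])
    also have "[\<theta> (inv (q (x \<otimes> y))) + \<theta> (w x y \<otimes> (cj (f y) (q x) \<otimes> q y)) =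
        - \<theta> (q (x \<otimes> y)) + (\<theta> (w x y) + \<theta> (cj (f y) (q x) \<otimes> q y))] (mod int p)"
      by (intro cong_add character_inv[OF QG th qQ] characterD[OF th wQ[OF x y] c2])
    also have "[- \<theta> (q (x \<otimes> y)) + (\<theta> (w x y) + \<theta> (cj (f y) (q x) \<otimes> q y)) =
        - \<theta> (q (x \<otimes> y)) + (\<theta> (w x y) + (\<theta> (cj (f y) (q x)) + \<theta> (q y)))] (mod int p)"
      by (intro cong_add cong_refl characterD[OF th c qQ])
    also have "[- \<theta> (q (x \<otimes> y)) + (\<theta> (w x y) + (\<theta> (cj (f y) (q x)) + \<theta> (q y))) =
        - (- (m' * b (x \<otimes> y))) + (1 * \<theta> (w x y) + (- (m' * b x) + - (m' * b y)))] (mod int p)"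
    proof (intro cong_add)
      show "[- \<theta> (q (x \<otimes> y)) = - (- (m' * b (x \<otimes> y)))] (mod int p)"
        unfolding q_def by (subst cong_minus_minus_iff) (rule tha)
      show "[\<theta> (cj (f y) (q x)) = - (m' * b x)] (mod int p)"
        using thinv[OF fP[OF y] qQ] tha unfolding q_def using cong_trans by blast
      show "[\<theta> (q y) = - (m' * b y)] (mod int p)" unfolding q_def by (rule tha)
    qed simp
    also have "[- (- (m' * b (x \<otimes> y))) + (1 * \<theta> (w x y) + (- (m' * b x) + - (m' * b y))) =
        - (- (m' * b (x \<otimes> y))) + ((int m * m') * \<theta> (w x y) + (- (m' * b x) + - (m' * b y)))] (mod int p)"
      by (intro cong_add cong_refl cong_scalar_right cong_sym[OF m'])
    also have "- (- (m' * b (x \<otimes> y))) + ((int m * m') * \<theta> (w x y) + (- (m' * b x) + - (m' * b y))) =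
        m' * ((b (x \<otimes> y) + int m * \<theta> (w x y)) - (b y + b x))" by (simp add: algebra_simps)
    also have "[\<dots> = m' * 0] (mod int p)"
      by (rule cong_scalar_left) (use bsum[OF x y] in \<open>simp add: cong_iff_dvd_diff dvd_diff_commute\<close>)
    finally have "[\<theta> ?r = 0] (mod int p)" by simp
    moreover have "?r \<in> Q" using subgroup.m_closed[OF QG i c3] .
    ultimately have "?r \<in> R" using ker by blast
    then show ?thesis using e by simp
  qed
  have f'1: "f' \<one> \<in> R" using hom[OF one_closed one_closed] f'c by simp
  have Rm: "x \<otimes> y \<in> R" if "x \<in> R" "y \<in> R" for x y using subgroup.m_closed[OF R(1) that] .
  have Ri: "inv x \<in> R" if "x \<in> R" for x using subgroup.m_inv_closed[OF R(1) that] .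
  have f'mul: "\<exists>r\<in>R. f' (x \<otimes> y) = f' x \<otimes> f' y \<otimes> r" if x: "x \<in> carrier G" and y: "y \<in> carrier G" for x y
  proof -
    have "f' (x \<otimes> y) = f' x \<otimes> f' y \<otimes> inv (inv (f' (x \<otimes> y)) \<otimes> (f' x \<otimes> f' y))"
      using x y f'c by (simp add: inv_mult_group m_assoc)
    then show ?thesis using Ri[OF hom[OF x y]] by blast
  qed
  \<comment> \<open>The elements of P that agree with some value of f' modulo R.\<close>
  define S where "S = {s \<in> P. \<exists>x\<in>carrier G. inv (f' x) \<otimes> s \<in> R}"
  have SG: "subgroup S G"
  proof (rule finite_submonoid_subgroup)
    show "S \<subseteq> carrier G" using Pc by (auto simp: S_def)
    show "\<one> \<in> S"
      using Ri[OF f'1] subgroup.one_closed[OF PG] Rc[OF f'1] unfolding S_def by (auto intro!: bexI[of _ \<one>])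
    fix s t assume "s \<in> S" "t \<in> S"
    then obtain x y where s: "s \<in> P" "x \<in> carrier G" "inv (f' x) \<otimes> s \<in> R"
      and t: "t \<in> P" "y \<in> carrier G" "inv (f' y) \<otimes> t \<in> R" by (auto simp: S_def)
    have "inv (f' (x \<otimes> y)) \<otimes> (s \<otimes> t) =
        (inv (f' (x \<otimes> y)) \<otimes> (f' x \<otimes> f' y)) \<otimes> (cj (f' y) (inv (f' x) \<otimes> s) \<otimes> (inv (f' y) \<otimes> t))"
      using s t f'c Pc by (simp add: conj_by_def m_assoc)
    also have "\<dots> \<in> R"
      using Rm hom[OF s(2) t(2)] invariantD[OF R(3) f'P[OF t(2)] s(3)] t(3) by blast
    finally show "s \<otimes> t \<in> S" using subgroup.m_closed[OF PG s(1) t(1)] s(2) t(2) unfolding S_def by blast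
  qed
  have SP: "S \<subseteq> P" by (auto simp: S_def)
  \<comment> \<open>Modulo R, f' is a homomorphism into a p-group, so it kills the p'-elements and
    with them K.\<close>
  define U where "U = {x \<in> K. f' x \<in> R}"
  have UK: "U = K"
  proof (rule p'_generatedD[OF K(1)])
    show "subgroup U G"
    proof (rule finite_submonoid_subgroup)
      show "U \<subseteq> carrier G" using Kc by (auto simp: U_def)
      show "\<one> \<in> U" using f'1 subgroup.one_closed[OF KG] by (simp add: U_def)
      fix x y assume xy: "x \<in> U" "y \<in> U"
      then obtain r where "r \<in> R" "f' (x \<otimes> y) = f' x \<otimes> f' y \<otimes> r" using f'mul Kc unfolding U_def by blast
      then have "f' (x \<otimes> y) \<in> R" using xy Rm by (simp add: U_def)
      then show "x \<otimes> y \<in> U" using xy subgroup.m_closed[OF KG] by (auto simp: U_def)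
    qed
    fix x assume x: "x \<in> K" "p'_elt x"
    then obtain l :: nat where l: "coprime l p" "x [^] l = \<one>" by (auto simp: p'_elt_def)
    have xc: "x \<in> carrier G" using Kc x by blast
    have "inv (f' (x [^] (i::nat))) \<otimes> f' x [^] i \<in> R" for i
    proof (induction i)
      case 0 show ?case using Ri[OF f'1] Rc[OF f'1] by simp
    next
      case (Suc i)
      have "inv (f' (x [^] Suc i)) \<otimes> f' x [^] Suc i =
          (inv (f' (x [^] i \<otimes> x)) \<otimes> (f' (x [^] i) \<otimes> f' x)) \<otimes> cj (f' x) (inv (f' (x [^] i)) \<otimes> f' x [^] i)"
        using xc f'c by (simp add: conj_by_def m_assoc)
      also have "\<dots> \<in> R" using Rm hom[OF _ xc] invariantD[OF R(3) f'P[OF xc] Suc] xc by simp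
      finally show ?case .
    qed
    from this[of l] have "inv (f' \<one>) \<otimes> f' x [^] l \<in> R" using l by simp
    then have "f' \<one> \<otimes> (inv (f' \<one>) \<otimes> f' x [^] l) \<in> R" using Rm f'1 by blast
    then have "f' x [^] l \<in> R" using f'c xc by simp
    moreover have "f' x [^] (p ^ n) \<in> R"
      using pow_card_eq_one[OF PG f'P[OF xc]] cP subgroup.one_closed[OF R(1)] by simp
    ultimately have "f' x \<in> R" using pow_mem_coprime[OF R(1) f'c[OF xc]] l(1) by simp
    then show "x \<in> U" using x by (simp add: U_def)
  qed (auto simp: U_def)
  have f'K: "inv x \<otimes> f' x \<in> K" if x: "x \<in> carrier G" for x
    unfolding f'_def f_def
    using x kk[OF x] kkc[OF x] qQ[of x] Qc subgroup.m_closed[OF KG] by (simp add: m_assoc Q_def)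
  \<comment> \<open>If s in K agrees with f' x modulo R, then x lies in K because f' x lies in x K;
    but f' maps K into R.\<close>
  have SK: "S \<inter> K = R"
  proof
    show "S \<inter> K \<subseteq> R"
    proof
      fix s assume s: "s \<in> S \<inter> K"
      then obtain x where x: "x \<in> carrier G" "inv (f' x) \<otimes> s \<in> R" by (auto simp: S_def)
      have sc: "s \<in> carrier G" using s Kc by blast
      have "inv (f' x) \<otimes> s \<in> K" using x R(2) by blast
      then have "(inv x \<otimes> f' x) \<otimes> (inv (f' x) \<otimes> s) \<in> K" using subgroup.m_closed[OF KG f'K[OF x(1)]] by blast
      then have "inv x \<otimes> s \<in> K" using x f'c sc by (simp add: m_assoc)
      then have "s \<otimes> inv (inv x \<otimes> s) \<in> K" using s subgroup.m_closed[OF KG] subgroup.m_inv_closed[OF KG] by blast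
      then have "x \<in> K" using x sc by (simp add: inv_mult_group m_assoc[symmetric])
      then have "f' x \<in> R" using UK by (auto simp: U_def)
      then have "f' x \<otimes> (inv (f' x) \<otimes> s) \<in> R" using Rm x by blast
      then show "s \<in> R" using f'c x sc by simp
    qed
    show "R \<subseteq> S \<inter> K"
    proof
      fix r assume r: "r \<in> R"
      have "inv (f' \<one>) \<otimes> r \<in> R" using Rm Ri f'1 r by blast
      then show "r \<in> S \<inter> K" using r R(2) by (auto simp: S_def)
    qed
  qed
  \<comment> \<open>u and f' u differ by an element of P lying in K; comparing orders then gives the
    index of S.\<close>
  have "Q <#> S = P"
  proof
    show "Q <#> S \<subseteq> P" using SP subgroup.m_closed[OF PG] by (auto simp: set_mult_mem Q_def subset_iff)
    show "P \<subseteq> Q <#> S"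
    proof
      fix u assume u: "u \<in> P"
      have uc: "u \<in> carrier G" using Pc u by blast
      have "f' u \<in> S" using f'P[OF uc] uc f'c[OF uc] subgroup.one_closed[OF R(1)] by (auto simp: S_def intro!: bexI[of _ u])
      moreover have "u \<otimes> inv (f' u) \<in> Q"
      proof -
        have "u \<otimes> inv (f' u) = cj (inv u) (inv (inv u \<otimes> f' u))"
          using uc f'c[OF uc] by (simp add: conj_by_def inv_mult_group m_assoc)
        also have "\<dots> \<in> K" using invariantD[OF K(2)] subgroup.m_inv_closed[OF KG f'K[OF uc]] uc by blast
        finally show ?thesis
          using subgroup.m_closed[OF PG u subgroup.m_inv_closed[OF PG f'P[OF uc]]] by (simp add: Q_def)
      qed
      moreover have "u = (u \<otimes> inv (f' u)) \<otimes> f' u" using uc f'c[OF uc] by (simp add: m_assoc)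
      ultimately show "u \<in> Q <#> S" unfolding set_mult_mem by blast
    qed
  qed
  then have "card P * card (Q \<inter> S) = card Q * card S"
    using card_set_mult[OF QG SG invariant_subset[OF Qinv SP]] by simp
  moreover have "Q \<inter> S = R" using SK SP by (auto simp: Q_def)
  ultimately have "card P * card R = (p * card R) * card S" using cR Q_def by metis
  then have "card P * card R = (p * card S) * card R" by (simp only: ac_simps)
  then have "card P = p * card S" using card_subgroup_pos[OF R(1)] by (metis mult_cancel2 less_irrefl)
  then show ?thesis using SG SP SK by blast
qed

section \<open>Layers of strongly closed subgroups\<close>

text \<open>The character of C with kernel L is invariant under g, so g sends x to d x with d in L.
  Such a d is fixed by g, and \<open>p'_fixed_quotient\<close> applies.\<close>

lemma p'_fixes_via_index_p:
  assumes cop: "coprime (order G) (p - 1)" and C: "subgroup C G" "card C = p ^ Suc n"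
    and L: "subgroup L G" "L \<subseteq> C" "card L = p ^ n"
    and g: "g \<in> carrier G" "p'_elt g" "\<And>x. x \<in> C \<Longrightarrow> cj g x \<in> C"
    and fix_L: "\<And>x. x \<in> L \<Longrightarrow> cj g x = x" and x: "x \<in> C"
  shows "cj g x = x"
proof -
  have inv: "invariant G C L" by (rule index_p_invariant[OF C L])
  have Cc: "y \<in> C \<Longrightarrow> y \<in> carrier G" for y using subgroup_mem[OF C(1)] .
  obtain \<theta> where th: "character_on C \<theta>" and ker: "\<And>x. x \<in> C \<Longrightarrow> [\<theta> x = 0] (mod int p) \<longleftrightarrow> x \<in> L"
    using exists_character[OF C(1) L(1,2) inv] C(2) L(3) by auto
  have eq: "[\<theta> (cj g x) = \<theta> x] (mod int p)"
    by (rule character_conj_invariant[OF C(1) th C(1) subset_refl g(1,3) _ cop x])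
      (use ker fix_L in auto)
  define d where "d = cj g x \<otimes> inv x"
  have ix: "inv x \<in> C" using subgroup.m_inv_closed[OF C(1) x] .
  have dC: "d \<in> C" unfolding d_def using subgroup.m_closed[OF C(1) g(3)[OF x] ix] .
  have "[\<theta> d = \<theta> (cj g x) + \<theta> (inv x)] (mod int p)"
    unfolding d_def by (rule characterD[OF th g(3)[OF x] ix])
  also have "[\<theta> (cj g x) + \<theta> (inv x) = \<theta> x + - \<theta> x] (mod int p)"
    by (rule cong_add[OF eq character_inv[OF C(1) th x]])
  finally have "d \<in> L" using ker[OF dC] by simp
  then have "cj g d = d" by (rule fix_L)
  moreover have "cj g x = d \<otimes> x" unfolding d_def using g(1) Cc[OF x] by (simp add: m_assoc)
  ultimately show ?thesis using p'_fixed_quotient[OF g(1,2) Cc[OF x] dC C] by blast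
qed

text \<open>The elements of <y> whose p^i-th power is 1 are the powers of y^(p^(k-i)), and these
  form a group of order p^i.\<close>

lemma cyclic_subgroup_unique:
  assumes y: "y \<in> carrier G" "card (powers y) = p ^ k"
    and L: "subgroup L G" "L \<subseteq> powers y" "card L = p ^ i" and z: "z \<in> powers y" "z [^] (p ^ i) = \<one>"
  shows "z \<in> L"
proof -
  have oy: "ord y = p ^ k" using card_powers[OF y(1)] y(2) by simp
  have Y: "subgroup (powers y) G" using powers_subgroup[OF y(1)] .
  have "p ^ i \<le> p ^ k" using card_mono[OF finite_subgroup[OF Y] L(2)] L(3) y(2) by simp
  then have ik: "i \<le> k" by (rule power_le_imp_le_exp[OF p_gt_1])
  define w where "w = y [^] (p ^ (k - i))"
  have wc: "w \<in> carrier G" using y by (simp add: w_def)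
  have pk: "p ^ k = p ^ (k - i) * p ^ i" using ik by (metis le_add_diff_inverse2 power_add)
  have "ord w = p ^ k div p ^ (k - i)"
    unfolding w_def using ord_pow[OF y(1), of "p ^ (k - i)"] oy p_gt_1 by (simp add: le_imp_power_dvd)
  then have cw: "card (powers w) = p ^ i" using card_powers[OF wc] pk p_gt_1 by simp
  have sub: "v \<in> powers w" if v: "v \<in> powers y" "v [^] (p ^ i) = \<one>" for v
  proof -
    obtain j where j: "v = y [^] (j::nat)" using v by (auto simp: powers_def)
    then have "y [^] (j * p ^ i) = \<one>" using v y by (simp add: nat_pow_pow)
    then have "p ^ k dvd j * p ^ i" using pow_eq_id[OF y(1)] oy by simp
    then have "p ^ (k - i) dvd j" unfolding pk using p_gt_1 by simp
    then obtain t where "j = p ^ (k - i) * t" by blast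
    then have "v = w [^] t" using j y by (simp add: w_def nat_pow_pow)
    then show ?thesis by (auto simp: powers_def)
  qed
  have "v \<in> powers w" if "v \<in> L" for v
    using sub pow_card_eq_one[OF L(1) that] L that by auto
  then have "L = powers w"
    using card_subset_eq[OF finite_subgroup[OF powers_subgroup[OF wc]], of L] cw L(3) by auto
  then show ?thesis using sub[OF z] by simp
qed

text \<open>If some subgroup \<open>Y\<close> of order \<open>p\<^sup>e\<close> is cyclic, the strongly closed subgroups of
  order \<open>p\<^sup>e\<close> cut any small \<open>C\<close> down, in steps of index \<open>p\<close>, to a subgroup of \<open>Y\<close>.\<close>

lemma p'_fixes_small:
  assumes cop: "coprime (order G) (p - 1)" and Q: "subgroup Q G" "card Q = p ^ q" and K: "subgroup K G" "Q \<subseteq> K"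
    and sc: "\<And>H. subgroup H G \<Longrightarrow> H \<subseteq> Q \<Longrightarrow> card H = p ^ e \<Longrightarrow> strongly_closed Q K H"
    and y: "y \<in> Q" "card (powers y) = p ^ e"
    and C: "subgroup C G" "C \<subseteq> Q" "card C \<le> p ^ e" and g: "g \<in> normalizer_in G K C" "p'_elt g" and x: "x \<in> C"
  shows "cj g x = x"
  using C g x
proof (induction "card C" arbitrary: C x rule: less_induct)
  case less
  note C = less.prems(1-3) and g = less.prems(4,5) and x = less.prems(6)
  have gK: "g \<in> K" and gC: "z \<in> C \<Longrightarrow> cj g z \<in> C" for z using g by (auto simp: normalizer_in_def)
  have gc: "g \<in> carrier G" using subgroup_mem[OF K(1) gK] .
  have yc: "y \<in> carrier G" using subgroup_mem[OF Q(1) y(1)] .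
  have Yg: "subgroup (powers y) G" and YQ: "powers y \<subseteq> Q"
    using powers_subgroup[OF yc] powers_subset[OF Q(1) y(1)] .
  obtain c where c: "card C = p ^ c" using card_p_power_sub[OF C(1) Q(1) C(2) Q(2)] by auto
  have inv: "invariant G Q H" if "subgroup H G" "H \<subseteq> Q" "card H = p ^ e" for H
    using strongly_closed_invariant[OF Q(1) K(2) that(2) sc[OF that]] .
  have step: "cj g x = x"
    if L: "subgroup L G" "L \<subseteq> C" "card C = p * card L" "\<And>z. z \<in> L \<Longrightarrow> cj g z \<in> L" for L
  proof -
    obtain l where l: "card L = p ^ l" using card_p_power_sub[OF L(1) C(1) L(2) c] by auto
    have lt: "card L < card C" using L(3) p_gt_1 card_subgroup_pos[OF L(1)] by simp
    have LQ: "L \<subseteq> Q" and Le: "card L \<le> p ^ e" and gL: "g \<in> normalizer_in G K L"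
      using L(2,4) C lt gK by (auto simp: normalizer_in_def)
    have "cj g z = z" if "z \<in> L" for z
      using less.hyps[OF lt L(1) LQ Le gL g(2) that] .
    then show ?thesis
      using p'_fixes_via_index_p[OF cop C(1) _ L(1,2) l gc g(2) gC _ x] L(3) l by simp
  qed
  show ?case
  proof (cases "C \<subseteq> powers y")
    \<comment> \<open>C is cyclic here, and its subgroup of index p is stable under g as the only
      one of its order.\<close>
    case True
    show ?thesis
    proof (cases c)
      case 0
      then have "C = {\<one>}" using c subgroup.one_closed[OF C(1)] by (auto simp: card_1_singleton_iff)
      then show ?thesis using x gc by simp
    next
      case (Suc i)
      obtain L where L: "subgroup L G" "L \<subseteq> C" "card L = p ^ i"
        using subgroup_intermediate[OF C(1) c triv_subgroup, of 0 i] subgroup.one_closed[OF C(1)] Suc by auto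
      have "cj g z \<in> L" if z: "z \<in> L" for z
      proof (rule cyclic_subgroup_unique[OF yc y(2) L(1) _ L(3)])
        show "L \<subseteq> powers y" "cj g z \<in> powers y" using L(2) True gC z by auto
        have "cj g z [^] (p ^ i) = cj g (z [^] (p ^ i))" using cj_pow gc subgroup_mem[OF L(1) z] by simp
        then show "cj g z [^] (p ^ i) = \<one>" using pow_card_eq_one[OF L(1) z] L(3) gc by simp
      qed
      then show ?thesis using step[OF L(1,2)] L(3) c Suc by simp
    qed
  next
    case False
    \<comment> \<open>Among the subgroups of order p^e of Q that contain C, one with largest
      intersection J with the cyclic group <y> is taken.\<close>
    define \<H> where "\<H> = {H. subgroup H G \<and> C \<subseteq> H \<and> H \<subseteq> Q \<and> card H = p ^ e}"
    have "p ^ e \<le> p ^ q" using card_mono[OF finite_subgroup[OF Q(1)] YQ] y(2) Q(2) by simp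
    then have "e \<le> q" by (rule power_le_imp_le_exp[OF p_gt_1])
    moreover have "c \<le> e" using C(3) unfolding c by (rule power_le_imp_le_exp[OF p_gt_1])
    ultimately obtain H0 where H0: "H0 \<in> \<H>"
      using subgroup_intermediate[OF Q C(1) c C(2)] unfolding \<H>_def by blast
    have "\<H> \<subseteq> Pow Q" by (auto simp: \<H>_def)
    then have "finite \<H>" using finite_subgroup[OF Q(1)] by (meson finite_Pow_iff finite_subset)
    then have "finite ((\<lambda>H. H \<inter> powers y) ` \<H>)" by simp
    from finite_has_maximal_card[OF this imageI[OF H0]]
    obtain H where HH: "H \<in> \<H>" and Hmax: "\<And>H'. H' \<in> \<H> \<Longrightarrow> card (H' \<inter> powers y) \<le> card (H \<inter> powers y)" by blast
    have H: "subgroup H G" "C \<subseteq> H" "H \<subseteq> Q" "card H = p ^ e" using HH by (auto simp: \<H>_def)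
    define J where "J = H \<inter> powers y"
    have J: "subgroup J G" unfolding J_def using H(1) Yg by (rule subgroups_Inter_pair)
    have Jinv: "invariant G Q J"
      using inv[OF H(1,3,4)] inv[OF Yg YQ y(2)] by (auto simp: J_def invariant_def)
    have JH: "J \<subseteq> H" and JY: "J \<subseteq> powers y" by (auto simp: J_def)
    obtain j where j: "j \<le> e" "card J = p ^ j" using card_p_power_sub[OF J H(1) JH H(4)] by auto
    have "J \<noteq> H" using False H(2) JY by blast
    then have "j < e" using j H JH subgroup_psubset_card[OF J H(1)] by (metis le_neq_implies_less order_refl)
    then obtain e' where e': "e = Suc e'" "j \<le> e'" by (cases e) auto
    obtain M where M: "subgroup M G" "invariant G Q M" "J \<subseteq> M" "M \<subseteq> H" "card M = p ^ e'"
      using invariant_intermediate[OF Q J Jinv j(2) H(1) inv[OF H(1,3,4)] H(4) JH H(3) e'(2)] e'(1) by auto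
    obtain Y1 where Y1: "subgroup Y1 G" "J \<subseteq> Y1" "Y1 \<subseteq> powers y" "card Y1 = p ^ Suc j"
      using invariant_intermediate[OF Q J Jinv j(2) Yg inv[OF Yg YQ y(2)] y(2) JY YQ, of "Suc j"] \<open>j < e\<close> by auto
    have Y1Q: "Y1 \<subseteq> Q" using Y1 YQ by blast
    have MY: "M \<inter> Y1 = J" using M Y1 by (auto simp: J_def)
    \<comment> \<open>M has index p in H, and Y1 is larger than J by a factor p, so H2 again has
      order p^e but meets <y> in more than J. By the choice of H, neither H2 nor M contains
      C.\<close>
    define H2 where "H2 = M <#> Y1"
    have H2g: "subgroup H2 G"
      unfolding H2_def by (rule invariant_set_mult_subgroup[OF M(1) Y1(1) invariant_subset[OF M(2) Y1Q]])
    have MH2: "M \<subseteq> H2" and YH2: "Y1 \<subseteq> H2" unfolding H2_def by (rule subset_set_mult[OF M(1) Y1(1)])+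
    have "card H2 * p ^ j = p ^ e' * p ^ Suc j"
      using card_set_mult[OF M(1) Y1(1) invariant_subset[OF M(2) Y1Q]] M(5) Y1(4) MY j(2) by (simp add: H2_def)
    then have cH2: "card H2 = p ^ e" using p_gt_1 e'(1) by simp
    have H2Q: "H2 \<subseteq> Q"
      using M(4) H(3) Y1Q subgroup.m_closed[OF Q(1)] by (auto simp: H2_def set_mult_mem subset_iff)
    have "\<not> C \<subseteq> M"
    proof
      assume "C \<subseteq> M"
      then have "H2 \<in> \<H>" using H2g MH2 H2Q cH2 by (auto simp: \<H>_def)
      then have "card (H2 \<inter> powers y) \<le> p ^ j" using Hmax j(2) by (simp add: J_def)
      moreover have "card Y1 \<le> card (H2 \<inter> powers y)"
        using YH2 Y1(3) finite_subgroup[OF Yg] by (intro card_mono) auto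
      ultimately have "p ^ Suc j \<le> p ^ j" using Y1(4) by linarith
      then have "Suc j \<le> j" by (rule power_le_imp_le_exp[OF p_gt_1])
      then show False by simp
    qed
    have H2H: "H2 \<inter> H \<subseteq> M"
    proof
      fix z assume z: "z \<in> H2 \<inter> H"
      then obtain m v where mv: "m \<in> M" "v \<in> Y1" "z = m \<otimes> v" by (auto simp: H2_def set_mult_mem)
      have mH: "m \<in> H" using mv M by blast
      have "v = inv m \<otimes> z" using mv subgroup_mem M(1) Y1(1) by simp
      then have "v \<in> H" using z mH subgroup.m_closed[OF H(1)] subgroup.m_inv_closed[OF H(1)] by simp
      then have "v \<in> M" using mv Y1 M by (auto simp: J_def)
      then show "z \<in> M" using mv subgroup.m_closed[OF M(1)] by simp
    qed
    \<comment> \<open>As H2 meets H in M, this is also the intersection of H2 with C. Conjugation by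
      g keeps C by assumption and H2 by strong closure, hence L; and L has index p in C because M C
      = H.\<close>
    define L where "L = M \<inter> C"
    have L: "subgroup L G" unfolding L_def using M(1) C(1) by (rule subgroups_Inter_pair)
    have gL: "cj g z \<in> L" if z: "z \<in> L" for z
    proof -
      have zC: "z \<in> C" and zH2: "z \<in> H2" using z MH2 by (auto simp: L_def)
      have "cj g z \<in> Q" using gC[OF zC] C by blast
      then have "cj g z \<in> H2" using sc[OF H2g H2Q cH2] zH2 gK by (simp add: strongly_closed_def)
      then show ?thesis using H2H gC[OF zC] H(2) by (auto simp: L_def)
    qed
    have MC: "subgroup (M <#> C) G"
      by (rule invariant_set_mult_subgroup[OF M(1) C(1) invariant_subset[OF M(2) C(2)]])
    have MCH: "M <#> C \<subseteq> H"
      using M(4) H(2) subgroup.m_closed[OF H(1)] by (auto simp: set_mult_mem subset_iff)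
    have sub: "M \<subseteq> M <#> C" "C \<subseteq> M <#> C" by (rule subset_set_mult[OF M(1) C(1)])+
    have "M <#> C \<noteq> M" using sub \<open>\<not> C \<subseteq> M\<close> by blast
    obtain t where t: "t \<le> e" "card (M <#> C) = p ^ t" using card_p_power_sub[OF MC H(1) MCH H(4)] by auto
    have "card M < card (M <#> C)"
      using sub(1) \<open>M <#> C \<noteq> M\<close> finite_subgroup[OF MC] by (simp add: psubset_card_mono psubset_eq)
    then have "e' < t" using M(5) t p_gt_1 by simp
    then have "t = e" using t e' by linarith
    then have "card (M <#> C) = p ^ e" using t by simp
    then have "p ^ e * card L = p ^ e' * card C"
      using card_set_mult[OF M(1) C(1) invariant_subset[OF M(2) C(2)]] M(5) by (simp add: L_def)
    then have "card C = p * card L" using e' p_gt_1 by simp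
    then show ?thesis using step[OF L] gL by (simp add: L_def)
  qed
qed

lemma strongly_closed_noncyclic:
  assumes Q: "subgroup Q G" "card Q = p ^ q"
    and sc: "\<And>H. subgroup H G \<Longrightarrow> H \<subseteq> Q \<Longrightarrow> card H = p ^ e \<Longrightarrow> strongly_closed Q K H"
    and S: "subgroup S G" "S \<subseteq> Q" "card S = p ^ Suc e" and nc: "\<And>x. x \<in> S \<Longrightarrow> powers x \<noteq> S"
  shows "strongly_closed Q K S"
  unfolding strongly_closed_def
proof (intro ballI impI)
  fix x g assume x: "x \<in> S" and g: "g \<in> K" "cj g x \<in> Q"
  have X: "subgroup (powers x) G" "powers x \<subseteq> S"
    using powers_subgroup powers_subset[OF S(1) x] subgroup_mem[OF S(1) x] by auto
  obtain i where i: "i \<le> Suc e" "card (powers x) = p ^ i" using card_p_power_sub[OF X(1) S(1) X(2) S(3)] by auto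
  have "i \<noteq> Suc e" using i S(3) nc[OF x] subgroup_psubset_card[OF X(1) S(1) X(2)] by auto
  then have "i \<le> e" using i by simp
  then obtain T where T: "subgroup T G" "powers x \<subseteq> T" "T \<subseteq> S" "card T = p ^ e"
    using subgroup_intermediate[OF S(1,3) X(1) i(2) X(2) _ le_SucI[OF order_refl]] by blast
  have "x \<in> T" using T(2) powers_self subgroup_mem[OF S(1) x] by blast
  then have "cj g x \<in> T" using sc[OF T(1) _ T(4)] T(3) S(2) g by (auto simp: strongly_closed_def)
  then show "cj g x \<in> S" using T by blast
qed

theorem no_strongly_closed_layer:
  assumes cop: "coprime (order G) (p - 1)" and K: "p'_generated K" and Q: "sylow_in G p Q K" "card Q = p ^ q"
    and d: "1 \<le> d" "d < q"
    and sc: "\<And>H. subgroup H G \<Longrightarrow> H \<subseteq> Q \<Longrightarrow> card H = p ^ d \<Longrightarrow> strongly_closed Q K H"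
    and cyc: "\<And>y. p = 2 \<Longrightarrow> Suc d < q \<Longrightarrow> y \<in> Q \<Longrightarrow> card (powers y) = p ^ Suc d \<Longrightarrow> strongly_closed Q K (powers y)"
  shows False
proof -
  have QG: "subgroup Q G" and KG: "subgroup K G" and QK: "Q \<subseteq> K" using Q(1) by (auto simp: sylow_in_def)
  obtain q' where q': "q = Suc q'" using d by (cases q) auto
  have triv: "{\<one>} \<subseteq> Q" using subgroup.one_closed[OF QG] by simp
  obtain R where R: "subgroup R G" "R \<subseteq> Q" "card R = p ^ q'"
    using subgroup_intermediate[OF QG Q(2) triv_subgroup _ triv, of 0 q'] q' by auto
  define good where "good e \<longleftrightarrow> (\<forall>H. subgroup H G \<and> H \<subseteq> Q \<and> card H = p ^ e \<longrightarrow> strongly_closed Q K H)" for e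
  have "\<not> good q'"
  proof
    assume "good q'"
    then have "strongly_closed Q K R" using R by (auto simp: good_def)
    then show False using no_strongly_closed_index_p[OF K Q(1) cop R(1,2)] R(3) Q(2) q' by simp
  qed
  moreover have "good d" using sc by (simp add: good_def)
  ultimately have "\<exists>e. d \<le> e \<and> e < q' \<and> good e \<and> \<not> good (Suc e)"
  proof -
    have "d \<le> q'" using d q' by simp
    then have "good q'" if "\<And>e. d \<le> e \<Longrightarrow> e < q' \<Longrightarrow> good e \<Longrightarrow> good (Suc e)"
      using \<open>good d\<close> that by (induction rule: dec_induct) auto
    then show ?thesis using \<open>\<not> good q'\<close> by blast
  qed
  then obtain e where e: "d \<le> e" "e < q'" "good e" "\<not> good (Suc e)" by blast
  have sce: "strongly_closed Q K H" if "subgroup H G" "H \<subseteq> Q" "card H = p ^ e" for H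
    using e(3) that by (auto simp: good_def)
  obtain S where S: "subgroup S G" "S \<subseteq> Q" "card S = p ^ Suc e" "\<not> strongly_closed Q K S"
    using e(4) by (auto simp: good_def)
  obtain y0 where y0: "y0 \<in> S" "powers y0 = S"
    using strongly_closed_noncyclic[OF QG Q(2) sce S(1-3)] S(4) by blast
  have y0Q: "y0 \<in> Q" and y0c: "y0 \<in> carrier G" using y0 S subgroup_mem by auto
  \<comment> \<open>Otherwise e = d = 1, and the cyclic group S of order 4 would be strongly closed
    by \<open>cyc\<close>.\<close>
  have e2: "2 \<le> e" if "p = 2"
  proof (rule ccontr)
    assume "\<not> 2 \<le> e"
    then have "e = d" using e d by linarith
    then show False using cyc[OF that _ y0Q] y0 S(3,4) e(2) q' by simp
  qed
  \<comment> \<open>The p-th power of the generator of S generates the cyclic subgroup of order p^e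
    that \<open>p'_fixes_small\<close> requires.\<close>
  define y where "y = y0 [^] p"
  have yQ: "y \<in> Q" unfolding y_def using subgroup_pow[OF QG y0Q] .
  have yc: "y \<in> carrier G" using subgroup_mem[OF QG yQ] .
  have "ord y0 = p * p ^ e" using card_powers[OF y0c] y0 S(3) by simp
  then have "ord y = p ^ e" unfolding y_def using ord_pow[OF y0c, of p] p_gt_1 by simp
  then have cy: "card (powers y) = p ^ e" using card_powers[OF yc] by simp
  have fixC: "cj g x = x"
    if C: "subgroup C G" "C \<subseteq> Q" and g: "g \<in> normalizer_in G K C" "p'_elt g" and x: "x \<in> C" for C g x
  proof -
    have gK: "g \<in> K" and gC: "\<And>z. z \<in> C \<Longrightarrow> cj g z \<in> C" using g by (auto simp: normalizer_in_def)
    have gc: "g \<in> carrier G" using subgroup_mem[OF KG gK] .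
    obtain c where c: "card C = p ^ c" using card_p_power_sub[OF C(1) QG C(2) Q(2)] by auto
    have small: "cj g z = z"
      if "subgroup D G" "D \<subseteq> Q" "card D \<le> p ^ e" "g \<in> normalizer_in G K D" "p'_elt g" "z \<in> D" for D z
      by (rule p'_fixes_small[OF cop QG Q(2) KG QK _ yQ cy that]) (rule sce)
    \<comment> \<open>\<open>p'_automorphism_trivial\<close> leaves only elements of order dividing
      p, or 4. The groups they generate have order at most p^e, for p = 2 because of 2 \<le>
      e.\<close>
    have "cj g z = z" if z: "z \<in> C" "z [^] (if p = 2 then 4 else p) = \<one>" for z
    proof (cases "c \<le> e")
      case True
      then show ?thesis using small[OF C _ g z(1)] c p_gt_1 by (simp add: power_increasing)
    next
      case False
      have zc: "z \<in> carrier G" using subgroup_mem[OF C(1) z(1)] .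
      have Z: "subgroup (powers z) G" "powers z \<subseteq> C"
        using powers_subgroup[OF zc] powers_subset[OF C(1) z(1)] .
      obtain i where i: "card (powers z) = p ^ i" using card_p_power_sub[OF Z(1) C(1) Z(2) c] by auto
      have "p ^ i dvd p ^ e"
      proof (cases "p = 2")
        case True
        have "ord z dvd p ^ 2" using z(2) pow_eq_id[OF zc] True by simp
        also have "p ^ 2 dvd p ^ e" using e2[OF True] by (rule le_imp_power_dvd)
        finally show ?thesis using card_powers[OF zc] i by simp
      next
        case False
        have "ord z dvd p ^ 1" using z(2) pow_eq_id[OF zc] False by simp
        also have "p ^ 1 dvd p ^ e" using d e by (intro le_imp_power_dvd) simp
        finally show ?thesis using card_powers[OF zc] i by simp
      qed
      then have "i \<le> e" using p_gt_1 power_dvd_imp_le by blast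
      \<comment> \<open>C is too large for \<open>small\<close>, but some T of order p^e lies
        between <z> and C. It is strongly closed, and g keeps C inside Q, so g normalizes T.\<close>
      then obtain T where T: "subgroup T G" "powers z \<subseteq> T" "T \<subseteq> C" "card T = p ^ e"
        using subgroup_intermediate[OF C(1) c Z(1) i Z(2) _ less_imp_le[OF not_le_imp_less[OF False]]] by blast
      have TQ: "T \<subseteq> Q" using T C by blast
      have "cj g v \<in> T" if "v \<in> T" for v
        using sce[OF T(1) TQ T(4)] that gK gC T(3) C(2) by (auto simp: strongly_closed_def subset_iff)
      then have "g \<in> normalizer_in G K T" using gK by (simp add: normalizer_in_def)
      moreover have "z \<in> T" using T(2) powers_self[OF zc] by blast
      ultimately show ?thesis using small[OF T(1) TQ _ _ g(2)] T(4) by simp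
    qed
    then show ?thesis using p'_automorphism_trivial[OF C(1) c gc g(2) gC _ x] by blast
  qed
  \<comment> \<open>Any subgroup R of index p in Q now gives a nonzero stable character, because
    each p'-element g acts trivially on the C that it normalizes.\<close>
  have Rinv: "invariant G Q R" using index_p_invariant[OF QG _ R] Q(2) q' by simp
  obtain \<theta> where th: "character_on Q \<theta>" and ker: "\<And>x. x \<in> Q \<Longrightarrow> [\<theta> x = 0] (mod int p) \<longleftrightarrow> x \<in> R"
    using exists_character[OF QG R(1,2) Rinv] Q(2) R(3) q' by auto
  have "[\<theta> u = 0] (mod int p)" if "u \<in> Q" for u
    by (rule no_p'_stable_character[OF K Q(1) th _ that]) (use fixC in simp)
  then have "Q = R" using ker R(2) by blast
  then show False using Q(2) R(3) q' p_gt_1 by simp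
qed

theorem no_complemented_layer:
  assumes cop: "coprime (order G) (p - 1)" and K: "p'_generated K" "invariant G (carrier G) K"
    and P: "sylow_in G p P (carrier G)" "card P = p ^ n" and PK: "\<And>x. x \<in> carrier G \<Longrightarrow> \<exists>k\<in>K. x \<otimes> k \<in> P"
    and Q: "sylow_in G p (P \<inter> K) K" "card (P \<inter> K) = p ^ Suc r" and d: "r \<le> d" "d < n"
    and sc: "\<And>H. subgroup H G \<Longrightarrow> H \<subseteq> P \<Longrightarrow> invariant G P H \<Longrightarrow> card H = p ^ d \<Longrightarrow>
      strongly_closed (P \<inter> K) K (H \<inter> K)"
  shows False
proof -
  have PG: "subgroup P G" and QG: "subgroup (P \<inter> K) G" using P(1) Q(1) by (auto simp: sylow_in_def)
  obtain n' where n': "n = Suc n'" "d \<le> n'" using d by (cases n) auto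
  have Qinv: "invariant G P (P \<inter> K)"
    using invariantD[OF K(2)] subgroup_cj[OF PG] subgroup_mem[OF PG] unfolding invariant_def by blast
  have "{\<one>} \<subseteq> P \<inter> K" using subgroup.one_closed[OF QG] by simp
  moreover have "invariant G P {\<one>}" using subgroup_mem[OF PG] by (simp add: invariant_def)
  ultimately obtain R where R: "subgroup R G" "invariant G P R" "R \<subseteq> P \<inter> K" "card R = p ^ r"
    using invariant_intermediate[OF PG P(2) triv_subgroup _ _ QG Qinv Q(2), of 0 r] by auto
  obtain S where S: "subgroup S G" "S \<subseteq> P" "S \<inter> K = R" "card P = p * card S"
    using complement_modulo[OF K P(1) PK cop R(1,3,2)] Q(2) R(4) by auto
  have cS: "card S = p ^ n'" using S(4) P(2) n' p_gt_1 by simp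
  have Sinv: "invariant G P S" using index_p_invariant[OF PG _ S(1,2) cS] P(2) n' by simp
  have "R \<subseteq> S" using S(3) by blast
  \<comment> \<open>H fits in because r \<le> d \<le> n'; since S meets K in R only, so does
    H.\<close>
  then obtain H where H: "subgroup H G" "invariant G P H" "R \<subseteq> H" "H \<subseteq> S" "card H = p ^ d"
    using invariant_intermediate[OF PG P(2) R(1,2,4) S(1) Sinv cS _ S(2) d(1) n'(2)] by blast
  have "H \<inter> K = R" using H(3,4) S(3) by blast
  moreover have "H \<subseteq> P" using H(4) S(2) by blast
  ultimately have "strongly_closed (P \<inter> K) K R" using sc[OF H(1) _ H(2,5)] by simp
  then show False using no_strongly_closed_index_p[OF K(1) Q(1) cop R(1,3)] Q(2) R(4) by simp
qed

section \<open>Supplements and the main theorem\<close>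

lemma conj_subgroup_eq:
  assumes "g \<in> carrier G" "H \<subseteq> carrier G"
  shows "conj_subgroup G H g = cj g ` H"
  by (auto simp: conj_subgroup_def conj_by_def l_coset_def r_coset_def)

text \<open>The library normalizer uses v H v^-1, whereas \<open>cj\<close> conjugates in the other
  direction; by finiteness the inclusion is an equality, so the direction does not matter.\<close>

lemma normalizer_in_normalizer:
  assumes H: "H \<subseteq> carrier G" and K: "K \<subseteq> carrier G" and v: "v \<in> normalizer_in G K H"
  shows "v \<in> normalizer G H"
proof -
  have vc: "v \<in> carrier G" using v K by (auto simp: normalizer_in_def)
  have "v <# H #> inv v = cj (inv v) ` H"
    using vc by (auto simp: conj_by_def l_coset_def r_coset_def)
  also have "\<dots> = cj (inv v) ` cj v ` H" using normalizer_in_image[OF v K H] by simp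
  also have "\<dots> = H" using vc H by (force simp: image_iff subset_iff)
  finally show ?thesis using vc H by (simp add: normalizer_def stabilizer_def)
qed

lemma invariant_carrier_normal:
  assumes "subgroup N G"
  shows "invariant G (carrier G) N \<longleftrightarrow> N \<lhd> G"
proof
  assume inv: "invariant G (carrier G) N"
  have "x \<otimes> h \<otimes> inv x \<in> N" if "x \<in> carrier G" "h \<in> N" for x h
    using invariantD[OF inv inv_closed[OF that(1)] that(2)] that by (simp add: conj_by_def)
  then show "N \<lhd> G" using assms normal_inv_iff by blast
next
  assume "N \<lhd> G"
  then show "invariant G (carrier G) N"
    using normal.inv_op_closed1 by (fastforce simp: invariant_def conj_by_def)
qed

text \<open>G/T is an image of H, hence a p-group. Concretely, x = y t gives x^i in y^i T, so
  x^(p^h) lies in T, and so does a power of x prime to p.\<close>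

lemma supplement_contains_p'_elts:
  assumes H: "subgroup H G" "card H = p ^ h" and T: "T \<lhd> G" "carrier G = H <#> T"
    and x: "x \<in> carrier G" "p'_elt x"
  shows "x \<in> T"
proof -
  have TG: "subgroup T G" using T(1) normal_imp_subgroup by blast
  have Tinv: "invariant G (carrier G) T" using invariant_carrier_normal[OF TG] T(1) by simp
  obtain y t where yt: "y \<in> H" "t \<in> T" "x = y \<otimes> t" using x(1) T(2) by (auto simp: set_mult_def)
  have yc: "y \<in> carrier G" and tc: "t \<in> carrier G" using yt subgroup_mem H(1) TG by auto
  have "inv (y [^] i) \<otimes> x [^] (i::nat) \<in> T" for i
  proof (induction i)
    case 0 show ?case using subgroup.one_closed[OF TG] by simp
  next
    case (Suc i)
    have "inv (y [^] Suc i) \<otimes> x [^] Suc i = cj y (inv (y [^] i) \<otimes> x [^] i) \<otimes> t"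
      using yt(3) yc tc x(1) by (simp add: conj_by_def inv_mult_group m_assoc)
    also have "\<dots> \<in> T" using subgroup.m_closed[OF TG invariantD[OF Tinv yc Suc] yt(2)] .
    finally show ?case .
  qed
  from this[of "p ^ h"] have "x [^] (p ^ h) \<in> T" using pow_card_eq_one[OF H(1) yt(1)] H(2) x(1) by simp
  moreover obtain m :: nat where m: "coprime m p" "x [^] m = \<one>" using x(2) by (auto simp: p'_elt_def)
  moreover have "x [^] m \<in> T" using m subgroup.one_closed[OF TG] by simp
  ultimately show ?thesis using pow_mem_coprime[OF TG x(1), of m "p ^ h"] by simp
qed

text \<open>This is O^p(G), the smallest normal subgroup whose quotient is a p-group.\<close>

definition p'_core where "p'_core = generate G {x \<in> carrier G. p'_elt x}"

lemma p'_core_subgroup: "subgroup p'_core G"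
  unfolding p'_core_def by (rule generate_is_subgroup) auto

lemma p'_elt_in_core: "x \<in> carrier G \<Longrightarrow> p'_elt x \<Longrightarrow> x \<in> p'_core"
  unfolding p'_core_def by (rule generate.incl) simp

lemma p'_core_least: "subgroup U G \<Longrightarrow> (\<And>x. x \<in> carrier G \<Longrightarrow> p'_elt x \<Longrightarrow> x \<in> U) \<Longrightarrow> p'_core \<subseteq> U"
  unfolding p'_core_def by (rule generate_subgroup_incl) auto

lemma p'_core_generated: "p'_generated p'_core"
  unfolding p'_generated_def
  using p'_core_subgroup p'_core_least p'_elt_in_core by (meson subset_antisym)

lemma p'_core_invariant: "invariant G (carrier G) p'_core"
  unfolding invariant_def
proof (intro ballI)
  fix g x assume g: "g \<in> carrier G" and x: "x \<in> p'_core"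
  have Kc: "y \<in> p'_core \<Longrightarrow> y \<in> carrier G" for y using subgroup_mem[OF p'_core_subgroup] .
  define U where "U = {y \<in> p'_core. cj g y \<in> p'_core}"
  have "subgroup U G"
    by (rule finite_submonoid_subgroup)
      (use Kc g subgroup.one_closed[OF p'_core_subgroup] subgroup.m_closed[OF p'_core_subgroup]
        in \<open>auto simp: U_def cj_mult\<close>)
  moreover have "y \<in> U" if y: "y \<in> carrier G" "p'_elt y" for y
  proof -
    obtain m :: nat where m: "coprime m p" "y [^] m = \<one>" using y(2) by (auto simp: p'_elt_def)
    have "cj g y [^] m = \<one>" using cj_pow[OF g y(1), of m] m(2) g by simp
    then have "p'_elt (cj g y)" using m(1) unfolding p'_elt_def by blast
    then show ?thesis using p'_elt_in_core y g by (simp add: U_def)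
  qed
  ultimately have "p'_core \<subseteq> U" by (rule p'_core_least)
  then show "cj g x \<in> p'_core" using x by (auto simp: U_def)
qed

text \<open>The product of \<open>p'_core\<close> and P contains all p'-elements and a Sylow
  p-subgroup, so it is G. Comparing orders gives the p-part of |\<open>p'_core\<close>|; if that is
  1, \<open>p'_core\<close> is the normal p-complement.\<close>

lemma sylow_core:
  assumes P: "sylow_in G p P (carrier G)"
  shows "sylow_in G p (P \<inter> p'_core) p'_core"
    and "x \<in> carrier G \<Longrightarrow> \<exists>k\<in>p'_core. x \<otimes> k \<in> P"
    and "card (P \<inter> p'_core) = 1 \<Longrightarrow> p_nilpotent p G"
proof -
  let ?K = "p'_core"
  obtain n m where PG: "subgroup P G" and cP: "card P = p ^ n" and cG: "card (carrier G) = m * p ^ n" "\<not> p dvd m"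
    using P by (auto simp: sylow_in_def)
  note KG = p'_core_subgroup
  have QG: "subgroup (P \<inter> ?K) G" using PG KG by (rule subgroups_Inter_pair)
  have Kinv: "invariant G P ?K" using invariant_subset[OF p'_core_invariant subgroup_sub[OF PG]] .
  have U: "subgroup (?K <#> P) G" by (rule invariant_set_mult_subgroup[OF KG PG Kinv])
  have sub: "?K \<subseteq> ?K <#> P" "P \<subseteq> ?K <#> P" by (rule subset_set_mult[OF KG PG])+
  have "p ^ n dvd card (?K <#> P)" using card_dvd[OF PG U sub(2)] cP by simp
  then have KP: "?K <#> P = carrier G"
    using subgroup_eq_by_elts[OF U subgroup_self subgroup_sub[OF U] _ cG] p'_elt_in_core sub(1) by blast
  obtain q where q: "q \<le> n" "card (P \<inter> ?K) = p ^ q" using card_p_power_sub[OF QG PG _ cP] by auto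
  have "m * p ^ n * p ^ q = card ?K * p ^ n"
    using card_set_mult[OF KG PG Kinv] KP cG(1) cP q(2) by (simp add: Int_commute)
  then have "(m * p ^ q) * p ^ n = card ?K * p ^ n" by (simp only: ac_simps)
  then have cK: "card ?K = m * p ^ q" using p_gt_1 by simp
  then show "sylow_in G p (P \<inter> ?K) ?K" using QG KG q(2) cG(2) by (auto simp: sylow_in_def)
  show "\<exists>k\<in>?K. x \<otimes> k \<in> P" if x: "x \<in> carrier G" for x
  proof -
    have "x \<in> ?K <#> P" using x KP by simp
    then obtain k u where ku: "k \<in> ?K" "u \<in> P" "x = k \<otimes> u" unfolding set_mult_mem by blast
    have c: "k \<in> carrier G" "u \<in> carrier G" using ku subgroup_mem KG PG by auto
    have "inv (cj u k) \<in> ?K" using subgroup.m_inv_closed[OF KG invariantD[OF Kinv ku(2,1)]] .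
    moreover have "x \<otimes> inv (cj u k) = u" using ku c by (simp add: conj_by_def inv_mult_group m_assoc)
    ultimately show ?thesis using ku(2) by metis
  qed
  show "p_nilpotent p G" if "card (P \<inter> ?K) = 1"
  proof -
    have "card ?K = m" using cK q(2) that by simp
    then have "coprime (card ?K) p"
      using cG(2) prime_p by (metis coprime_commute prime_imp_coprime)
    moreover have "card (rcosets ?K) * card ?K = m * p ^ n"
      using lagrange[OF KG] cG(1) by (simp add: order_def)
    then have "subgroup_index G ?K = p ^ n"
      using \<open>card ?K = m\<close> card_subgroup_pos[OF KG] by (simp add: subgroup_index_def mult.commute)
    moreover have "?K \<lhd> G" using invariant_carrier_normal[OF KG] p'_core_invariant by simp
    ultimately show ?thesis unfolding p_nilpotent_def by blast
  qed
qed

text \<open>The supplement T contains \<open>p'_core\<close>, so an element of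
  \<open>p'_core\<close> normalizing H lies in N_T(H).\<close>

lemma HC_core:
  assumes HC: "HC_subgroup H G" and H: "card H = p ^ h"
    and g: "g \<in> p'_core" and x: "x \<in> H" "x \<in> p'_core" and n: "cj g x \<in> normalizer_in G p'_core H"
  shows "cj g x \<in> H"
proof -
  note KG = p'_core_subgroup
  have HG: "subgroup H G" using HC by (simp add: HC_subgroup_def)
  obtain T where T: "T \<lhd> G" "carrier G = H <#> T"
    and TH: "\<And>g. g \<in> carrier G \<Longrightarrow> conj_subgroup G H g \<inter> (T \<inter> normalizer G H) \<subseteq> H"
    using HC by (auto simp: HC_subgroup_def)
  have gc: "g \<in> carrier G" using subgroup_mem[OF KG g] .
  have "p'_core \<subseteq> T"
    using p'_core_least[OF normal_imp_subgroup[OF T(1)]] supplement_contains_p'_elts[OF HG H T] by blast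
  moreover have "cj g x \<in> p'_core" using n by (simp add: normalizer_in_def)
  moreover have "cj g x \<in> normalizer G H"
    using normalizer_in_normalizer[OF subgroup_sub[OF HG] subgroup_sub[OF KG] n] .
  moreover have "cj g x \<in> conj_subgroup G H g" using conj_subgroup_eq[OF gc subgroup_sub[OF HG]] x(1) by simp
  ultimately show ?thesis using TH[OF gc] by blast
qed

text \<open>Every element of P normalizes H, so the condition reaches all conjugates that lie in
  P.\<close>

lemma HC_strongly_closed_inter:
  assumes P: "subgroup P G" and H: "HC_subgroup H G" "card H = p ^ h" "invariant G P H"
  shows "strongly_closed (P \<inter> p'_core) p'_core (H \<inter> p'_core)"
  unfolding strongly_closed_def
proof (intro ballI impI)
  fix x g assume x: "x \<in> H \<inter> p'_core" and g: "g \<in> p'_core" and Q: "cj g x \<in> P \<inter> p'_core"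
  then have "cj g x \<in> normalizer_in G p'_core H" using H(3) by (auto simp: normalizer_in_def invariant_def)
  then show "cj g x \<in> H \<inter> p'_core" using HC_core[OF H(1,2) g] x Q by blast
qed

text \<open>H is not assumed normal in P. If N = N_Q(H) were smaller than Q, some u in Q outside N
  would normalize N. Then H^u lies in N, so it normalizes H and lies in H by \<open>HC_core\<close>,
  which puts u into N after all.\<close>

lemma HC_strongly_closed:
  assumes P: "subgroup P G" "card P = p ^ n" and H: "HC_subgroup H G" "card H = p ^ h" "H \<subseteq> P \<inter> p'_core"
  shows "strongly_closed (P \<inter> p'_core) p'_core H"
proof -
  define Q where "Q = P \<inter> p'_core"
  note KG = p'_core_subgroup
  have HG: "subgroup H G" using H by (simp add: HC_subgroup_def)
  have QG: "subgroup Q G" unfolding Q_def using P(1) KG by (rule subgroups_Inter_pair)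
  have QP: "Q \<subseteq> P" and QK: "Q \<subseteq> p'_core" and HQ: "H \<subseteq> Q" using H(3) by (auto simp: Q_def)
  obtain q where q: "card Q = p ^ q" using card_p_power_sub[OF QG P(1) QP P(2)] by auto
  define N where "N = normalizer_in G Q H"
  have NG: "subgroup N G" unfolding N_def using normalizer_in_subgroup[OF QG subgroup_sub[OF HG]] .
  have NQ: "N \<subseteq> Q" and HN: "H \<subseteq> N" using HQ subgroup_cj[OF HG] by (auto simp: N_def normalizer_in_def)
  have "N = Q"
  proof (rule ccontr)
    assume "N \<noteq> Q"
    then have "N \<subset> normalizer_in G Q N" using normalizer_grows[OF NG QG _ q] NQ by blast
    then obtain u where u: "u \<in> Q" "\<And>y. y \<in> N \<Longrightarrow> cj u y \<in> N" "u \<notin> N" by (auto simp: normalizer_in_def)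
    have "cj u y \<in> H" if y: "y \<in> H" for y
    proof (rule HC_core[OF H(1,2)])
      show "u \<in> p'_core" "y \<in> p'_core" using u(1) y HQ QK by auto
      have "cj u y \<in> N" using u(2) HN y by blast
      then show "cj u y \<in> normalizer_in G p'_core H" using QK by (auto simp: N_def normalizer_in_def)
    qed (rule y)
    then show False using u by (auto simp: N_def normalizer_in_def)
  qed
  show ?thesis
    unfolding strongly_closed_def
  proof (intro ballI impI)
    fix x g assume x: "x \<in> H" and g: "g \<in> p'_core" and "cj g x \<in> P \<inter> p'_core"
    then have "cj g x \<in> N" using \<open>N = Q\<close> by (simp add: Q_def)
    then have "cj g x \<in> normalizer_in G p'_core H" using QK by (auto simp: N_def normalizer_in_def)
    then show "cj g x \<in> H" using HC_core[OF H(1,2) g x] x HQ QK by blast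
  qed
qed

section \<open>Cyclic subgroups and their quotients\<close>

lemma cyclic_group_powers:
  assumes "subgroup P G"
  shows "cyclic_group (G\<lparr>carrier := P\<rparr>) \<longleftrightarrow> (\<exists>a\<in>P. P = powers a)"
proof -
  interpret S: group "G\<lparr>carrier := P\<rparr>" using assms by (rule subgroup_imp_group)
  have rng: "range (\<lambda>n::int. a [^]\<^bsub>G\<lparr>carrier := P\<rparr>\<^esub> n) = powers a" if a: "a \<in> P" for a
  proof -
    have ac: "a \<in> carrier G" using subgroup_mem[OF assms a] .
    have ip: "a [^]\<^bsub>G\<lparr>carrier := P\<rparr>\<^esub> (n::int) = a [^] n" for n
      using int_pow_consistent[OF assms a] by simp
    have "a [^] (n::int) \<in> powers a" for n
      using subgroup_int_pow_closed[OF powers_subgroup[OF ac] powers_self[OF ac]] .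
    moreover have "a [^] (n::nat) = a [^] (int n)" for n by (simp add: int_pow_int)
    ultimately show ?thesis unfolding ip by (auto simp: powers_def image_iff)
  qed
  show ?thesis unfolding S.cyclic_group using rng by auto
qed

text \<open>The subgroup generated by h^s serves. With s = 4 this brings cyclic subgroups under
  hypothesis (ii).\<close>

lemma cyclic_quotient_of_powers:
  assumes h: "h \<in> carrier G" "card (powers h) = r * s" and s: "s > 0" "r > 0"
  shows "\<exists>D. D \<lhd> G\<lparr>carrier := powers h\<rparr> \<and> card D = r \<and>
    cyclic_group (G\<lparr>carrier := powers h\<rparr> Mod D) \<and> order (G\<lparr>carrier := powers h\<rparr> Mod D) = s"
proof -
  let ?H = "G\<lparr>carrier := powers h\<rparr>"
  have HG: "subgroup (powers h) G" using powers_subgroup[OF h(1)] .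
  interpret H: group ?H using HG by (rule subgroup_imp_group)
  have cyc: "cyclic_group ?H" using cyclic_group_powers[OF HG] powers_self[OF h(1)] by blast
  define D where "D = powers (h [^] s)"
  have DG: "subgroup D G" unfolding D_def using h(1) by (intro powers_subgroup) simp
  have Dh: "D \<subseteq> powers h" unfolding D_def using powers_subset[OF HG] subgroup_pow[OF HG powers_self[OF h(1)]] by simp
  have "ord h = r * s" using card_powers[OF h(1)] h(2) by simp
  then have cD: "card D = r" unfolding D_def using card_powers[of "h [^] s"] ord_pow[OF h(1), of s] h(1) s by simp
  have DH: "subgroup D ?H" using subgroup_incl[OF DG HG Dh] .
  have DN: "D \<lhd> ?H" using comm_group.subgroup_imp_normal[OF H.cyclic_imp_abelian_group[OF cyc] DH] .
  interpret D: normal D ?H by (rule DN)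
  have "(\<lambda>x. D #>\<^bsub>?H\<^esub> x) \<in> epi ?H (?H Mod D)"
    using D.r_coset_hom_Mod by (auto simp: epi_def carrier_FactGroup)
  then have "cyclic_group (?H Mod D)"
    using H.cyclic_group_epimorphic_image[OF _ cyc D.factorgroup_is_group] by blast
  moreover have "order (?H Mod D) = s"
  proof -
    have "card (rcosets\<^bsub>?H\<^esub> D) * r = r * s" using H.lagrange[OF DH] cD h(2) by (simp add: order_def)
    then show ?thesis using s by (simp add: order_def FactGroup_def)
  qed
  ultimately show ?thesis using DN cD by blast
qed

text \<open>Subgroups of a cyclic p-group are given by the orders of their elements, which
  conjugation preserves, so they are all strongly closed.\<close>

lemma cyclic_sylow_p_nilpotent:
  assumes cop: "coprime (order G) (p - 1)" and P: "sylow_in G p P (carrier G)" and a: "a \<in> P" "P = powers a"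
  shows "p_nilpotent p G"
proof (rule sylow_core(3)[OF P])
  let ?K = "p'_core" and ?Q = "P \<inter> p'_core"
  have PG: "subgroup P G" using P by (simp add: sylow_in_def)
  obtain n where n: "card P = p ^ n" using P by (auto simp: sylow_in_def)
  have QG: "subgroup ?Q G" using PG p'_core_subgroup by (rule subgroups_Inter_pair)
  have ac: "a \<in> carrier G" using subgroup_mem[OF PG a(1)] .
  obtain q where q: "card ?Q = p ^ q" using card_p_power_sub[OF QG PG _ n] by auto
  show "card ?Q = 1"
  proof (cases q)
    case (Suc i)
    obtain L where L: "subgroup L G" "L \<subseteq> ?Q" "card L = p ^ i"
      using subgroup_intermediate[OF QG q triv_subgroup, of 0 i] subgroup.one_closed[OF QG] Suc by auto
    have "strongly_closed ?Q ?K L"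
      unfolding strongly_closed_def
    proof (intro ballI impI)
      fix x g assume x: "x \<in> L" and g: "g \<in> ?K" and Q: "cj g x \<in> ?Q"
      have c: "x \<in> carrier G" "g \<in> carrier G" using subgroup_mem L(1) p'_core_subgroup x g by auto
      show "cj g x \<in> L"
      proof (rule cyclic_subgroup_unique[OF ac _ L(1) _ L(3)])
        show "cj g x [^] (p ^ i) = \<one>"
          using cj_pow[OF c(2,1), of "p ^ i"] pow_card_eq_one[OF L(1) x] L(3) c by simp
      qed (use n a(2) L(2) Q in auto)
    qed
    then show ?thesis
      using no_strongly_closed_index_p[OF p'_core_generated sylow_core(1)[OF P] cop L(1,2)] q L(3) Suc by simp
  qed (use q in simp)
qed

theorem HC_sylow_p_nilpotent:
  assumes cop: "coprime (order G) (p - 1)" and P: "sylow_in G p P (carrier G)"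
    and D: "1 < card D" "card D < card P" "subgroup D G" "D \<subseteq> P"
    and HC: "\<And>H. subgroup H G \<Longrightarrow> H \<subseteq> P \<Longrightarrow> card H = card D \<Longrightarrow> HC_subgroup H G"
    and HC4: "\<And>H. p = 2 \<Longrightarrow> 2 * card D < card P \<Longrightarrow> subgroup H G \<Longrightarrow> H \<subseteq> P \<Longrightarrow>
      (\<exists>D1. D1 \<lhd> G\<lparr>carrier := H\<rparr> \<and> 2 * card D1 = card D \<and> cyclic_group (G\<lparr>carrier := H\<rparr> Mod D1) \<and>
        order (G\<lparr>carrier := H\<rparr> Mod D1) = 4) \<Longrightarrow> HC_subgroup H G"
  shows "p_nilpotent p G"
proof (rule sylow_core(3)[OF P], rule ccontr)
  let ?K = "p'_core" and ?Q = "P \<inter> p'_core"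
  assume ne: "card ?Q \<noteq> 1"
  have PG: "subgroup P G" using P by (simp add: sylow_in_def)
  obtain n where n: "card P = p ^ n" using P by (auto simp: sylow_in_def)
  have QG: "subgroup ?Q G" using PG p'_core_subgroup by (rule subgroups_Inter_pair)
  obtain q where q: "q \<le> n" "card ?Q = p ^ q" using card_p_power_sub[OF QG PG _ n] by auto
  obtain d where d: "card D = p ^ d" using card_p_power_sub[OF D(3) PG D(4) n] by auto
  have d1: "1 \<le> d" using D(1) d by (cases d) auto
  have dn: "d < n" using D(2) d n p_gt_1 by simp
  obtain r where r: "q = Suc r" using ne q by (cases q) auto
  show False
  proof (cases "r \<le> d")
    case True
    have "strongly_closed ?Q ?K (H \<inter> ?K)"
      if "subgroup H G" "H \<subseteq> P" "invariant G P H" "card H = p ^ d" for H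
      using HC_strongly_closed_inter[OF PG HC[OF that(1,2)] that(4,3)] that(4) d by simp
    then show False
      using no_complemented_layer[OF cop p'_core_generated p'_core_invariant P n sylow_core(2)[OF P]
          sylow_core(1)[OF P] _ True dn] q(2) r by blast
  next
    case False
    have dq: "Suc d < q" using False r by simp
    have QP: "?Q \<subseteq> P" by blast
    show False
    proof (rule no_strongly_closed_layer[OF cop p'_core_generated sylow_core(1)[OF P] q(2) d1])
      show "d < q" using dq by simp
      show "strongly_closed ?Q ?K H" if H: "subgroup H G" "H \<subseteq> ?Q" "card H = p ^ d" for H
      proof -
        have "HC_subgroup H G" using HC[OF H(1)] H(2,3) d by auto
        then show ?thesis using HC_strongly_closed[OF PG n _ H(3,2)] by blast
      qed
      show "strongly_closed ?Q ?K (powers y)"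
        if p2: "p = 2" and y: "y \<in> ?Q" "card (powers y) = p ^ Suc d" for y
      proof -
        have yc: "y \<in> carrier G" using subgroup_mem[OF QG y(1)] .
        have Y: "subgroup (powers y) G" "powers y \<subseteq> ?Q"
          using powers_subgroup[OF yc] powers_subset[OF QG y(1)] .
        obtain d' where d': "d = Suc d'" using d1 by (cases d) auto
        have "Suc d < n" using dq q(1) by simp
        then have "p ^ Suc d < p ^ n" using p_gt_1 by (rule power_strict_increasing)
        then have lt: "2 * card D < card P" using d n p2 by simp
        \<comment> \<open>Here |D| = 2^(d'+1); the factor 4 is the order of the quotient, and 2^d'
          that of the subgroup D1 in hypothesis (ii).\<close>
        have "card (powers y) = 2 ^ d' * 4" using y(2) p2 d' by simp
        from cyclic_quotient_of_powers[OF yc this]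
        obtain D1 where "D1 \<lhd> G\<lparr>carrier := powers y\<rparr>" "card D1 = 2 ^ d'"
          "cyclic_group (G\<lparr>carrier := powers y\<rparr> Mod D1)" "order (G\<lparr>carrier := powers y\<rparr> Mod D1) = 4" by auto
        moreover from this have "2 * card D1 = card D" using d d' p2 by simp
        ultimately have "HC_subgroup (powers y) G" using HC4[OF p2 lt Y(1)] Y(2) by blast
        then show ?thesis using HC_strongly_closed[OF PG n _ y(2) Y(2)] by blast
      qed
    qed
  qed
qed

end

text \<open>A common prime divisor would divide N and yet be at most p - 1.\<close>

lemma coprime_order_smallest_prime:
  fixes N p :: nat
  assumes "Factorial_Ring.prime p" "\<And>q. Factorial_Ring.prime q \<Longrightarrow> q dvd N \<Longrightarrow> p \<le> q"
  shows "coprime N (p - 1)"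
proof (rule ccontr)
  assume "\<not> coprime N (p - 1)"
  then have "gcd N (p - 1) \<noteq> 1" using coprime_iff_gcd_eq_1 by blast
  then obtain q where q: "Factorial_Ring.prime q" "q dvd gcd N (p - 1)" using prime_factor_nat by blast
  have "p - 1 > 0" using prime_gt_1_nat[OF assms(1)] by simp
  then have "q \<le> p - 1" using q(2) by (intro dvd_imp_le) auto
  moreover have "p \<le> q" using assms(2) q by simp
  ultimately show False using \<open>p - 1 > 0\<close> by simp
qed

theorem theorem3p1:
  fixes G :: "('a, 'b) monoid_scheme" and p :: nat and P :: "'a set"
  assumes "group G" and "finite (carrier G)"
    and "Factorial_Ring.prime p" and "p dvd order G"
    and "\<And>q. Factorial_Ring.prime q \<Longrightarrow> q dvd order G \<Longrightarrow> p \<le> q"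
    and "sylow_subgroup p P G"
    and "cyclic_group (G\<lparr>carrier := P\<rparr>) \<or>
      (\<exists>D. subgroup D G \<and> D \<subseteq> P \<and> 1 < card D \<and> card D < card P \<and>
        (\<forall>H. subgroup H G \<and> H \<subseteq> P \<and> card H = card D \<longrightarrow> HC_subgroup H G) \<and>
        (p = 2 \<and> subgroup_index (G\<lparr>carrier := P\<rparr>) D > 2 \<longrightarrow>
          (\<forall>H. subgroup H G \<and> H \<subseteq> P \<and>
            (\<exists>D1. D1 \<lhd> G\<lparr>carrier := H\<rparr> \<and> 2 * card D1 = card D \<and>
              cyclic_group (G\<lparr>carrier := H\<rparr> Mod D1) \<and>
              order (G\<lparr>carrier := H\<rparr> Mod D1) = 4) \<longrightarrow>
            HC_subgroup H G)))"
  shows "p_nilpotent p G"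
proof -
  interpret finite_group_prime G p
    using assms(1-3) by (simp add: finite_group_prime_def finite_group_prime_axioms_def)
  have cop: "coprime (order G) (p - 1)" by (rule coprime_order_smallest_prime[OF assms(3,5)])
  have PG: "subgroup P G" and cP: "card P = p ^ multiplicity p (order G)"
    using assms(6) by (auto simp: sylow_subgroup_def)
  have "order G \<noteq> 0" using fin order_gt_0_iff_finite by simp
  then obtain m where m: "order G = p ^ multiplicity p (order G) * m" "\<not> p dvd m"
    using multiplicity_decompose'[of "order G" p] prime_p by (metis not_prime_unit)
  have P: "sylow_in G p P (carrier G)"
    using PG subgroup_self subgroup_sub[OF PG] cP m unfolding sylow_in_def order_def by (metis mult.commute)
  show ?thesis
    using assms(7)
  proof (elim disjE exE conjE)
    assume "cyclic_group (G\<lparr>carrier := P\<rparr>)"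
    then obtain a where "a \<in> P" "P = powers a" using cyclic_group_powers[OF PG] by blast
    then show ?thesis using cyclic_sylow_p_nilpotent[OF cop P] by blast
  next
    fix D
    assume D: "subgroup D G" "D \<subseteq> P" "1 < card D" "card D < card P"
      and HC: "\<forall>H. subgroup H G \<and> H \<subseteq> P \<and> card H = card D \<longrightarrow> HC_subgroup H G"
      and HC4: "p = 2 \<and> subgroup_index (G\<lparr>carrier := P\<rparr>) D > 2 \<longrightarrow>
          (\<forall>H. subgroup H G \<and> H \<subseteq> P \<and>
            (\<exists>D1. D1 \<lhd> G\<lparr>carrier := H\<rparr> \<and> 2 * card D1 = card D \<and>
              cyclic_group (G\<lparr>carrier := H\<rparr> Mod D1) \<and>
              order (G\<lparr>carrier := H\<rparr> Mod D1) = 4) \<longrightarrow>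
            HC_subgroup H G)"
    have "group (G\<lparr>carrier := P\<rparr>)" "subgroup D (G\<lparr>carrier := P\<rparr>)"
      using subgroup_imp_group[OF PG] subgroup_incl[OF D(1) PG D(2)] .
    from group.lagrange[OF this]
    have idx: "subgroup_index (G\<lparr>carrier := P\<rparr>) D * card D = card P" by (simp add: subgroup_index_def order_def)
    show ?thesis
    proof (rule HC_sylow_p_nilpotent[OF cop P D(3,4,1,2)])
      show "HC_subgroup H G" if "subgroup H G" "H \<subseteq> P" "card H = card D" for H using HC that by blast
      show "HC_subgroup H G"
        if "p = 2" and lt: "2 * card D < card P" and H: "subgroup H G" "H \<subseteq> P"
          "\<exists>D1. D1 \<lhd> G\<lparr>carrier := H\<rparr> \<and> 2 * card D1 = card D \<and> cyclic_group (G\<lparr>carrier := H\<rparr> Mod D1) \<and>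
            order (G\<lparr>carrier := H\<rparr> Mod D1) = 4" for H
      proof -
        have "subgroup_index (G\<lparr>carrier := P\<rparr>) D > 2"
        proof (rule ccontr)
          assume "\<not> ?thesis"
          then have "subgroup_index (G\<lparr>carrier := P\<rparr>) D * card D \<le> 2 * card D" by (intro mult_le_mono1) simp
          then show False using lt idx by simp
        qed
        then show ?thesis using HC4 \<open>p = 2\<close> H by blast
      qed
    qed
  qed
qed

end
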